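(* Let $\Delta_u,\Delta_w,\delta_u,\delta_w$ be fixed natural numbers. For $n,m$ consider degree sequences (which may vary with $n,m$) satisfying $\Delta_u=d_1\ge d_2\ge\cdots\ge d_n=\delta_u>1$, $\Delta_w=d'_1\ge d'_2\ge\cdots\ge d'_m=\delta_w>1$, and $\sum_{i=1}^n d_i=\sum_{i=1}^m d'_i=\eta$. Let $\mathcal G$ be the set of all bipartite graphs (without parallel edges) with node set $(U,W)$, $U=\{u_1,\dots,u_n\}$, $W=\{w_1,\dots,w_m\}$, in which $u_i$ has degree $d_i$ and $w_i$ has degree $d'_i$, and let $G$ be chosen uniformly at random from $\mathcal G$. For even $i$ let $N_i=N_i(G)$ be the number of cycles of length $i$ in $G$. Then, as $n,m\to\infty$, for any fixed even $k\ge4$ the random variables $N_4,N_6,\dots,N_k$ are asymptotically independent Poisson random variables, i.e. for all fixed non-negative integers $x_4,x_6,\dots,x_k$, $$\Pr(N_4=x_4,\,N_6=x_6,\dots,N_k=x_k)-\prod_{c\in\{4,6,\dots,k\}}e^{-E(N_c)}\frac{E(N_c)^{x_c}}{x_c!}\longrightarrow 0,$$ where the expected values satisfy the following: with $$M_c=\frac1c\left(\Big(\frac2\eta\sum_{i=1}^n\binom{d_i}{2}\Big)\Big(\frac2\eta\sum_{i=1}^m\binom{d'_i}{2}\Big)\right)^{c/2},$$ $M_c$ is an asymptotic upper bound on $E(N_c)$ and $[S(h_u)S(h_w)]^{-c/2}M_c$ is an asymptotic lower bound on $E(N_c)$; that is, for each even $c$ with $4\le c\le k$ and every $\varepsilon>0$,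 for all sufficiently large $n,m$, $$(1-\varepsilon)\,[S(h_u)\,S(h_w)]^{-c/2}\,M_c\;\le\;E(N_c)\;\le\;(1+\varepsilon)\,M_c .$$ Here $h_u=\frac{\Delta_u(\Delta_u-1)}{\delta_u(\delta_u-1)}$, $h_w=\frac{\Delta_w(\Delta_w-1)}{\delta_w(\delta_w-1)}$, and $S$ is Specht's ratio.
   Context: Specht's ratio is $S(h)=\dfrac{(h-1)h^{1/(h-1)}}{e\log h}$ for $h>1$, where $e$ is Euler's number and $\log$ is the natural logarithm, and $S(1)=1$. A cycle of length $c$ in a graph is a closed path with $c$ distinct nodes, identified with its set of $c$ edges (so it is counted once, regardless of starting node and direction). *)

theory Defs
  imports "HOL-Probability.Probability"
begin

definition specht :: "real \<Rightarrow> real" where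
  "specht h = (if h = 1 then 1 else (h - 1) * h powr (1 / (h - 1)) / (exp 1 * ln h))"

definition degree_sequence :: "nat \<Rightarrow> (nat \<Rightarrow> nat) \<Rightarrow> nat \<Rightarrow> nat \<Rightarrow> bool" where
  "degree_sequence n d \<Delta> \<delta> \<longleftrightarrow> 1 \<le> n \<and> antimono_on {1..n} d \<and> d 1 = \<Delta> \<and> d n = \<delta>"

text \<open>A simple graph is given by its set of edges, an edge being the set of its two end nodes.\<close>

definition node_degree :: "'a set set \<Rightarrow> 'a \<Rightarrow> nat" where
  "node_degree G v = card {e \<in> G. v \<in> e}"

text \<open>A cycle is its edge set, so the starting node and the direction of the closed path
  given by the list \<open>vs\<close> do not matter. The edges of the path are pairwise distinct
  because \<open>3 \<le> c\<close>.\<close>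

definition is_cycle :: "'a set set \<Rightarrow> nat \<Rightarrow> 'a set set \<Rightarrow> bool" where
  "is_cycle G c C \<longleftrightarrow> 3 \<le> c \<and> C \<subseteq> G \<and>
     (\<exists>vs. length vs = c \<and> distinct vs \<and> C = {{vs ! i, vs ! ((i + 1) mod c)} | i. i < c})"

definition num_cycles :: "nat \<Rightarrow> 'a set set \<Rightarrow> nat" where
  "num_cycles c G = card {C. is_cycle G c C}"

text \<open>\<open>Inl i\<close> is the node \<open>u\<^sub>i\<close> and \<open>Inr j\<close> is the node \<open>w\<^sub>j\<close>.\<close>

definition bipartite_graphs ::
    "nat \<Rightarrow> (nat \<Rightarrow> nat) \<Rightarrow> nat \<Rightarrow> (nat \<Rightarrow> nat) \<Rightarrow> (nat + nat) set set set" where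
  "bipartite_graphs n d m d' =
     {G. G \<subseteq> {{Inl i, Inr j} | i j. i \<in> {1..n} \<and> j \<in> {1..m}} \<and>
         (\<forall>i\<in>{1..n}. node_degree G (Inl i) = d i) \<and>
         (\<forall>j\<in>{1..m}. node_degree G (Inr j) = d' j)}"

text \<open>If there is no graph with the given degrees, then \<open>pmf_of_set\<close> is unspecified; for
  bounded degrees with equal sums this does not happen once \<open>n\<close> and \<open>m\<close> are large.\<close>

definition random_graph ::
    "nat \<Rightarrow> (nat \<Rightarrow> nat) \<Rightarrow> nat \<Rightarrow> (nat \<Rightarrow> nat) \<Rightarrow> (nat + nat) set set pmf" where
  "random_graph n d m d' = pmf_of_set (bipartite_graphs n d m d')"

definition expected_cycles ::
    "nat \<Rightarrow> (nat \<Rightarrow> nat) \<Rightarrow> nat \<Rightarrow> (nat \<Rightarrow> nat) \<Rightarrow> nat \<Rightarrow> real" where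
  "expected_cycles n d m d' c =
     measure_pmf.expectation (random_graph n d m d') (\<lambda>G. real (num_cycles c G))"

definition cycle_bound ::
    "nat \<Rightarrow> nat \<Rightarrow> (nat \<Rightarrow> nat) \<Rightarrow> nat \<Rightarrow> (nat \<Rightarrow> nat) \<Rightarrow> nat \<Rightarrow> real" where
  "cycle_bound \<eta> n d m d' c =
     1 / real c *
     ((2 / real \<eta> * (\<Sum>i=1..n. real (d i choose 2))) *
      (2 / real \<eta> * (\<Sum>i=1..m. real (d' i choose 2)))) powr (real c / 2)"

definition degree_ratio :: "nat \<Rightarrow> nat \<Rightarrow> real" where
  "degree_ratio \<Delta> \<delta> = (real \<Delta> * (real \<Delta> - 1)) / (real \<delta> * (real \<delta> - 1))"

end

theory Submission
  imports Defs
begin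

text \<open>Everything is expressed through the number \<open>cnt H\<close> of graphs that contain a fixed set \<open>H\<close> of
  boundedly many edges. Exchanging an edge \<open>uw\<close> and a far edge \<open>u'w'\<close> for \<open>uw'\<close> and \<open>u'w\<close> is a
  bijection between graphs that shows
  \<open>cnt (H \<union> {uw}) = (d u - deg\<^sub>H u) (d w - deg\<^sub>H w) / \<eta> * cnt H\<close> up to a relative error of order
  \<open>1 / \<eta>\<close>. Adding the edges of disjoint cycles one by one and summing over all tuples of cycles
  gives products of the numbers \<open>M\<^sub>c\<close>. Graphs in which two distinct short cycles meet contribute only
  \<open>O(1 / \<eta>)\<close> to any moment, so the joint factorial moments of the cycle counts are asymptotic to
  those of independent Poisson variables, and Bonferroni's inequalities give the distribution.
  In particular \<open>E(N\<^sub>c)\<close> is asymptotic to \<open>M\<^sub>c\<close> itself, and the lower bound follows from \<open>S \<ge> 1\<close>.\<close>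

subsection \<open>Bipartite graphs with given degrees\<close>


text \<open>Switchings never leave the set of simple graphs, so nothing has to be conditioned on the
  absence of parallel edges, as it would be in a model that pairs up half-edges. Nothing is assumed
  to converge: the degree sequences may vary wildly, so every error constant is a function of
  \<open>D\<close> and \<open>L\<close> alone, and the Poisson parameters are only known to be
  bounded. The uniform distribution is unspecified on an empty set, so the existence of a graph with
  the given degrees has to be proved as well. The main obstacle is that factorial moments count
  tuples of distinct cycles, whereas adding edges step by step handles disjoint cycles. The two
  counts agree unless two short cycles meet, and then they differ by at most a power of the number
  of short cycles. Hence meeting pairs must be shown to be rare even when weighted by such powers.
  The estimates yield \<open>E(N\<^sub>c) - M\<^sub>c \<longlongrightarrow> 0\<close>, an additive
  statement. It becomes a relative one because minimum degree 2 forces \<open>M\<^sub>c\<close> to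
  be at least \<open>1 / c\<close>.\<close>

definition bedges :: "'a set \<Rightarrow> 'a set \<Rightarrow> 'a set set" where
  "bedges U W = {{u, w} | u w. u \<in> U \<and> w \<in> W}"

lemma bedges_commute: "bedges U W = bedges W U"
  unfolding bedges_def by (auto simp: insert_commute)

lemma bedgesI: "u \<in> U \<Longrightarrow> w \<in> W \<Longrightarrow> {u, w} \<in> bedges U W"
  unfolding bedges_def by blast

lemma bedgesE:
  assumes "e \<in> bedges U W"
  obtains u w where "u \<in> U" "w \<in> W" "e = {u, w}"
  using assms unfolding bedges_def by blast

lemma finite_bedges: "finite U \<Longrightarrow> finite W \<Longrightarrow> finite (bedges U W)"
proof -
  assume "finite U" "finite W"
  moreover have "bedges U W = (\<lambda>(u, w). {u, w}) ` (U \<times> W)"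
    unfolding bedges_def by auto
  ultimately show ?thesis by simp
qed

lemma node_degree_insert:
  assumes "finite G" "e \<notin> G"
  shows "node_degree (insert e G) v = node_degree G v + of_bool (v \<in> e)"
proof -
  have "{x \<in> insert e G. v \<in> x} = (if v \<in> e then insert e {x \<in> G. v \<in> x} else {x \<in> G. v \<in> x})"
    by auto
  then show ?thesis using assms unfolding node_degree_def by auto
qed

lemma node_degree_Un:
  assumes "finite G" "finite H" "G \<inter> H = {}"
  shows "node_degree (G \<union> H) v = node_degree G v + node_degree H v"
proof -
  have "{x \<in> G \<union> H. v \<in> x} = {x \<in> G. v \<in> x} \<union> {x \<in> H. v \<in> x}" by auto
  then show ?thesis using assms unfolding node_degree_def
    by (simp add: card_Un_disjoint disjoint_iff)
qed

lemma node_degree_Diff: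
  assumes "finite G" "H \<subseteq> G"
  shows "node_degree (G - H) v = node_degree G v - node_degree H v"
  using node_degree_Un[of "G - H" H v] assms finite_subset[of H G]
  by (simp add: Un_absorb2 Diff_disjoint Int_commute)

lemma node_degree_eq_0: "v \<notin> \<Union>G \<Longrightarrow> node_degree G v = 0"
  unfolding node_degree_def by (metis (mono_tags, lifting) Collect_empty_eq UnionI card.empty)

lemma node_degree_empty [simp]: "node_degree {} v = 0"
  by (simp add: node_degree_def)

lemma node_degree_eq_card_nbrs:
  assumes "G \<subseteq> bedges U W" "U \<inter> W = {}" "v \<in> U"
  shows "node_degree G v = card {w \<in> W. {v, w} \<in> G}"
proof -
  have "{e \<in> G. v \<in> e} = (\<lambda>w. {v, w}) ` {w \<in> W. {v, w} \<in> G}"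
  proof (intro equalityI subsetI)
    fix e assume "e \<in> {e \<in> G. v \<in> e}"
    then have e: "e \<in> G" "v \<in> e" by auto
    then obtain u w where uw: "u \<in> U" "w \<in> W" "e = {u, w}" using assms(1) by (blast elim: bedgesE)
    then have "v = u" using e assms by auto
    then show "e \<in> (\<lambda>w. {v, w}) ` {w \<in> W. {v, w} \<in> G}" using e uw by blast
  qed auto
  moreover have "inj_on (\<lambda>w. {v, w}) {w \<in> W. {v, w} \<in> G}"
    by (auto simp: inj_on_def doubleton_eq_iff)
  ultimately show ?thesis unfolding node_degree_def by (simp add: card_image)
qed

lemma sum_of_bool_eq_card:
  "finite A \<Longrightarrow> (\<Sum>x\<in>A. of_bool (P x)) = (of_nat (card {x \<in> A. P x}) :: 'b :: semiring_1)"
  by (simp add: Int_def)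

lemma sum_node_degree:
  assumes "G \<subseteq> bedges U W" "U \<inter> W = {}" "finite U" "finite W"
  shows "(\<Sum>v\<in>U. node_degree G v) = card G"
proof -
  have fin: "finite G" using assms finite_bedges finite_subset by blast
  have "(\<Sum>v\<in>U. node_degree G v) = (\<Sum>v\<in>U. \<Sum>e\<in>G. of_bool (v \<in> e))"
    unfolding node_degree_def using fin by (simp add: sum_of_bool_eq_card del: sum_of_bool_eq)
  also have "\<dots> = (\<Sum>e\<in>G. \<Sum>v\<in>U. of_bool (v \<in> e))" by (rule sum.swap)
  also have "\<dots> = (\<Sum>e\<in>G. 1)"
  proof (rule sum.cong)
    fix e assume "e \<in> G"
    then obtain u w where uw: "u \<in> U" "w \<in> W" "e = {u, w}" using assms(1) by (blast elim: bedgesE)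
    then have "{v \<in> U. v \<in> e} = {u}" using assms(2) by auto
    then show "(\<Sum>v\<in>U. of_bool (v \<in> e)) = (1::nat)" using assms(3)
      by (simp add: sum_of_bool_eq_card del: sum_of_bool_eq)
  qed simp
  finally show ?thesis by simp
qed

text \<open>There are at most \<open>D\<close> edges \<open>f\<close> at \<open>v\<close>, and each
  has two ends of degree at most \<open>D\<close>. This is the loss caused by edges too close to one
  of the two nodes fixed in a switching.\<close>

lemma card_touching_le:
  assumes "finite G" "\<And>v. node_degree G v \<le> D" "G \<subseteq> bedges U W"
  shows "card {e \<in> G. \<exists>f\<in>G. v \<in> f \<and> e \<inter> f \<noteq> {}} \<le> 2 * D\<^sup>2"
proof -
  let ?F = "{f \<in> G. v \<in> f}"
  have "{e \<in> G. \<exists>f\<in>G. v \<in> f \<and> e \<inter> f \<noteq> {}} \<subseteq> (\<Union>f\<in>?F. \<Union>x\<in>f. {e \<in> G. x \<in> e})"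
    by auto
  then have "card {e \<in> G. \<exists>f\<in>G. v \<in> f \<and> e \<inter> f \<noteq> {}} \<le> card (\<Union>f\<in>?F. \<Union>x\<in>f. {e \<in> G. x \<in> e})"
    by (rule card_mono[rotated]) (auto intro: finite_subset[OF _ assms(1)])
  also have "\<dots> \<le> (\<Sum>f\<in>?F. card (\<Union>x\<in>f. {e \<in> G. x \<in> e}))"
    by (rule card_UN_le) (use assms in auto)
  also have "\<dots> \<le> (\<Sum>f\<in>?F. 2 * D)"
  proof (rule sum_mono)
    fix f assume "f \<in> ?F"
    then obtain u w where f: "f = {u, w}" using assms(3) by (blast elim: bedgesE)
    have "card (\<Union>x\<in>f. {e \<in> G. x \<in> e}) \<le> (\<Sum>x\<in>f. card {e \<in> G. x \<in> e})"
      by (rule card_UN_le) (simp add: f)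
    also have "\<dots> \<le> (\<Sum>x\<in>f. D)"
      using assms(2) by (intro sum_mono) (simp add: node_degree_def)
    also have "\<dots> \<le> 2 * D" using card_2_iff[of f] f by (cases "u = w") auto
    finally show "card (\<Union>x\<in>f. {e \<in> G. x \<in> e}) \<le> 2 * D" .
  qed
  also have "\<dots> \<le> D * (2 * D)" using assms(2)[of v] by (simp add: node_degree_def)
  finally show ?thesis by (simp add: power2_eq_square mult_ac)
qed

text \<open>The edge sets whose containment is estimated have at most \<open>L\<close> edges. All error constants
  below depend on \<open>D\<close> and \<open>L\<close> only, so the estimates are uniform in the degree sequences.\<close>

locale bip_degrees =
  fixes U W :: "'a set" and d :: "'a \<Rightarrow> nat" and D \<eta> L :: nat
  assumes finite_U: "finite U" and finite_W: "finite W" and disj: "U \<inter> W = {}"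
    and d_ge: "v \<in> U \<union> W \<Longrightarrow> 2 \<le> d v" and d_le: "v \<in> U \<union> W \<Longrightarrow> d v \<le> D"
    and sum_U: "(\<Sum>v\<in>U. d v) = \<eta>" and sum_W: "(\<Sum>v\<in>W. d v) = \<eta>"
    and large: "2 * (L + 2 + 4 * D\<^sup>2) \<le> \<eta>"
begin

definition graphs :: "'a set set set" where
  "graphs = {G. G \<subseteq> bedges U W \<and> (\<forall>v\<in>U \<union> W. node_degree G v = d v)}"

definition cnt :: "'a set set \<Rightarrow> real" where
  "cnt H = real (card {G \<in> graphs. H \<subseteq> G})"

lemma finite_graphs: "finite graphs"
  unfolding graphs_def using finite_bedges[OF finite_U finite_W] by simp

lemma finite_graphs_sup: "finite {G \<in> graphs. H \<subseteq> G}"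
  using finite_graphs by simp

lemma cnt_nonneg: "0 \<le> cnt H" unfolding cnt_def by simp

text \<open>Double counting. It reduces a sum of containment counts to the question how many of the
  sets \<open>f i\<close> a single graph contains, which bounded degrees answer whenever these sets
  are confined to a neighbourhood of fixed nodes.\<close>

lemma sum_cnt:
  assumes "finite I"
  shows "(\<Sum>i\<in>I. cnt (f i)) = (\<Sum>G\<in>graphs. real (card {i \<in> I. f i \<subseteq> G}))"
proof -
  have "(\<Sum>i\<in>I. cnt (f i)) = (\<Sum>i\<in>I. \<Sum>G\<in>graphs. of_bool (f i \<subseteq> G))"
    unfolding cnt_def using finite_graphs by (simp add: sum_of_bool_eq_card del: sum_of_bool_eq)
  also have "\<dots> = (\<Sum>G\<in>graphs. \<Sum>i\<in>I. of_bool (f i \<subseteq> G))" by (rule sum.swap)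
  also have "\<dots> = (\<Sum>G\<in>graphs. real (card {i \<in> I. f i \<subseteq> G}))"
    using assms by (simp add: sum_of_bool_eq_card del: sum_of_bool_eq)
  finally show ?thesis .
qed

lemma graph_sub: "G \<in> graphs \<Longrightarrow> G \<subseteq> bedges U W"
  and graph_degree: "G \<in> graphs \<Longrightarrow> v \<in> U \<union> W \<Longrightarrow> node_degree G v = d v"
  unfolding graphs_def by auto

lemma graph_finite: "G \<in> graphs \<Longrightarrow> finite G"
  using graph_sub finite_bedges[OF finite_U finite_W] finite_subset by blast

lemma card_graph: "G \<in> graphs \<Longrightarrow> card G = \<eta>"
  using sum_node_degree[OF graph_sub disj finite_U finite_W] graph_degree sum_U by simp

lemma Union_bedges: "G \<subseteq> bedges U W \<Longrightarrow> \<Union>G \<subseteq> U \<union> W"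
  by (auto elim!: bedgesE dest!: subsetD)

lemma node_degree_le:
  assumes "G \<subseteq> bedges U W" "\<And>v. v \<in> U \<union> W \<Longrightarrow> node_degree G v \<le> d v"
  shows "node_degree G v \<le> D"
proof (cases "v \<in> U \<union> W")
  case True
  then show ?thesis using assms(2) d_le le_trans by blast
next
  case False
  then have "v \<notin> \<Union>G" using Union_bedges[OF assms(1)] by blast
  then show ?thesis by (simp add: node_degree_eq_0)
qed

lemma graph_degree_le: "G \<in> graphs \<Longrightarrow> node_degree G v \<le> D"
  by (rule node_degree_le) (auto simp: graph_sub graph_degree dest: subsetD[OF graph_sub])

lemma edge_eq_iff:
  assumes "u \<in> U" "u' \<in> U" "w \<in> W" "w' \<in> W"
  shows "{u, w} = {u', w'} \<longleftrightarrow> u = u' \<and> w = w'"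
  using assms disj by (auto simp: doubleton_eq_iff)

text \<open>An edge \<open>u'w'\<close> is useless only if \<open>u'\<close> is adjacent to
  \<open>w\<close> or \<open>w'\<close> to \<open>u\<close>, and then it touches an edge at
  \<open>w\<close> or at \<open>u\<close>. Degrees are only bounded by \<open>d\<close> here,
  because the existence proof applies this to a graph that does not yet attain its degrees.\<close>

lemma exists_far_edges:
  assumes "G \<subseteq> bedges U W" "\<And>v. v \<in> U \<union> W \<Longrightarrow> node_degree G v \<le> d v" "u \<in> U" "w \<in> W"
  shows "card G \<le> card {(u', w'). u' \<in> U \<and> w' \<in> W \<and> {u', w'} \<in> G \<and> {u, w'} \<notin> G \<and> {u', w} \<notin> G} + 4 * D\<^sup>2"
proof -
  let ?S = "{(u', w'). u' \<in> U \<and> w' \<in> W \<and> {u', w'} \<in> G \<and> {u, w'} \<notin> G \<and> {u', w} \<notin> G}"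
  let ?T = "\<lambda>v. {e \<in> G. \<exists>f\<in>G. v \<in> f \<and> e \<inter> f \<noteq> {}}"
  have fin: "finite G" using assms(1) finite_bedges[OF finite_U finite_W] finite_subset by blast
  have finS: "finite ?S"
    by (rule finite_subset[of _ "U \<times> W"]) (use finite_U finite_W in auto)
  have "G \<subseteq> (\<lambda>(u', w'). {u', w'}) ` ?S \<union> ?T u \<union> ?T w"
  proof
    fix e assume e: "e \<in> G"
    obtain u' w' where uw: "u' \<in> U" "w' \<in> W" "e = {u', w'}"
      by (rule bedgesE[OF subsetD[OF assms(1) e]])
    show "e \<in> (\<lambda>(u', w'). {u', w'}) ` ?S \<union> ?T u \<union> ?T w"
    proof (cases "{u, w'} \<in> G \<or> {u', w} \<in> G")
      case True
      moreover have "e \<in> ?T u" if "{u, w'} \<in> G"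
        using that e uw(3) by (auto intro!: bexI[of _ "{u, w'}"])
      moreover have "e \<in> ?T w" if "{u', w} \<in> G"
        using that e uw(3) by (auto intro!: bexI[of _ "{u', w}"])
      ultimately have "e \<in> ?T u \<union> ?T w" by blast
      then show ?thesis by blast
    next
      case False
      then have "(u', w') \<in> ?S" using e uw by blast
      then show ?thesis using uw(3) by force
    qed
  qed
  then have "card G \<le> card ((\<lambda>(u', w'). {u', w'}) ` ?S \<union> ?T u \<union> ?T w)"
    by (rule card_mono[rotated]) (use fin finS in auto)
  also have "\<dots> \<le> card ((\<lambda>(u', w'). {u', w'}) ` ?S) + card (?T u) + card (?T w)"
    by (meson card_Un_le add_mono order_trans le_refl)
  also have "\<dots> \<le> card ?S + 2 * D\<^sup>2 + 2 * D\<^sup>2"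
    by (intro add_mono card_image_le finS card_touching_le[OF fin _ assms(1)] node_degree_le[OF assms(1,2)])
  finally show ?thesis by simp
qed


subsection \<open>Switchings\<close>

definition switch :: "'a \<Rightarrow> 'a \<Rightarrow> 'a \<Rightarrow> 'a \<Rightarrow> 'a set set \<Rightarrow> 'a set set" where
  "switch u w u' w' G = (G - {{u, w}, {u', w'}}) \<union> {{u, w'}, {u', w}}"

text \<open>Every node loses and gains the same number of edges. The inverse is again a switching,
  with \<open>w\<close> and \<open>w'\<close> exchanged, so one definition serves both
  directions.\<close>

lemma switch_graph:
  assumes G: "G \<in> graphs" and mem: "u \<in> U" "w \<in> W" "u' \<in> U" "w' \<in> W"
    and e: "{u, w} \<in> G" "{u', w'} \<in> G" "{u, w'} \<notin> G" "{u', w} \<notin> G"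
  shows "switch u w u' w' G \<in> graphs"
    and "switch u w' u' w (switch u w u' w' G) = G"
proof -
  have ne: "u \<noteq> u'" "w \<noteq> w'" using e by auto
  have un: "u \<noteq> w" "u \<noteq> w'" "u' \<noteq> w" "u' \<noteq> w'" using mem disj by auto
  have dist: "{u, w} \<noteq> {u', w'}" "{u, w'} \<noteq> {u', w}"
    using ne mem by (simp_all add: edge_eq_iff)
  let ?R = "G - {{u, w}, {u', w'}}"
  have finR: "finite ?R" using graph_finite[OF G] by simp
  have G_eq: "G = insert {u, w} (insert {u', w'} ?R)" using e by auto
  have S_eq: "switch u w u' w' G = insert {u, w'} (insert {u', w} ?R)"
    unfolding switch_def by auto
  have "node_degree (switch u w u' w' G) v = node_degree G v" for v
  proof -
    have "node_degree G v = node_degree ?R v + of_bool (v \<in> {u', w'}) + of_bool (v \<in> {u, w})"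
      by (subst G_eq) (use finR dist in \<open>simp add: node_degree_insert\<close>)
    moreover have "node_degree (switch u w u' w' G) v
        = node_degree ?R v + of_bool (v \<in> {u', w}) + of_bool (v \<in> {u, w'})"
      unfolding S_eq using finR dist e by (simp add: node_degree_insert)
    moreover have "of_bool (v \<in> {u', w'}) + of_bool (v \<in> {u, w})
        = (of_bool (v \<in> {u', w}) + of_bool (v \<in> {u, w'}) :: nat)"
      using ne un by auto
    ultimately show ?thesis by simp
  qed
  moreover have "switch u w u' w' G \<subseteq> bedges U W"
    using graph_sub[OF G] mem by (auto simp: switch_def intro: bedgesI)
  ultimately show "switch u w u' w' G \<in> graphs"
    using graph_degree[OF G] unfolding graphs_def by simp
  show "switch u w' u' w (switch u w u' w' G) = G"
    using e dist unfolding switch_def by auto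
qed

text \<open>\<open>fwd\<close> and \<open>bwd\<close> are the switchings that destroy, respectively create, the edge \<open>uw\<close> and
  leave \<open>H\<close> alone; \<open>bad\<close> consists of the candidates for \<open>bwd\<close> that would create a double edge.\<close>

definition fwd :: "'a set set \<Rightarrow> 'a \<Rightarrow> 'a \<Rightarrow> 'a set set \<Rightarrow> ('a \<times> 'a) set" where
  "fwd H u w G = {(u', w'). u' \<in> U \<and> w' \<in> W \<and> {u', w'} \<in> G \<and> {u', w'} \<notin> H
     \<and> {u, w'} \<notin> G \<and> {u', w} \<notin> G}"

definition bwd :: "'a set set \<Rightarrow> 'a \<Rightarrow> 'a \<Rightarrow> 'a set set \<Rightarrow> ('a \<times> 'a) set" where
  "bwd H u w G = {(u', w'). u' \<in> U \<and> w' \<in> W \<and> {u, w'} \<in> G \<and> {u', w} \<in> G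
     \<and> {u, w'} \<notin> H \<and> {u', w} \<notin> H \<and> {u', w'} \<notin> G}"

lemma finite_pairs [simp]: "finite {(u', w'). u' \<in> U \<and> w' \<in> W \<and> P u' w'}"
  by (rule finite_subset[of _ "U \<times> W"]) (use finite_U finite_W in auto)

lemma finite_fwd [simp]: "finite (fwd H u w G)"
  and finite_bwd [simp]: "finite (bwd H u w G)"
  unfolding fwd_def bwd_def by simp_all

text \<open>The bijection is between pairs of a graph and a switching applicable to it: the
  conditions in \<open>fwd\<close> and \<open>bwd\<close> are those that make \<open>switch\<close>
  and its inverse land in the other set of pairs while keeping all edges of
  \<open>H\<close>.\<close>

lemma switching_count:
  assumes "u \<in> U" "w \<in> W" "{u, w} \<notin> H"
  shows "(\<Sum>G | G \<in> graphs \<and> insert {u, w} H \<subseteq> G. card (fwd H u w G))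
       = (\<Sum>G | G \<in> graphs \<and> H \<subseteq> G \<and> {u, w} \<notin> G. card (bwd H u w G))"
proof -
  let ?A = "{G \<in> graphs. insert {u, w} H \<subseteq> G}"
  let ?B = "{G \<in> graphs. H \<subseteq> G \<and> {u, w} \<notin> G}"
  let ?f = "\<lambda>(G, u', w'). (switch u w u' w' G, u', w')"
  let ?g = "\<lambda>(G, u', w'). (switch u w' u' w G, u', w')"
  have 1: "?f x \<in> Sigma ?B (bwd H u w) \<and> ?g (?f x) = x" if x: "x \<in> Sigma ?A (fwd H u w)" for x
  proof -
    obtain G u' w' where xe: "x = (G, u', w')" by (cases x)
    have G: "G \<in> graphs" "{u, w} \<in> G" "H \<subseteq> G" and
      uw: "u' \<in> U" "w' \<in> W" "{u', w'} \<in> G" "{u', w'} \<notin> H" "{u, w'} \<notin> G" "{u', w} \<notin> G"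
      using x xe by (auto simp: fwd_def)
    have ne: "u \<noteq> u'" "w \<noteq> w'" using G uw by auto
    have "H \<subseteq> switch u w u' w' G" "{u, w} \<notin> switch u w u' w' G"
      "{u', w'} \<notin> switch u w u' w' G" "{u, w'} \<in> switch u w u' w' G" "{u', w} \<in> switch u w u' w' G"
      using G uw assms ne by (auto simp: switch_def edge_eq_iff)
    moreover have "{u, w'} \<notin> H" "{u', w} \<notin> H" using G uw by auto
    ultimately show ?thesis
      using switch_graph[OF G(1) assms(1,2) uw(1,2) G(2) uw(3,5,6)] uw(1,2) xe
      by (simp add: bwd_def)
  qed
  have 2: "?g y \<in> Sigma ?A (fwd H u w) \<and> ?f (?g y) = y" if y: "y \<in> Sigma ?B (bwd H u w)" for y
  proof -
    obtain G u' w' where ye: "y = (G, u', w')" by (cases y)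
    have G: "G \<in> graphs" "{u, w} \<notin> G" "H \<subseteq> G" and
      uw: "u' \<in> U" "w' \<in> W" "{u', w'} \<notin> G" "{u, w'} \<notin> H" "{u', w} \<notin> H" "{u, w'} \<in> G" "{u', w} \<in> G"
      using y ye by (auto simp: bwd_def)
    have ne: "u \<noteq> u'" "w \<noteq> w'" using G uw by auto
    have "H \<subseteq> switch u w' u' w G" "{u, w} \<in> switch u w' u' w G"
      "{u', w'} \<in> switch u w' u' w G" "{u, w'} \<notin> switch u w' u' w G" "{u', w} \<notin> switch u w' u' w G"
      using G uw assms ne by (auto simp: switch_def edge_eq_iff)
    moreover have "{u', w'} \<notin> H" using G uw by auto
    ultimately show ?thesis
      using switch_graph[OF G(1) assms(1) uw(2) uw(1) assms(2) uw(6,7) G(2) uw(3)] uw(1,2) ye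
      by (simp add: fwd_def)
  qed
  have "bij_betw ?f (Sigma ?A (fwd H u w)) (Sigma ?B (bwd H u w))"
    by (rule bij_betw_byWitness[where f' = ?g]) (use 1 2 in blast)+
  then have "card (Sigma ?A (fwd H u w)) = card (Sigma ?B (bwd H u w))"
    by (rule bij_betw_same_card)
  then show ?thesis using finite_graphs by (simp add: card_SigmaI)
qed

lemma card_fwd:
  assumes "G \<in> graphs" "u \<in> U" "w \<in> W" "finite H"
  shows "\<eta> \<le> card (fwd H u w G) + card H + 4 * D\<^sup>2" and "card (fwd H u w G) \<le> \<eta>"
proof -
  let ?S = "{(u', w'). u' \<in> U \<and> w' \<in> W \<and> {u', w'} \<in> G \<and> {u, w'} \<notin> G \<and> {u', w} \<notin> G}"
  let ?T = "{(u', w'). u' \<in> U \<and> w' \<in> W \<and> {u', w'} \<in> H}"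
  have inj: "inj_on (\<lambda>(u', w'). {u', w'}) (U \<times> W)"
    by (auto simp: inj_on_def edge_eq_iff)
  have "card ?T \<le> card H"
    by (rule card_inj_on_le[where f = "\<lambda>(u', w'). {u', w'}"])
      (auto intro: inj_on_subset[OF inj] assms)
  moreover have "card ?S \<le> card (fwd H u w G \<union> ?T)"
    by (rule card_mono) (auto simp: fwd_def)
  moreover have "card (fwd H u w G \<union> ?T) \<le> card (fwd H u w G) + card ?T" by (rule card_Un_le)
  moreover have "card G \<le> card ?S + 4 * D\<^sup>2"
    by (rule exists_far_edges[OF graph_sub[OF assms(1)] _ assms(2,3)]) (simp add: graph_degree assms)
  ultimately show "\<eta> \<le> card (fwd H u w G) + card H + 4 * D\<^sup>2"
    using card_graph[OF assms(1)] by linarith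
  have "card (fwd H u w G) \<le> card G"
    by (rule card_inj_on_le[where f = "\<lambda>(u', w'). {u', w'}"])
      (auto simp: fwd_def graph_finite assms intro: inj_on_subset[OF inj])
  then show "card (fwd H u w G) \<le> \<eta>" using card_graph[OF assms(1)] by simp
qed

lemma card_fresh_nbrs:
  assumes "G \<in> graphs" "H \<subseteq> G"
  shows "u \<in> U \<Longrightarrow> card {w' \<in> W. {u, w'} \<in> G - H} = d u - node_degree H u"
    and "w \<in> W \<Longrightarrow> card {u' \<in> U. {u', w} \<in> G - H} = d w - node_degree H w"
proof -
  have deg: "node_degree (G - H) v = d v - node_degree H v" if "v \<in> U \<union> W" for v
    using node_degree_Diff[OF graph_finite[OF assms(1)] assms(2)] graph_degree[OF assms(1) that] by simp
  have sub: "G - H \<subseteq> bedges U W" using graph_sub[OF assms(1)] by blast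
  show "u \<in> U \<Longrightarrow> card {w' \<in> W. {u, w'} \<in> G - H} = d u - node_degree H u"
    using node_degree_eq_card_nbrs[OF sub disj] deg by simp
  have "G - H \<subseteq> bedges W U" "W \<inter> U = {}" using sub disj bedges_commute by blast+
  from node_degree_eq_card_nbrs[OF this] deg
  show "w \<in> W \<Longrightarrow> card {u' \<in> U. {u', w} \<in> G - H} = d w - node_degree H w"
    by (simp add: insert_commute)
qed

definition bad :: "'a set set \<Rightarrow> 'a \<Rightarrow> 'a \<Rightarrow> 'a set set \<Rightarrow> ('a \<times> 'a) set" where
  "bad H u w G = {(u', w'). u' \<in> U \<and> w' \<in> W \<and> {u, w'} \<in> G \<and> {u', w} \<in> G
     \<and> {u, w'} \<notin> H \<and> {u', w} \<notin> H \<and> {u', w'} \<in> G}"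

lemma finite_bad [simp]: "finite (bad H u w G)"
  unfolding bad_def by simp

text \<open>Candidates are pairs of an unprotected neighbour of \<open>w\<close> and an unprotected
  neighbour of \<open>u\<close>. Their number depends on \<open>H\<close> but not on
  \<open>G\<close>, which is where the main term comes from.\<close>

lemma card_bwd:
  assumes "G \<in> graphs" "H \<subseteq> G" "u \<in> U" "w \<in> W"
  shows "card (bwd H u w G) + card (bad H u w G) = (d u - node_degree H u) * (d w - node_degree H w)"
proof -
  have "bwd H u w G \<union> bad H u w G = {u' \<in> U. {u', w} \<in> G - H} \<times> {w' \<in> W. {u, w'} \<in> G - H}"
    by (auto simp: bwd_def bad_def)
  moreover have "bwd H u w G \<inter> bad H u w G = {}" by (auto simp: bwd_def bad_def)
  ultimately have "card (bwd H u w G) + card (bad H u w G)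
      = card ({u' \<in> U. {u', w} \<in> G - H} \<times> {w' \<in> W. {u, w'} \<in> G - H})"
    by (metis card_Un_disjoint finite_bwd finite_bad)
  then show ?thesis
    using card_fresh_nbrs[OF assms(1,2)] assms(3,4) by (simp add: card_cartesian_product mult.commute)
qed

section \<open>The effect of one more prescribed edge\<close>

lemma fresh_le: "v \<in> U \<union> W \<Longrightarrow> d v - h \<le> D"
  using d_le[of v] by linarith

lemma eta_pos: "0 < \<eta>" using large by presburger

text \<open>At least \<open>\<eta> / 2\<close> switchings destroy \<open>e\<close> in a graph that
  contains it, and at most \<open>D\<^sup>2\<close> create it in one that does not. This crude
  factor of order \<open>1 / \<eta>\<close> controls all error terms of the sharp estimate.\<close>

lemma cnt_insert_le:
  assumes "e \<in> bedges U W" "e \<notin> H" "finite H" "2 * (card H + 4 * D\<^sup>2) \<le> \<eta>"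
  shows "cnt (insert e H) \<le> 2 * D\<^sup>2 / \<eta> * cnt H"
proof -
  obtain u w where uw: "u \<in> U" "w \<in> W" and e: "e = {u, w}" using assms(1) by (rule bedgesE)
  let ?A = "{G \<in> graphs. insert {u, w} H \<subseteq> G}"
  let ?B = "{G \<in> graphs. H \<subseteq> G \<and> {u, w} \<notin> G}"
  have "\<eta> * card ?A = (\<Sum>G\<in>?A. \<eta>)" by simp
  also have "\<dots> \<le> (\<Sum>G\<in>?A. 2 * card (fwd H u w G))"
  proof (rule sum_mono)
    fix G assume "G \<in> ?A"
    then have "\<eta> \<le> card (fwd H u w G) + card H + 4 * D\<^sup>2" using card_fwd(1)[OF _ uw assms(3)] by blast
    then show "\<eta> \<le> 2 * card (fwd H u w G)" using assms(4) by presburger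
  qed
  also have "\<dots> = 2 * (\<Sum>G\<in>?B. card (bwd H u w G))"
    using switching_count[OF uw assms(2)[unfolded e]] by (simp only: sum_distrib_left[symmetric])
  also have "\<dots> \<le> 2 * (\<Sum>G\<in>?B. D\<^sup>2)"
  proof (intro mult_left_mono sum_mono)
    fix G assume G: "G \<in> ?B"
    have "card (bwd H u w G) \<le> (d u - node_degree H u) * (d w - node_degree H w)"
      using card_bwd[of G H u w] G uw by force
    also have "\<dots> \<le> D * D" by (intro mult_mono fresh_le) (use uw in auto)
    finally show "card (bwd H u w G) \<le> D\<^sup>2" by (simp add: power2_eq_square)
  qed simp
  also have "\<dots> = 2 * D\<^sup>2 * card ?B" by simp
  also have "\<dots> \<le> 2 * D\<^sup>2 * card {G \<in> graphs. H \<subseteq> G}"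
    by (intro mult_left_mono card_mono finite_graphs_sup) auto
  finally have "real (\<eta> * card ?A) \<le> real (2 * D\<^sup>2 * card {G \<in> graphs. H \<subseteq> G})"
    by (rule of_nat_mono)
  then have "\<eta> * cnt (insert e H) \<le> 2 * D\<^sup>2 * cnt H"
    by (simp add: cnt_def e)
  then show ?thesis using eta_pos by (simp add: field_simps)
qed

text \<open>A bad pair is a path \<open>u\<close>, \<open>w'\<close>, \<open>u'\<close>,
  \<open>w\<close> in \<open>G\<close>. Prescribing its edge \<open>uw'\<close> last costs a factor
  of order \<open>1 / \<eta>\<close>, while the other two edges form a path that starts at
  \<open>w\<close>, of which one graph has at most \<open>D\<^sup>2\<close>. The crude estimate is
  thus applied to sets of up to \<open>L + 2\<close> edges, which explains the bound on
  \<open>\<eta>\<close> in the locale.\<close>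

lemma sum_bad_le:
  assumes "u \<in> U" "w \<in> W" "{u, w} \<notin> H" "finite H" "card H \<le> L"
  shows "(\<Sum>G | G \<in> graphs \<and> H \<subseteq> G \<and> {u, w} \<notin> G. real (card (bad H u w G)))
      \<le> 2 * D\<^sup>2 / \<eta> * (D\<^sup>2 * cnt H)"
proof -
  let ?I = "{(u', w'). u' \<in> U \<and> w' \<in> W \<and> (u' \<noteq> u \<and> w' \<noteq> w \<and> {u, w'} \<notin> H)}"
  let ?H' = "\<lambda>(u', w'). {{u', w}, {u', w'}} \<union> H"
  let ?H = "\<lambda>(u', w'). insert {u, w'} ({{u', w}, {u', w'}} \<union> H)"
  have "(\<Sum>G | G \<in> graphs \<and> H \<subseteq> G \<and> {u, w} \<notin> G. real (card (bad H u w G)))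
      \<le> (\<Sum>G | G \<in> graphs \<and> H \<subseteq> G \<and> {u, w} \<notin> G. real (card {i \<in> ?I. ?H i \<subseteq> G}))"
  proof (intro sum_mono of_nat_mono card_mono)
    fix G assume "G \<in> {G \<in> graphs. H \<subseteq> G \<and> {u, w} \<notin> G}"
    then show "bad H u w G \<subseteq> {i \<in> ?I. ?H i \<subseteq> G}"
      by (auto simp: bad_def)
  qed simp
  also have "\<dots> \<le> (\<Sum>G\<in>graphs. real (card {i \<in> ?I. ?H i \<subseteq> G}))"
    by (rule sum_mono2) (use finite_graphs in auto)
  also have "\<dots> = (\<Sum>i\<in>?I. cnt (?H i))" by (rule sum_cnt[symmetric]) simp
  also have "\<dots> \<le> (\<Sum>i\<in>?I. 2 * D\<^sup>2 / \<eta> * cnt (?H' i))"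
  proof (rule sum_mono)
    fix i assume "i \<in> ?I"
    then obtain u' w' where i: "i = (u', w')" "u' \<in> U" "w' \<in> W" "u' \<noteq> u" "w' \<noteq> w" "{u, w'} \<notin> H" by auto
    have "card (?H' i) \<le> card {{u', w}, {u', w'}} + card H"
      using card_Un_le[of "{{u', w}, {u', w'}}" H] by (simp add: i(1))
    also have "\<dots> \<le> L + 2" using assms(5) by (simp add: card_insert_if)
    finally have "2 * (card (?H' i) + 4 * D\<^sup>2) \<le> \<eta>" using large by presburger
    then show "cnt (?H i) \<le> 2 * D\<^sup>2 / \<eta> * cnt (?H' i)"
      using cnt_insert_le[of "{u, w'}" "?H' i"] i assms by (auto simp: edge_eq_iff intro: bedgesI)
  qed
  also have "\<dots> = 2 * D\<^sup>2 / \<eta> * (\<Sum>i\<in>?I. cnt (?H' i))" by (simp add: sum_distrib_left)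
  also have "\<dots> \<le> 2 * D\<^sup>2 / \<eta> * (D\<^sup>2 * cnt H)"
  proof (rule mult_left_mono)
    have "(\<Sum>i\<in>?I. cnt (?H' i)) = (\<Sum>G\<in>graphs. real (card {i \<in> ?I. ?H' i \<subseteq> G}))"
      by (rule sum_cnt) simp
    also have "\<dots> \<le> (\<Sum>G\<in>graphs. if H \<subseteq> G then real (D\<^sup>2) else 0)"
    proof (rule sum_mono)
      fix G assume G: "G \<in> graphs"
      show "real (card {i \<in> ?I. ?H' i \<subseteq> G}) \<le> (if H \<subseteq> G then real (D\<^sup>2) else 0)"
      proof (cases "H \<subseteq> G")
        case True
        have "card {i \<in> ?I. ?H' i \<subseteq> G} \<le> card (SIGMA u':{u' \<in> U. {u', w} \<in> G}. {w' \<in> W. {u', w'} \<in> G})"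
          by (rule card_mono) (auto simp: finite_U finite_W)
        also have "\<dots> = (\<Sum>u' | u' \<in> U \<and> {u', w} \<in> G. card {w' \<in> W. {u', w'} \<in> G})"
          by (rule card_SigmaI) (auto simp: finite_U finite_W)
        also have "\<dots> \<le> (\<Sum>u' | u' \<in> U \<and> {u', w} \<in> G. D)"
          using card_fresh_nbrs(1)[OF G, of "{}"] d_le by (intro sum_mono) auto
        also have "\<dots> \<le> D * D"
          using card_fresh_nbrs(2)[OF G, of "{}" w] d_le[of w] assms(2) by simp
        finally have "card {i \<in> ?I. ?H' i \<subseteq> G} \<le> D\<^sup>2" by (simp add: power2_eq_square)
        then show ?thesis using True by simp
      next
        case False
        then have "{i \<in> ?I. ?H' i \<subseteq> G} = {}" by auto
        then show ?thesis using False by (simp only: card.empty) simp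
      qed
    qed
    also have "\<dots> = D\<^sup>2 * cnt H"
      using finite_graphs by (simp add: sum.If_cases cnt_def Int_def)
    finally show "(\<Sum>i\<in>?I. cnt (?H' i)) \<le> D\<^sup>2 * cnt H" .
  qed simp
  finally show ?thesis .
qed

text \<open>The switching identity is exact. Its deviations from the ideal count are supported on
  graphs that contain \<open>uw\<close> or have bad pairs, and both contribute only
  \<open>O(1 / \<eta>)\<close> times \<open>cnt H\<close>.\<close>

lemma cnt_insert_approx:
  assumes "u \<in> U" "w \<in> W" "{u, w} \<notin> H" "finite H" "card H \<le> L"
  shows "\<bar>cnt (insert {u, w} H) - (d u - node_degree H u) * (d w - node_degree H w) / \<eta> * cnt H\<bar>
      \<le> 2 * D\<^sup>2 * (L + 6 * D\<^sup>2) / \<eta>\<^sup>2 * cnt H"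
proof -
  let ?A = "{G \<in> graphs. insert {u, w} H \<subseteq> G}"
  let ?B = "{G \<in> graphs. H \<subseteq> G \<and> {u, w} \<notin> G}"
  define \<kappa> where "\<kappa> = real ((d u - node_degree H u) * (d w - node_degree H w))"
  define a where "a = cnt (insert {u, w} H)"
  define b where "b = (\<Sum>G\<in>?B. real (card (bad H u w G)))"
  define \<theta> where "\<theta> = (\<Sum>G\<in>?A. real \<eta> - real (card (fwd H u w G)))"
  have A: "card ?A = a" by (simp add: a_def cnt_def)
  have "{G \<in> graphs. H \<subseteq> G} = ?A \<union> ?B" "?A \<inter> ?B = {}" by auto
  then have "cnt H = a + real (card ?B)"
    unfolding cnt_def a_def using finite_graphs by (simp add: card_Un_disjoint)
  then have B: "real (card ?B) = cnt H - a" by simp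
  have \<kappa>: "0 \<le> \<kappa>" "\<kappa> \<le> D\<^sup>2"
  proof -
    have "(d u - node_degree H u) * (d w - node_degree H w) \<le> D * D"
      by (intro mult_mono fresh_le) (use assms in auto)
    then show "\<kappa> \<le> D\<^sup>2" unfolding \<kappa>_def power2_eq_square by (rule of_nat_mono)
  qed (simp add: \<kappa>_def)
  have "(\<Sum>G\<in>?A. real (card (fwd H u w G))) = (\<Sum>G\<in>?B. real (card (bwd H u w G)))"
    using arg_cong[OF switching_count[OF assms(1-3)], of real] by (simp only: of_nat_sum)
  also have "\<dots> = (\<Sum>G\<in>?B. \<kappa> - real (card (bad H u w G)))"
  proof (rule sum.cong)
    fix G assume "G \<in> ?B"
    then have "card (bwd H u w G) + card (bad H u w G) = (d u - node_degree H u) * (d w - node_degree H w)"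
      using card_bwd assms by blast
    then show "real (card (bwd H u w G)) = \<kappa> - real (card (bad H u w G))"
      unfolding \<kappa>_def by (metis add_diff_cancel_right' of_nat_add)
  qed simp
  also have "\<dots> = \<kappa> * (cnt H - a) - b" by (simp add: sum_subtractf B b_def mult.commute)
  finally have "(\<Sum>G\<in>?A. real (card (fwd H u w G))) = \<kappa> * (cnt H - a) - b" .
  \<comment> \<open>\<open>\<theta>\<close> collects the missing forward switchings,
    \<open>\<kappa> * a\<close> corrects for graphs that contain \<open>uw\<close> already, and
    \<open>b\<close> counts the bad pairs. They contribute \<open>L + 4 * D\<^sup>2\<close>,
    \<open>D\<^sup>2\<close> and \<open>D\<^sup>2\<close> to the factor
    \<open>L + 6 * D\<^sup>2\<close> below.\<close>
  then have eq: "\<eta> * a - \<kappa> * cnt H = \<theta> - (\<kappa> * a + b)"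
    unfolding \<theta>_def by (simp add: sum_subtractf A algebra_simps del: insert_subset)
  have a: "0 \<le> a" "a \<le> 2 * D\<^sup>2 / \<eta> * cnt H"
  proof -
    show "0 \<le> a" by (simp add: a_def cnt_nonneg)
    show "a \<le> 2 * D\<^sup>2 / \<eta> * cnt H" unfolding a_def
      by (rule cnt_insert_le) (use assms large in \<open>auto intro: bedgesI\<close>)
  qed
  have b: "0 \<le> b" "b \<le> 2 * D\<^sup>2 / \<eta> * (D\<^sup>2 * cnt H)"
    using sum_bad_le[OF assms] by (auto simp: b_def intro: sum_nonneg)
  have "\<theta> \<le> (\<Sum>G\<in>?A. real L + 4 * D\<^sup>2)"
    unfolding \<theta>_def
  proof (rule sum_mono)
    fix G assume "G \<in> ?A"
    then have "\<eta> \<le> card (fwd H u w G) + card H + 4 * D\<^sup>2" using card_fwd(1) assms by blast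
    then have "\<eta> \<le> card (fwd H u w G) + L + 4 * D\<^sup>2" using assms(5) by presburger
    then have "real \<eta> \<le> real (card (fwd H u w G) + L + 4 * D\<^sup>2)" by (rule of_nat_mono)
    then show "real \<eta> - real (card (fwd H u w G)) \<le> real L + 4 * D\<^sup>2" by simp
  qed
  also have "\<dots> = (L + 4 * D\<^sup>2) * a" by (simp add: A del: insert_subset)
  finally have \<theta>2: "\<theta> \<le> (L + 4 * D\<^sup>2) * a" .
  have \<theta>1: "0 \<le> \<theta>" unfolding \<theta>_def using card_fwd(2) assms by (intro sum_nonneg) auto
  define X where "X = 2 * D\<^sup>2 / \<eta> * cnt H"
  have X: "0 \<le> X" unfolding X_def by (simp add: cnt_nonneg)
  have "\<theta> \<le> (L + 4 * D\<^sup>2) * X"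
    using order_trans[OF \<theta>2 mult_left_mono[OF a(2)[folded X_def]]] by simp
  moreover have "\<kappa> * a \<le> D\<^sup>2 * X" using \<kappa> a unfolding X_def by (intro mult_mono) auto
  moreover have "b \<le> D\<^sup>2 * X" using b(2) by (simp add: X_def mult_ac)
  moreover have "0 \<le> \<kappa> * a" using \<kappa> a by simp
  moreover have "0 \<le> D\<^sup>2 * X" "0 \<le> L * X" using X by simp_all
  ultimately have "\<bar>\<eta> * a - \<kappa> * cnt H\<bar> \<le> (L + 6 * D\<^sup>2) * X"
    unfolding eq abs_le_iff using \<theta>1 b(1) by (simp add: algebra_simps)
  then have "\<bar>\<eta> * a - \<kappa> * cnt H\<bar> / \<eta> \<le> (L + 6 * D\<^sup>2) * X / \<eta>"
    by (rule divide_right_mono) simp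
  moreover have "\<bar>\<eta> * a - \<kappa> * cnt H\<bar> / \<eta> = \<bar>a - \<kappa> / \<eta> * cnt H\<bar>"
  proof -
    have "a - \<kappa> / \<eta> * cnt H = (\<eta> * a - \<kappa> * cnt H) / \<eta>" using eta_pos by (simp add: field_simps)
    then show ?thesis by simp
  qed
  moreover have "(L + 6 * D\<^sup>2) * X / \<eta> = 2 * D\<^sup>2 * (L + 6 * D\<^sup>2) / \<eta>\<^sup>2 * cnt H"
    by (simp add: X_def power2_eq_square mult_ac)
  ultimately show ?thesis unfolding a_def \<kappa>_def by simp
qed


text \<open>A maximal graph with degrees at most \<open>d\<close> attains them: otherwise nodes \<open>u\<close>, \<open>w\<close> with missing
  degree are adjacent, and replacing a far edge \<open>u'w'\<close> by \<open>uw'\<close> and \<open>u'w\<close> gives a larger graph.\<close>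

lemma graphs_nonempty: "graphs \<noteq> {}"
proof
  assume empty: "graphs = {}"
  define P where "P = {G. G \<subseteq> bedges U W \<and> (\<forall>v\<in>U \<union> W. node_degree G v \<le> d v)}"
  have fP: "finite P" unfolding P_def using finite_bedges[OF finite_U finite_W] by simp
  have "{} \<in> P" unfolding P_def by simp
  then have "Max (card ` P) \<in> card ` P" using fP by (intro Max_in) auto
  then obtain G where G: "G \<in> P" "card G = Max (card ` P)" by auto
  have max: "card G' \<le> card G" if "G' \<in> P" for G'
    using that fP unfolding G(2) by (intro Max_ge) auto
  have sub: "G \<subseteq> bedges U W" and deg: "\<And>v. v \<in> U \<union> W \<Longrightarrow> node_degree G v \<le> d v"
    using G by (auto simp: P_def)
  have fin: "finite G" using sub finite_bedges[OF finite_U finite_W] finite_subset by blast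
  have sums: "(\<Sum>v\<in>U. node_degree G v) = card G" "(\<Sum>v\<in>W. node_degree G v) = card G"
    using sum_node_degree[OF sub disj finite_U finite_W]
      sum_node_degree[OF sub[unfolded bedges_commute[of U]] _ finite_W finite_U] disj by auto
  define DU where "DU = {u \<in> U. node_degree G u < d u}"
  define DW where "DW = {w \<in> W. node_degree G w < d w}"
  have ne: "DU \<noteq> {}" "DW \<noteq> {}"
  proof -
    have no: "\<not> (\<forall>v\<in>U \<union> W. node_degree G v = d v)" using empty sub by (auto simp: graphs_def)
    have "DU = {} \<Longrightarrow> card G = \<eta>"
      unfolding sums(1)[symmetric] sum_U[symmetric] using deg
      by (intro sum.cong) (force simp: DU_def)+
    moreover have "DW = {} \<Longrightarrow> card G = \<eta>"
      unfolding sums(2)[symmetric] sum_W[symmetric] using deg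
      by (intro sum.cong) (force simp: DW_def)+
    moreover have "DU \<noteq> {} \<Longrightarrow> card G < \<eta>"
      unfolding sums(1)[symmetric] sum_U[symmetric] using deg
      by (intro sum_strict_mono_ex1) (auto simp: DU_def finite_U)
    moreover have "DW \<noteq> {} \<Longrightarrow> card G < \<eta>"
      unfolding sums(2)[symmetric] sum_W[symmetric] using deg
      by (intro sum_strict_mono_ex1) (auto simp: DW_def finite_W)
    moreover have "DU \<noteq> {} \<or> DW \<noteq> {}"
    proof (rule ccontr)
      assume "\<not> ?thesis"
      then have "\<not> node_degree G v < d v" if "v \<in> U \<union> W" for v using that by (auto simp: DU_def DW_def)
      then show False using no deg by (meson le_neq_implies_less)
    qed
    ultimately show "DU \<noteq> {}" "DW \<noteq> {}" by auto
  qed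
  have adj: "{u, w} \<in> G" if "u \<in> DU" "w \<in> DW" for u w
  proof (rule ccontr)
    assume new: "{u, w} \<notin> G"
    have "insert {u, w} G \<in> P"
      using that sub deg disj unfolding P_def DU_def DW_def
      by (auto simp: node_degree_insert[OF fin new] intro: bedgesI)
    then show False using max[of "insert {u, w} G"] new fin by simp
  qed
  obtain u w where uw: "u \<in> DU" "w \<in> DW" using ne by blast
  have uw': "u \<in> U" "w \<in> W" "node_degree G u < d u" "node_degree G w < d w"
    using uw by (auto simp: DU_def DW_def)
  \<comment> \<open>All deficient nodes of \<open>U\<close> are neighbours of \<open>w\<close> by
    \<open>adj\<close>, so there are at most \<open>D\<close> of them, and each lacks at most
    \<open>D\<close> edges.\<close>
  have "\<eta> \<le> card G + D\<^sup>2"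
  proof -
    have "{w} \<times> DU \<subseteq> {w} \<times> {v \<in> U. {w, v} \<in> G}"
      using adj[OF _ uw(2)] by (auto simp: DU_def insert_commute)
    then have "DU \<subseteq> {v \<in> U. {w, v} \<in> G}" by auto
    then have "card DU \<le> card {v \<in> U. {w, v} \<in> G}" by (rule card_mono[rotated]) (simp add: finite_U)
    also have "\<dots> = node_degree G w"
      using node_degree_eq_card_nbrs[OF sub[unfolded bedges_commute[of U]] disj[unfolded Int_commute[of U]] uw'(2)] by simp
    also have "\<dots> \<le> D" using node_degree_le[OF sub deg] .
    finally have cD: "card DU \<le> D" .
    have "\<eta> = (\<Sum>v\<in>U. d v)" by (simp add: sum_U)
    also have "\<dots> \<le> (\<Sum>v\<in>U. node_degree G v + (if v \<in> DU then D else 0))"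
      by (rule sum_mono) (use deg d_le in \<open>force simp: DU_def trans_le_add2 not_less\<close>)
    also have "\<dots> = card G + (\<Sum>v\<in>U. if v \<in> DU then D else 0)" by (simp add: sum.distrib sums)
    also have "(\<Sum>v\<in>U. if v \<in> DU then D else 0) = card DU * D"
    proof -
      have "{v \<in> U. v \<in> DU} = DU" by (auto simp: DU_def)
      then show ?thesis using finite_U by (simp add: sum.If_cases Int_def)
    qed
    also have "card DU * D \<le> D\<^sup>2" using cD by (simp add: power2_eq_square)
    finally show ?thesis by simp
  qed
  moreover have "card G \<le> card {(u', w'). u' \<in> U \<and> w' \<in> W \<and> {u', w'} \<in> G \<and> {u, w'} \<notin> G \<and> {u', w} \<notin> G} + 4 * D\<^sup>2"
    by (rule exists_far_edges[OF sub deg uw'(1,2)])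
  \<comment> \<open>Since \<open>G\<close> has at least \<open>\<eta> - D\<^sup>2\<close> edges,
    more than \<open>4 * D\<^sup>2\<close> of them are present, and some far edge remains.\<close>
  moreover have "4 + 5 * D\<^sup>2 \<le> \<eta>" by (rule order_trans[OF _ large]) simp
  ultimately have "card {(u', w'). u' \<in> U \<and> w' \<in> W \<and> {u', w'} \<in> G \<and> {u, w'} \<notin> G \<and> {u', w} \<notin> G} > 0"
    by linarith
  then obtain u' w' where far: "u' \<in> U" "w' \<in> W" "{u', w'} \<in> G" "{u, w'} \<notin> G" "{u', w} \<notin> G"
    by (auto simp: card_gt_0_iff)
  have dist: "u' \<noteq> u" "w' \<noteq> w" using far by auto
  let ?R = "G - {{u', w'}}"
  let ?G = "insert {u, w'} (insert {u', w} ?R)"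
  have finR: "finite ?R" using fin by simp
  have n1: "{u', w} \<notin> ?R" using far by auto
  have n2: "{u, w'} \<notin> insert {u', w} ?R" using far dist uw' by (auto simp: edge_eq_iff)
  have un: "u \<noteq> w" "u \<noteq> w'" "u' \<noteq> w" "u' \<noteq> w'" using far uw' disj by auto
  have deg': "node_degree ?G v = node_degree G v + of_bool (v = u) + of_bool (v = w)" for v
  proof -
    have "node_degree G v = node_degree (insert {u', w'} ?R) v" using far by (simp add: insert_absorb)
    also have "\<dots> = node_degree ?R v + of_bool (v \<in> {u', w'})" by (rule node_degree_insert[OF finR]) simp
    finally have "node_degree G v = node_degree ?R v + of_bool (v \<in> {u', w'})" .
    moreover have "node_degree ?G v = node_degree ?R v + of_bool (v \<in> {u', w}) + of_bool (v \<in> {u, w'})"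
      using node_degree_insert[OF _ n2] node_degree_insert[OF finR n1] finR by simp
    ultimately show ?thesis using un dist by auto
  qed
  have "?G \<subseteq> bedges U W" using sub far uw' by (auto intro: bedgesI)
  moreover have "node_degree ?G v \<le> d v" if "v \<in> U \<union> W" for v
    using deg[OF that] uw' un by (auto simp: deg')
  ultimately have "?G \<in> P" unfolding P_def by blast
  moreover have "card ?G = card G + 1"
    using finR n1 n2 far fin by (simp add: card_Diff_singleton card_gt_0_iff) (metis Suc_pred card_gt_0_iff empty_iff)
  ultimately show False using max[of ?G] by simp
qed

section \<open>The effect of a set of prescribed edges\<close>

definition falling_wt :: "'a set set \<Rightarrow> 'a set set \<Rightarrow> real" where
  "falling_wt H H' = (\<Prod>v\<in>U \<union> W. \<Prod>j<node_degree H' v. real (d v - node_degree H v - j))"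

definition edge_bound :: real where "edge_bound = 2 * D\<^sup>2"
definition edge_error :: real where "edge_error = 2 * D\<^sup>2 * (L + 6 * D\<^sup>2)"

lemma D_ge: "2 \<le> D"
proof -
  have "U \<noteq> {}" using sum_U eta_pos by auto
  then obtain u where "u \<in> U" by blast
  then show ?thesis using d_ge[of u] d_le[of u] by simp
qed

lemma edge_bound_ge: "1 \<le> edge_bound" and edge_bound_ge_sq: "real (D\<^sup>2) \<le> edge_bound" and edge_error_nonneg: "0 \<le> edge_error"
proof -
  have "(1::nat) \<le> D\<^sup>2" using D_ge by (simp add: power2_eq_square)
  then have "real 1 \<le> real (D\<^sup>2)" by (rule of_nat_mono)
  then show "1 \<le> edge_bound" "real (D\<^sup>2) \<le> edge_bound" unfolding edge_bound_def by simp_all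
qed (simp add: edge_error_def)

lemma falling_wt_insert:
  assumes "u \<in> U" "w \<in> W" "{u, w} \<notin> H'" "finite H'" "finite H" "H \<inter> H' = {}"
  shows "falling_wt H (insert {u, w} H') = falling_wt H H' *
    ((d u - node_degree (H \<union> H') u) * (d w - node_degree (H \<union> H') w))"
proof -
  let ?f = "\<lambda>v. \<Prod>j<node_degree H' v. real (d v - node_degree H v - j)"
  let ?g = "\<lambda>v. (if v = u then real (d u - node_degree (H \<union> H') u) else 1)
    * (if v = w then real (d w - node_degree (H \<union> H') w) else 1)"
  have uw: "u \<noteq> w" using assms disj by auto
  have fin: "finite (U \<union> W)" using finite_U finite_W by simp
  have "falling_wt H (insert {u, w} H') = (\<Prod>v\<in>U \<union> W. ?f v * ?g v)"
    unfolding falling_wt_def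
    by (rule prod.cong) (use uw assms in \<open>auto simp: node_degree_insert node_degree_Un\<close>)
  also have "\<dots> = falling_wt H H' * (\<Prod>v\<in>U \<union> W. ?g v)"
    by (simp add: prod.distrib falling_wt_def)
  also have "(\<Prod>v\<in>U \<union> W. ?g v) = real (d u - node_degree (H \<union> H') u) * real (d w - node_degree (H \<union> H') w)"
    using fin assms by (simp add: prod.distrib)
  finally show ?thesis by simp
qed

lemma cnt_Un_le:
  assumes "finite H" "finite H'" "H' \<subseteq> bedges U W" "H \<inter> H' = {}" "card H + card H' \<le> L"
  shows "cnt (H \<union> H') \<le> (edge_bound / \<eta>) ^ card H' * cnt H"
  using assms(2-)
proof (induction H' rule: finite_induct)
  case empty
  then show ?case by simp
next
  case (insert e H')
  have c: "card (H \<union> H') \<le> L" using card_Un_le[of H H'] insert by simp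
  then have "2 * (card (H \<union> H') + 4 * D\<^sup>2) \<le> \<eta>" using large by presburger
  then have "cnt (insert e (H \<union> H')) \<le> 2 * D\<^sup>2 / \<eta> * cnt (H \<union> H')"
    using insert assms(1) by (intro cnt_insert_le) auto
  also have "\<dots> \<le> 2 * D\<^sup>2 / \<eta> * ((edge_bound / \<eta>) ^ card H' * cnt H)"
    using insert by (intro mult_left_mono) auto
  finally show ?case using insert by (simp add: edge_bound_def mult_ac)
qed

text \<open>Each insertion adds an error of relative order \<open>1 / \<eta>\<^sup>2\<close> to a
  count already bounded by \<open>cnt_Un_le\<close>, and multiplies the old error by at most
  \<open>edge_bound / \<eta>\<close>. The errors of the \<open>card H'\<close> steps therefore all
  have the same order and add up.\<close>

lemma cnt_Un_approx:
  assumes "finite H" "finite H'" "H' \<subseteq> bedges U W" "H \<inter> H' = {}" "card H + card H' \<le> L"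
  shows "\<bar>cnt (H \<union> H') - falling_wt H H' / \<eta> ^ card H' * cnt H\<bar>
     \<le> card H' * edge_error * edge_bound ^ card H' / \<eta> ^ (card H' + 1) * cnt H"
  using assms(2-)
proof (induction H' rule: finite_induct)
  case empty
  then show ?case by (simp add: falling_wt_def)
next
  case (insert e H')
  obtain u w where uw: "u \<in> U" "w \<in> W" and e: "e = {u, w}"
    using bedgesE[of e U W] insert.prems by auto
  define s where "s = card H'"
  define \<kappa> where "\<kappa> = real ((d u - node_degree (H \<union> H') u) * (d w - node_degree (H \<union> H') w))"
  have c: "card (H \<union> H') \<le> L" using card_Un_le[of H H'] insert by simp
  have IH: "\<bar>cnt (H \<union> H') - falling_wt H H' / \<eta> ^ s * cnt H\<bar> \<le> s * edge_error * edge_bound ^ s / \<eta> ^ (s + 1) * cnt H"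
    using insert unfolding s_def by auto
  have step: "\<bar>cnt (insert e (H \<union> H')) - \<kappa> / \<eta> * cnt (H \<union> H')\<bar> \<le> edge_error / \<eta>\<^sup>2 * cnt (H \<union> H')"
    unfolding e edge_error_def \<kappa>_def
    by (rule cnt_insert_approx) (use uw insert assms(1) c e in auto)
  also have "\<dots> \<le> edge_error / \<eta>\<^sup>2 * ((edge_bound / \<eta>) ^ s * cnt H)"
    unfolding s_def using insert edge_error_nonneg assms(1) by (intro mult_left_mono cnt_Un_le) auto
  finally have 1: "\<bar>cnt (insert e (H \<union> H')) - \<kappa> / \<eta> * cnt (H \<union> H')\<bar> \<le> edge_error * edge_bound ^ s / \<eta> ^ (s + 2) * cnt H"
    by (simp add: power_divide power2_eq_square mult_ac)
  have \<kappa>: "0 \<le> \<kappa>" "\<kappa> \<le> edge_bound"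
  proof -
    have "(d u - node_degree (H \<union> H') u) * (d w - node_degree (H \<union> H') w) \<le> D * D"
      by (intro mult_mono fresh_le) (use uw in auto)
    then have "\<kappa> \<le> real (D\<^sup>2)" unfolding \<kappa>_def power2_eq_square by (rule of_nat_mono)
    then show "\<kappa> \<le> edge_bound" using edge_bound_ge_sq by simp
  qed (simp add: \<kappa>_def)
  have "\<kappa> / \<eta> * \<bar>cnt (H \<union> H') - falling_wt H H' / \<eta> ^ s * cnt H\<bar>
      \<le> edge_bound / \<eta> * (s * edge_error * edge_bound ^ s / \<eta> ^ (s + 1) * cnt H)"
    using IH \<kappa> by (intro mult_mono divide_right_mono) auto
  moreover have "falling_wt H (insert e H') = falling_wt H H' * \<kappa>"
    unfolding \<kappa>_def e using falling_wt_insert[OF uw] insert e assms(1) by simp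
  then have "\<kappa> / \<eta> * (cnt (H \<union> H') - falling_wt H H' / \<eta> ^ s * cnt H)
      = \<kappa> / \<eta> * cnt (H \<union> H') - falling_wt H (insert e H') / \<eta> ^ Suc s * cnt H"
    by (simp add: algebra_simps)
  then have "\<kappa> / \<eta> * \<bar>cnt (H \<union> H') - falling_wt H H' / \<eta> ^ s * cnt H\<bar>
      = \<bar>\<kappa> / \<eta> * cnt (H \<union> H') - falling_wt H (insert e H') / \<eta> ^ Suc s * cnt H\<bar>"
    using \<kappa>(1) by (metis abs_mult abs_of_nonneg divide_nonneg_nonneg of_nat_0_le_iff)
  ultimately have 2: "\<bar>\<kappa> / \<eta> * cnt (H \<union> H') - falling_wt H (insert e H') / \<eta> ^ Suc s * cnt H\<bar>
      \<le> edge_bound / \<eta> * (s * edge_error * edge_bound ^ s / \<eta> ^ (s + 1) * cnt H)" by simp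
  have "edge_error * edge_bound ^ s / \<eta> ^ (s + 2) * cnt H \<le> edge_error * edge_bound ^ Suc s / \<eta> ^ (s + 2) * cnt H"
    using edge_bound_ge edge_error_nonneg
    by (intro mult_right_mono divide_right_mono mult_left_mono) (auto simp: cnt_nonneg)
  with 1 2 have "\<bar>cnt (insert e (H \<union> H')) - falling_wt H (insert e H') / \<eta> ^ Suc s * cnt H\<bar>
     \<le> edge_error * edge_bound ^ Suc s / \<eta> ^ (s + 2) * cnt H + edge_bound / \<eta> * (s * edge_error * edge_bound ^ s / \<eta> ^ (s + 1) * cnt H)"
    by linarith
  also have "\<dots> = Suc s * edge_error * edge_bound ^ Suc s / \<eta> ^ (Suc s + 1) * cnt H"
    by (simp add: algebra_simps add_divide_distrib)
  finally show ?case using insert by (simp add: s_def)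
qed

end

subsection \<open>Alternating lists of distinct nodes\<close>

primrec alternating :: "'a set \<Rightarrow> 'a set \<Rightarrow> 'a list \<Rightarrow> bool" where
  "alternating A B [] \<longleftrightarrow> True"
| "alternating A B (x # xs) \<longleftrightarrow> x \<in> A \<and> alternating B A xs"

text \<open>\<open>X\<close> holds the nodes that are out of bounds: at first those of cycles chosen
  earlier, and in the recursion also those already on the list. The recursion exchanges
  \<open>A\<close> and \<open>B\<close>.\<close>

definition alt_lists :: "nat \<Rightarrow> 'a set \<Rightarrow> 'a set \<Rightarrow> 'a set \<Rightarrow> 'a list set" where
  "alt_lists l A B X = {vs. length vs = l \<and> distinct vs \<and> set vs \<inter> X = {} \<and> alternating A B vs}"

lemma alt_lists_0: "alt_lists 0 A B X = {[]}"
  unfolding alt_lists_def by auto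

lemma alt_lists_Suc:
  "alt_lists (Suc l) A B X = (\<lambda>(x, xs). x # xs) ` (SIGMA x:A - X. alt_lists l B A (insert x X))"
proof (intro equalityI subsetI)
  fix vs assume "vs \<in> alt_lists (Suc l) A B X"
  then obtain x xs where "vs = x # xs" "x \<in> A - X" "xs \<in> alt_lists l B A (insert x X)"
    unfolding alt_lists_def by (auto simp: length_Suc_conv)
  then show "vs \<in> (\<lambda>(x, xs). x # xs) ` (SIGMA x:A - X. alt_lists l B A (insert x X))" by force
qed (auto simp: alt_lists_def)

lemma finite_alt_lists: "finite A \<Longrightarrow> finite B \<Longrightarrow> finite (alt_lists l A B X)"
  by (induction l arbitrary: A B X) (simp_all add: alt_lists_0 alt_lists_Suc)

lemma sum_alt_lists_Suc:
  assumes "finite A" "finite B"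
  shows "(\<Sum>vs\<in>alt_lists (Suc l) A B X. f vs)
    = (\<Sum>x\<in>A - X. \<Sum>xs\<in>alt_lists l B A (insert x X). f (x # xs))"
  using assms unfolding alt_lists_Suc
  by (subst sum.reindex) (auto simp: inj_on_def sum.Sigma finite_alt_lists case_prod_unfold)

lemma card_alt_lists_le:
  assumes "finite A" "finite B" "card A \<le> N" "card B \<le> N"
  shows "card (alt_lists l A B X) \<le> N ^ l"
  using assms
proof (induction l arbitrary: A B X)
  case 0
  then show ?case by (simp add: alt_lists_0)
next
  case (Suc l)
  have "card (alt_lists (Suc l) A B X) = (\<Sum>vs\<in>alt_lists (Suc l) A B X. 1)" by simp
  also have "\<dots> = (\<Sum>x\<in>A - X. card (alt_lists l B A (insert x X)))"
    using Suc by (subst sum_alt_lists_Suc) simp_all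
  also have "\<dots> \<le> (\<Sum>x\<in>A - X. N ^ l)" using Suc by (intro sum_mono) auto
  also have "\<dots> \<le> (\<Sum>x\<in>A. N ^ l)" using Suc by (intro sum_mono2) auto
  also have "\<dots> \<le> N * N ^ l" using Suc by simp
  finally show ?case by simp
qed

primrec alt_prod :: "nat \<Rightarrow> real \<Rightarrow> real \<Rightarrow> real" where
  "alt_prod 0 a b = 1"
| "alt_prod (Suc l) a b = a * alt_prod l b a"

lemma alt_prod_even: "alt_prod (2 * l) a b = (a * b) ^ l"
  by (induction l) (simp_all add: mult_ac)

lemma alt_prod_bounds: "0 \<le> a \<Longrightarrow> a \<le> B \<Longrightarrow> 0 \<le> b \<Longrightarrow> b \<le> B \<Longrightarrow> 0 \<le> alt_prod l a b \<and> alt_prod l a b \<le> B ^ l"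
  by (induction l arbitrary: a b) (auto intro!: mult_mono)

text \<open>If repetitions and nodes of \<open>X\<close> were allowed, the sum would factor into
  \<open>alt_prod\<close>. At each of the \<open>l\<close> positions at most
  \<open>card X + l\<close> nodes are excluded, each of weight at most \<open>\<xi>\<close>, and the
  other \<open>l - 1\<close> positions contribute at most \<open>M\<close> each.\<close>

lemma sum_alt_lists_approx:
  fixes g :: "'a \<Rightarrow> real" and \<xi> M :: real
  assumes "finite A" "finite B" "\<And>v. v \<in> A \<union> B \<Longrightarrow> 0 \<le> g v \<and> g v \<le> \<xi>" "sum g A \<le> M" "sum g B \<le> M"
    "finite X" "0 \<le> \<xi>" "0 \<le> M"
  shows "(\<Sum>vs\<in>alt_lists l A B X. \<Prod>v\<in>set vs. g v) \<le> alt_prod l (sum g A) (sum g B)"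
    and "alt_prod l (sum g A) (sum g B) - l * (card X + l) * \<xi> * M ^ (l - 1)
      \<le> (\<Sum>vs\<in>alt_lists l A B X. \<Prod>v\<in>set vs. g v)"
proof -
  have "(\<Sum>vs\<in>alt_lists l A B X. \<Prod>v\<in>set vs. g v) \<le> alt_prod l (sum g A) (sum g B) \<and>
    alt_prod l (sum g A) (sum g B) - l * (card X + l) * \<xi> * M ^ (l - 1)
      \<le> (\<Sum>vs\<in>alt_lists l A B X. \<Prod>v\<in>set vs. g v)"
    using assms(1-6)
  proof (induction l arbitrary: A B X)
    case 0
    then show ?case by (simp add: alt_lists_0)
  next
    case (Suc l)
    let ?S = "\<lambda>X. \<Sum>vs\<in>alt_lists l B A X. \<Prod>v\<in>set vs. g v"
    let ?P = "alt_prod l (sum g B) (sum g A)"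
    \<comment> \<open>The summand \<open>1\<close> accounts for the node \<open>x\<close> that joins
      \<open>X\<close> in the recursive call.\<close>
    define \<epsilon> where "\<epsilon> = l * (card X + 1 + l) * \<xi> * M ^ (l - 1)"
    have \<epsilon>: "0 \<le> \<epsilon>" unfolding \<epsilon>_def using assms by simp
    have IH: "?S (insert x X) \<le> ?P \<and> ?P - \<epsilon> \<le> ?S (insert x X)" for x
    proof -
      have "?S (insert x X) \<le> ?P \<and> ?P - l * (card (insert x X) + l) * \<xi> * M ^ (l - 1) \<le> ?S (insert x X)"
        using Suc.prems Suc.IH[of B A "insert x X"] by (auto simp: Un_commute)
      moreover have "l * (card (insert x X) + l) * \<xi> * M ^ (l - 1) \<le> \<epsilon>"
      proof -
        have "l * (card (insert x X) + l) \<le> l * (card X + 1 + l)"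
          using Suc.prems by (intro mult_left_mono) (simp_all add: card_insert_if)
        then have "real (l * (card (insert x X) + l)) \<le> real (l * (card X + 1 + l))"
          by (rule of_nat_mono)
        then show ?thesis unfolding \<epsilon>_def using assms by (intro mult_right_mono) simp_all
      qed
      ultimately show ?thesis by linarith
    qed
    have eq: "(\<Sum>vs\<in>alt_lists (Suc l) A B X. \<Prod>v\<in>set vs. g v) = (\<Sum>x\<in>A - X. g x * ?S (insert x X))"
    proof (subst sum_alt_lists_Suc)
      show "(\<Sum>x\<in>A - X. \<Sum>xs\<in>alt_lists l B A (insert x X). prod g (set (x # xs)))
          = (\<Sum>x\<in>A - X. g x * ?S (insert x X))"
        by (intro sum.cong) (auto simp: alt_lists_def sum_distrib_left intro!: sum.cong)
    qed (use Suc in auto)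
    have P: "0 \<le> ?P" "?P \<le> M ^ l"
      using alt_prod_bounds[of "sum g B" M "sum g A" l] Suc.prems by (auto intro: sum_nonneg)
    have sX: "sum g (A - X) \<le> sum g A" using Suc.prems by (intro sum_mono2) auto
    have s0: "0 \<le> sum g (A - X)" using Suc.prems by (intro sum_nonneg) auto
    have "sum g A = sum g (A - X) + sum g (A \<inter> X)"
      using Suc.prems by (metis add.commute sum.Int_Diff)
    moreover have "sum g (A \<inter> X) \<le> card X * \<xi>"
    proof -
      have "sum g (A \<inter> X) \<le> card (A \<inter> X) * \<xi>" using Suc.prems by (intro sum_bounded_above) auto
      also have "\<dots> \<le> card X * \<xi>" using Suc.prems assms(7)
        by (intro mult_right_mono of_nat_mono card_mono) auto
      finally show ?thesis .
    qed
    ultimately have sl: "sum g A - card X * \<xi> \<le> sum g (A - X)" by linarith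
    have "(\<Sum>x\<in>A - X. g x * ?S (insert x X)) \<le> (\<Sum>x\<in>A - X. g x * ?P)"
      using IH Suc.prems by (intro sum_mono mult_left_mono) auto
    also have "\<dots> = sum g (A - X) * ?P" by (simp add: sum_distrib_right)
    also have "\<dots> \<le> sum g A * ?P" using sX P by (intro mult_right_mono)
    finally have up: "(\<Sum>x\<in>A - X. g x * ?S (insert x X)) \<le> alt_prod (Suc l) (sum g A) (sum g B)" by simp
    have "sum g (A - X) * (?P - \<epsilon>) = (\<Sum>x\<in>A - X. g x * (?P - \<epsilon>))" by (simp add: sum_distrib_right)
    also have "\<dots> \<le> (\<Sum>x\<in>A - X. g x * ?S (insert x X))"
      using IH Suc.prems by (intro sum_mono mult_left_mono) auto
    finally have low: "sum g (A - X) * (?P - \<epsilon>) \<le> (\<Sum>x\<in>A - X. g x * ?S (insert x X))" .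
    have "(sum g A - card X * \<xi>) * ?P \<le> sum g (A - X) * ?P" using sl P by (intro mult_right_mono)
    moreover have "card X * \<xi> * ?P \<le> card X * \<xi> * M ^ l"
      using P assms(7) by (intro mult_left_mono) auto
    moreover have "sum g (A - X) * \<epsilon> \<le> M * \<epsilon>"
      using sX Suc.prems \<epsilon> by (intro mult_right_mono) auto
    moreover have "M * \<epsilon> + card X * \<xi> * M ^ l \<le> Suc l * (card X + Suc l) * \<xi> * M ^ l"
    proof -
      have "M * \<epsilon> = l * (card X + 1 + l) * \<xi> * M ^ l"
        unfolding \<epsilon>_def by (cases l) auto
      moreover have "(l * (card X + 1 + l) + card X) * (\<xi> * M ^ l) \<le> (Suc l * (card X + Suc l)) * (\<xi> * M ^ l)"
      proof (rule mult_right_mono)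
        have "l * (card X + 1 + l) + card X \<le> Suc l * (card X + Suc l)" by simp
        then show "real (l * (card X + 1 + l) + card X) \<le> real (Suc l * (card X + Suc l))"
          by (rule of_nat_mono)
      qed (use assms in simp)
      ultimately show ?thesis by (simp add: algebra_simps)
    qed
    ultimately have "alt_prod (Suc l) (sum g A) (sum g B) - Suc l * (card X + Suc l) * \<xi> * M ^ (Suc l - 1)
        \<le> sum g (A - X) * (?P - \<epsilon>)"
      by (simp add: algebra_simps)
    then show ?case unfolding eq using up low by linarith
  qed
  then show "(\<Sum>vs\<in>alt_lists l A B X. \<Prod>v\<in>set vs. g v) \<le> alt_prod l (sum g A) (sum g B)"
    and "alt_prod l (sum g A) (sum g B) - l * (card X + l) * \<xi> * M ^ (l - 1)
      \<le> (\<Sum>vs\<in>alt_lists l A B X. \<Prod>v\<in>set vs. g v)" by blast+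
qed


subsection \<open>Cycles as edge sets\<close>

definition cyc_edge :: "'a list \<Rightarrow> nat \<Rightarrow> 'a set" where
  "cyc_edge vs i = {vs ! i, vs ! ((i + 1) mod length vs)}"

definition cyc_edges :: "'a list \<Rightarrow> 'a set set" where
  "cyc_edges vs = cyc_edge vs ` {..<length vs}"

lemma is_cycle_iff:
  "is_cycle G c C \<longleftrightarrow> 3 \<le> c \<and> C \<subseteq> G \<and> (\<exists>vs. length vs = c \<and> distinct vs \<and> C = cyc_edges vs)"
proof -
  have "{{vs ! i, vs ! ((i + 1) mod c)} | i. i < c} = cyc_edges vs" if "length vs = c" for vs :: "'a list"
    using that by (auto simp: cyc_edges_def cyc_edge_def)
  then show ?thesis unfolding is_cycle_def by (simp cong: conj_cong)
qed

lemma Suc_mod_if: "(i::nat) < c \<Longrightarrow> (i + 1) mod c = (if i + 1 = c then 0 else i + 1)"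
  by auto

lemma Union_cyc_edges: "\<Union>(cyc_edges vs) = set vs"
proof (intro equalityI subsetI)
  fix x assume "x \<in> \<Union>(cyc_edges vs)"
  then obtain i where i: "i < length vs" "x \<in> {vs ! i, vs ! ((i + 1) mod length vs)}"
    by (auto simp: cyc_edges_def cyc_edge_def)
  then have "(i + 1) mod length vs < length vs" by (intro mod_less_divisor) auto
  then show "x \<in> set vs" using i by auto
next
  fix x assume "x \<in> set vs"
  then obtain i where "i < length vs" "x = vs ! i" by (auto simp: in_set_conv_nth)
  then show "x \<in> \<Union>(cyc_edges vs)" by (auto simp: cyc_edges_def cyc_edge_def)
qed

text \<open>The conditional is the cyclic predecessor of \<open>j\<close>, spelled out because
  subtraction on natural numbers stops at 0.\<close>

lemma mem_cyc_edge_iff: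
  assumes "distinct vs" "i < length vs" "j < length vs"
  shows "vs ! j \<in> cyc_edge vs i \<longleftrightarrow> i = j \<or> i = (if j = 0 then length vs - 1 else j - 1)"
proof -
  have "(i + 1) mod length vs < length vs" using assms by (intro mod_less_divisor) auto
  then have "vs ! j \<in> cyc_edge vs i \<longleftrightarrow> j = i \<or> j = (i + 1) mod length vs"
    using assms by (simp add: cyc_edge_def nth_eq_iff_index_eq)
  also have "\<dots> \<longleftrightarrow> i = j \<or> i = (if j = 0 then length vs - 1 else j - 1)"
    unfolding Suc_mod_if[OF assms(2)] using assms by auto
  finally show ?thesis .
qed

lemma edges_at_cycle_node:
  assumes "distinct vs" "j < length vs"
  shows "{e \<in> cyc_edges vs. vs ! j \<in> e}
    = {cyc_edge vs j, cyc_edge vs (if j = 0 then length vs - 1 else j - 1)}"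
proof -
  have p: "(if j = 0 then length vs - 1 else j - 1) < length vs" using assms by auto
  show ?thesis
    using mem_cyc_edge_iff[OF assms(1) _ assms(2)] assms(2) p unfolding cyc_edges_def
    by (auto simp del: One_nat_def)
qed

lemma inj_cyc_edge:
  assumes "distinct vs" "3 \<le> length vs"
  shows "inj_on (cyc_edge vs) {..<length vs}"
proof (rule inj_onI)
  fix i j assume ij: "i \<in> {..<length vs}" "j \<in> {..<length vs}" "cyc_edge vs i = cyc_edge vs j"
  then have i: "i < length vs" and j: "j < length vs" by auto
  have "vs ! i \<in> cyc_edge vs j" "vs ! j \<in> cyc_edge vs i" using ij(3) by (auto simp: cyc_edge_def)
  then show "i = j"
    using assms(2) i j unfolding mem_cyc_edge_iff[OF assms(1) i j] mem_cyc_edge_iff[OF assms(1) j i]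
    by (auto split: if_splits)
qed

lemma card_cyc_edges: "distinct vs \<Longrightarrow> 3 \<le> length vs \<Longrightarrow> card (cyc_edges vs) = length vs"
  unfolding cyc_edges_def by (simp add: card_image inj_cyc_edge)

lemma finite_cyc_edges [simp]: "finite (cyc_edges vs)"
  unfolding cyc_edges_def by simp

lemma node_degree_cyc_edges:
  assumes "distinct vs" "3 \<le> length vs" "v \<in> set vs"
  shows "node_degree (cyc_edges vs) v = 2"
proof -
  obtain j where j: "j < length vs" "v = vs ! j" using assms(3) by (auto simp: in_set_conv_nth)
  have "j \<noteq> (if j = 0 then length vs - 1 else j - 1)" "(if j = 0 then length vs - 1 else j - 1) < length vs"
    using j assms(2) by auto
  then have "cyc_edge vs j \<noteq> cyc_edge vs (if j = 0 then length vs - 1 else j - 1)"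
    using inj_onD[OF inj_cyc_edge[OF assms(1,2)], of j] j(1) by (metis lessThan_iff)
  then show ?thesis
    unfolding node_degree_def j(2) edges_at_cycle_node[OF assms(1) j(1)] by simp
qed

lemma cyc_edges_rotate1: "cyc_edges (rotate1 vs) = cyc_edges vs"
proof -
  let ?c = "length vs"
  have "cyc_edges (rotate1 vs) = (\<lambda>i. cyc_edge vs ((i + 1) mod ?c)) ` {..<?c}"
    unfolding cyc_edges_def length_rotate1
  proof (rule image_cong)
    fix i assume i: "i \<in> {..<?c}"
    then have "(i + 1) mod ?c < ?c" by (intro mod_less_divisor) auto
    then show "cyc_edge (rotate1 vs) i = cyc_edge vs ((i + 1) mod ?c)"
      using i by (simp add: cyc_edge_def nth_rotate1)
  qed simp
  also have "\<dots> = cyc_edge vs ` ((\<lambda>i. (i + 1) mod ?c) ` {..<?c})" by (simp add: image_image)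
  also have "(\<lambda>i. (i + 1) mod ?c) ` {..<?c} = {..<?c}"
  proof (intro equalityI subsetI)
    fix j assume j: "j \<in> {..<?c}"
    show "j \<in> (\<lambda>i. (i + 1) mod ?c) ` {..<?c}"
    proof (cases "j = 0")
      case True
      then show ?thesis using j by (intro image_eqI[of _ _ "?c - 1"]) auto
    next
      case False
      then show ?thesis using j by (intro image_eqI[of _ _ "j - 1"]) auto
    qed
  qed (auto intro!: mod_less_divisor)
  finally show ?thesis unfolding cyc_edges_def .
qed

lemma cyc_edges_rotate: "cyc_edges (rotate n vs) = cyc_edges vs"
  by (induction n) (simp_all add: cyc_edges_rotate1)

lemma cyc_edges_rev: "cyc_edges (rev vs) = cyc_edges vs"
proof -
  let ?c = "length vs"
  have sub: "cyc_edges (rev vs) \<subseteq> cyc_edges vs" for vs :: "'b list"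
  proof
    let ?c = "length vs"
    fix e assume "e \<in> cyc_edges (rev vs)"
    then obtain i where i: "i < ?c" "e = cyc_edge (rev vs) i" by (auto simp: cyc_edges_def)
    show "e \<in> cyc_edges vs"
    proof (cases "i + 1 = ?c")
      case True
      then have "(i + 1) mod ?c = 0" "rev vs ! i = vs ! 0" "rev vs ! 0 = vs ! (?c - 1)"
        using i(1) by (auto simp: rev_nth simp flip: length_greater_0_conv)
      then have "e = {vs ! 0, vs ! (?c - 1)}" using i(2) by (simp add: cyc_edge_def)
      also have "\<dots> = cyc_edge vs (?c - 1)"
      proof -
        have "?c - 1 + 1 = ?c" using i by simp
        then show ?thesis by (simp only: cyc_edge_def mod_self insert_commute)
      qed
      finally show ?thesis using i by (auto simp: cyc_edges_def)
    next
      case False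
      then have lt: "i + 1 < ?c" using i by simp
      then have "e = {vs ! (?c - 2 - i + 1), vs ! (?c - 2 - i)}"
        using i by (auto simp: cyc_edge_def rev_nth Suc_diff_Suc numeral_2_eq_2)
      also have "\<dots> = cyc_edge vs (?c - 2 - i)" using lt by (auto simp: cyc_edge_def)
      finally show ?thesis using lt by (auto simp: cyc_edges_def)
    qed
  qed
  from sub[of vs] sub[of "rev vs"] show ?thesis by simp
qed

text \<open>Both cycles have degree two at a common node, so the smaller edge set contains both
  edges of the larger one there. Walking around \<open>vs\<close> from a common node therefore never
  leaves the smaller cycle.\<close>

lemma cycle_subset_eq:
  assumes "distinct vs" "3 \<le> length vs" "distinct ws" "3 \<le> length ws"
    and sub: "cyc_edges ws \<subseteq> cyc_edges vs"
  shows "cyc_edges ws = cyc_edges vs"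
proof -
  let ?C = "cyc_edges ws" and ?c = "length vs"
  have sets: "set ws \<subseteq> set vs" using sub Union_cyc_edges by (metis Union_mono)
  have step: "cyc_edge vs i \<in> ?C" if "i < ?c" "vs ! i \<in> set ws" for i
  proof -
    have "{e \<in> ?C. vs ! i \<in> e} = {e \<in> cyc_edges vs. vs ! i \<in> e}"
    proof (rule card_subset_eq)
      show "card {e \<in> ?C. vs ! i \<in> e} = card {e \<in> cyc_edges vs. vs ! i \<in> e}"
        using node_degree_cyc_edges[OF assms(1,2)] node_degree_cyc_edges[OF assms(3,4)] that sets
        unfolding node_degree_def by (metis subsetD)
    qed (use sub in auto)
    moreover have "cyc_edge vs i \<in> cyc_edges vs" "vs ! i \<in> cyc_edge vs i"
      using that by (auto simp: cyc_edges_def cyc_edge_def)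
    ultimately show ?thesis by blast
  qed
  have c: "0 < ?c" using assms(2) by linarith
  have "ws ! 0 \<in> set ws" using assms(4) by (intro nth_mem) linarith
  then have "ws ! 0 \<in> set vs" using sets by blast
  then obtain i0 where i0: "i0 < ?c" "vs ! i0 = ws ! 0" by (auto simp: in_set_conv_nth)
  have reach: "vs ! ((i0 + n) mod ?c) \<in> set ws" for n
  proof (induction n)
    case 0
    have "ws ! 0 \<in> set ws" using assms(4) by (intro nth_mem) linarith
    then show ?case using i0 by simp
  next
    case (Suc n)
    have "cyc_edge vs ((i0 + n) mod ?c) \<in> ?C" by (rule step[OF mod_less_divisor[OF c] Suc])
    moreover have "vs ! ((i0 + Suc n) mod ?c) \<in> cyc_edge vs ((i0 + n) mod ?c)"
      by (simp add: cyc_edge_def mod_Suc_eq)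
    ultimately show ?case using Union_cyc_edges[of ws] by blast
  qed
  have "cyc_edge vs j \<in> ?C" if j: "j < ?c" for j
  proof -
    \<comment> \<open>Adding \<open>?c\<close> before subtracting \<open>i0\<close> keeps the
      difference from being truncated when \<open>j < i0\<close>.\<close>
    have "(i0 + (j + ?c - i0)) mod ?c = j" using i0 j by simp
    then have "vs ! j \<in> set ws" using reach[of "j + ?c - i0"] by simp
    then show ?thesis by (rule step[OF j])
  qed
  then have "cyc_edges vs \<subseteq> ?C" unfolding cyc_edges_def[of vs] by blast
  then show ?thesis using sub by blast
qed

lemma alternating_iff: "alternating A B vs \<longleftrightarrow> (\<forall>i<length vs. vs ! i \<in> (if even i then A else B))"
proof (induction vs arbitrary: A B)
  case (Cons x xs)
  show ?case by (auto simp: Cons less_Suc_eq_0_disj nth_Cons split: nat.splits)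
qed simp

lemma alternating_rotate:
  assumes "alternating A B vs" "even (length vs)"
  shows "even m \<Longrightarrow> alternating A B (rotate m vs)" and "odd m \<Longrightarrow> alternating B A (rotate m vs)"
proof -
  have "rotate m vs ! i \<in> (if even (m + i) then A else B)" if "i < length vs" for i
  proof -
    have "(m + i) mod length vs < length vs" using that by (intro mod_less_divisor) auto
    moreover have "even ((m + i) mod length vs) \<longleftrightarrow> even (m + i)"
      using assms(2) by (simp add: dvd_mod_iff)
    ultimately have "vs ! ((m + i) mod length vs) \<in> (if even (m + i) then A else B)"
      using assms(1) unfolding alternating_iff by metis
    then show ?thesis using that by (simp add: nth_rotate)
  qed
  note key = this
  show "alternating A B (rotate m vs)" if "even m"
    unfolding alternating_iff length_rotate
  proof (intro allI impI)
    fix i assume "i < length vs"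
    from key[OF this] show "rotate m vs ! i \<in> (if even i then A else B)" using that by simp
  qed
  show "alternating B A (rotate m vs)" if "odd m"
    unfolding alternating_iff length_rotate
  proof (intro allI impI)
    fix i assume "i < length vs"
    from key[OF this] show "rotate m vs ! i \<in> (if even i then B else A)"
      using that by (simp split: if_splits)
  qed
qed

lemma alternating_rev:
  assumes "alternating A B vs" "even (length vs)"
  shows "alternating B A (rev vs)"
  unfolding alternating_iff
proof (intro allI impI)
  fix i assume i: "i < length (rev vs)"
  then have "length vs - Suc i < length vs" "even (length vs - Suc i) \<longleftrightarrow> odd i"
    using assms(2) by auto
  then have "vs ! (length vs - Suc i) \<in> (if odd i then A else B)"
    using assms(1) unfolding alternating_iff by metis
  then show "rev vs ! i \<in> (if even i then B else A)" using i by (simp add: rev_nth split: if_splits)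
qed

lemma alternating_subset: "alternating A B vs \<Longrightarrow> set vs \<subseteq> A \<union> B"
  by (induction vs arbitrary: A B) auto

lemma alternating_cyc_edges:
  assumes "alternating U W vs" "even (length vs)"
  shows "cyc_edges vs \<subseteq> bedges U W"
proof
  fix e assume "e \<in> cyc_edges vs"
  then obtain i where i: "i < length vs" "e = {vs ! i, vs ! ((i + 1) mod length vs)}"
    by (auto simp: cyc_edges_def cyc_edge_def)
  have "(i + 1) mod length vs < length vs" using i by (intro mod_less_divisor) auto
  moreover have "even ((i + 1) mod length vs) \<longleftrightarrow> odd i"
    using assms(2) by (simp add: dvd_mod_iff)
  ultimately have "vs ! i \<in> (if even i then U else W)"
    "vs ! ((i + 1) mod length vs) \<in> (if odd i then U else W)"
    using assms(1) i(1) unfolding alternating_iff by metis+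
  then show "e \<in> bedges U W" unfolding i(2)
    by (metis bedgesI insert_commute)
qed

lemma cycle_alternating:
  assumes "U \<inter> W = {}" "even c" "is_cycle (bedges U W) c C"
  obtains vs where "length vs = c" "distinct vs" "alternating U W vs" "C = cyc_edges vs"
proof -
  from assms(3) obtain vs where vs: "length vs = c" "distinct vs" "C = cyc_edges vs" "3 \<le> c"
    "C \<subseteq> bedges U W" by (auto simp: is_cycle_iff)
  have edge: "cyc_edge vs i \<in> bedges U W" if "i < c" for i
    using vs that by (auto simp: cyc_edges_def)
  have step: "(vs ! i \<in> U \<and> vs ! ((i + 1) mod c) \<in> W) \<or> (vs ! i \<in> W \<and> vs ! ((i + 1) mod c) \<in> U)"
    if "i < c" for i
    using edge[OF that] unfolding cyc_edge_def vs(1)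
    by (auto elim!: bedgesE simp: doubleton_eq_iff)
  have alt: "alternating A B vs" if "A = U \<and> B = W \<or> A = W \<and> B = U" "vs ! 0 \<in> A" for A B
    unfolding alternating_iff
  proof (intro allI impI)
    fix i assume "i < length vs"
    then show "vs ! i \<in> (if even i then A else B)"
    proof (induction i)
      case (Suc i)
      then have "i < c" "(i + 1) mod c = Suc i" using vs by auto
      then show ?case using step[of i] Suc that(1) assms(1) by (auto split: if_splits)
    qed (use that in simp)
  qed
  consider "vs ! 0 \<in> U" | "vs ! 0 \<in> W" using step[of 0] vs(4) by force
  then show ?thesis
  proof cases
    case 1
    then show ?thesis using that[of vs] alt[of U W] vs by blast
  next
    case 2
    then have "alternating W U vs" using alt[of W U] by blast
    then have "alternating U W (rotate 1 vs)" using alternating_rotate(2)[of W U vs 1] vs assms(2) by simp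
    then show ?thesis using that[of "rotate 1 vs"] vs cyc_edges_rotate[of 1 vs] by simp
  qed
qed

text \<open>Here \<open>a\<close> and \<open>b\<close> are the neighbours of \<open>p\<close> on a
  cycle. The edges at \<open>p\<close> and the predecessor \<open>a\<close> determine the successor,
  so a list is recovered from its first edge node by node.\<close>

lemma second_edge_determined:
  assumes "{{p, b}, {a, p}} = {{p, b'}, {a, p}}" "b \<noteq> a"
  shows "b = b'"
proof -
  have "{p, b} \<in> {{p, b'}, {a, p}}" by (subst assms(1)[symmetric]) simp
  then have "{p, b} = {p, b'} \<or> {p, b} = {a, p}" by simp
  then show ?thesis using assms(2) by (auto simp: doubleton_eq_iff)
qed

text \<open>An alternating list that starts in \<open>U\<close> is determined by its cycle together with its
  first edge, and every edge of the cycle is the first edge of such a list.\<close>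

lemma card_cycle_lists:
  assumes "U \<inter> W = {}" "even c" "is_cycle (bedges U W) c C"
  shows "card {vs. length vs = c \<and> distinct vs \<and> alternating U W vs \<and> cyc_edges vs = C} = c"
proof -
  obtain vs0 where vs0: "length vs0 = c" "distinct vs0" "alternating U W vs0" "C = cyc_edges vs0"
    using cycle_alternating[OF assms] .
  have c: "3 \<le> c" using assms(3) by (simp add: is_cycle_iff)
  let ?F = "{vs. length vs = c \<and> distinct vs \<and> alternating U W vs \<and> cyc_edges vs = C}"
  let ?f = "\<lambda>vs. cyc_edge vs 0"
  have first: "cyc_edge vs 0 = {vs ! 0, vs ! 1}" if "length vs = c" for vs :: "'a list"
    using that c by (simp add: cyc_edge_def)
  have "bij_betw ?f ?F C"
  proof (rule bij_betw_imageI)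
    show "inj_on ?f ?F"
    proof (rule inj_onI)
      fix vs ws assume v: "vs \<in> ?F" and w: "ws \<in> ?F" and eq: "cyc_edge vs 0 = cyc_edge ws 0"
      have "xs ! 0 \<in> U \<and> xs ! 1 \<in> W" if "xs \<in> ?F" for xs
      proof -
        have "\<forall>i<c. xs ! i \<in> (if even i then U else W)" using that by (simp add: alternating_iff)
        from this[rule_format, of 0] this[rule_format, of 1] show ?thesis using c by auto
      qed
      then have mem: "vs ! 0 \<in> U" "ws ! 0 \<in> U" "vs ! 1 \<in> W" "ws ! 1 \<in> W"
        using v w by blast+
      then have start: "vs ! 0 = ws ! 0" "vs ! 1 = ws ! 1"
        using eq first v w assms(1) by (auto simp: doubleton_eq_iff)
      have "i + 1 < c \<longrightarrow> vs ! i = ws ! i \<and> vs ! (i + 1) = ws ! (i + 1)" for i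
      proof (induction i)
        case 0
        then show ?case using start by simp
      next
        case (Suc i)
        show ?case
        proof
          assume lt: "Suc i + 1 < c"
          have 1: "{e \<in> C. xs ! Suc i \<in> e} = {{xs ! Suc i, xs ! (Suc i + 1)}, {xs ! i, xs ! Suc i}}"
            if "xs \<in> ?F" for xs
          proof -
            have "{e \<in> C. xs ! Suc i \<in> e} = {cyc_edge xs (Suc i), cyc_edge xs i}"
              using edges_at_cycle_node[of xs "Suc i"] that lt by simp
            then show ?thesis using that lt by (simp add: cyc_edge_def)
          qed
          have "xs ! (Suc i + 1) \<noteq> xs ! i" if "xs \<in> ?F" for xs
            using that lt by (simp add: nth_eq_iff_index_eq)
          then have ne: "vs ! (Suc i + 1) \<noteq> vs ! i" using v by blast
          have IH: "vs ! i = ws ! i" "vs ! Suc i = ws ! Suc i" using Suc lt by auto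
          show "vs ! Suc i = ws ! Suc i \<and> vs ! (Suc i + 1) = ws ! (Suc i + 1)"
            using second_edge_determined[OF _ ne] 1[OF v] 1[OF w] IH by metis
        qed
      qed
      note same = this[rule_format]
      have "vs ! i = ws ! i" if "i < c" for i
      proof (cases i)
        case 0
        then show ?thesis using same[of 0] c by simp
      next
        case (Suc k)
        then show ?thesis using same[of k] that by simp
      qed
      then show "vs = ws" using v w by (intro nth_equalityI) auto
    qed
    show "?f ` ?F = C"
    proof (intro equalityI subsetI)
      fix e assume "e \<in> ?f ` ?F"
      then show "e \<in> C" using c by (auto simp: cyc_edges_def)
    next
      fix e assume "e \<in> C"
      then obtain i where i: "i < c" "e = cyc_edge vs0 i" using vs0 by (auto simp: cyc_edges_def)
      show "e \<in> ?f ` ?F"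
      proof (cases "even i")
        case True
        let ?vs = "rotate i vs0"
        have "alternating U W ?vs" using alternating_rotate(1)[OF vs0(3)] True vs0(1) assms(2) by simp
        moreover have "cyc_edge ?vs 0 = e"
          using i c vs0(1) first[of ?vs] nth_rotate[of 0 vs0 i] nth_rotate[of 1 vs0 i]
          by (simp add: cyc_edge_def)
        ultimately show ?thesis using vs0
          by (intro image_eqI[of _ _ ?vs]) (simp_all add: cyc_edges_rotate)
      next
        case False
        \<comment> \<open>For odd \<open>i\<close> the edge leads from \<open>W\<close> to
          \<open>U\<close>, so the cycle has to be traversed backwards. Rotation by
          \<open>i + 2\<close> places positions \<open>i\<close> and \<open>i + 1\<close> at the end
          of the list, and reversal brings them to the front in the order \<open>i + 1\<close>,
          \<open>i\<close>.\<close>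
        define k where "k = i + 2"
        let ?ws = "rotate k vs0"
        let ?vs = "rev ?ws"
        have "odd k" using False by (simp add: k_def)
        then have "alternating W U ?ws" using alternating_rotate(2)[OF vs0(3)] vs0(1) assms(2) by simp
        then have "alternating U W ?vs" using vs0(1) assms(2) by (intro alternating_rev) simp_all
        moreover have "cyc_edge ?vs 0 = e"
        proof -
          have a: "?vs ! 0 = ?ws ! (c - 1)" "?vs ! 1 = ?ws ! (c - 2)"
            using c vs0(1) by (simp_all add: rev_nth numeral_2_eq_2)
          have b: "?ws ! (c - 1) = vs0 ! ((k + (c - 1)) mod c)"
            "?ws ! (c - 2) = vs0 ! ((k + (c - 2)) mod c)"
            using c vs0(1) nth_rotate[of _ vs0 k] by simp_all
          have e: "k + (c - 1) = (i + 1) + c" "k + (c - 2) = i + c"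
            using c by (auto simp: k_def)
          have eqs: "?vs ! 0 = vs0 ! ((i + 1) mod c)" "?vs ! 1 = vs0 ! i"
            unfolding a b e mod_add_self2 using i(1) by simp_all
          have "cyc_edge ?vs 0 = {?vs ! 0, ?vs ! 1}" by (rule first) (simp add: vs0(1))
          also have "\<dots> = {vs0 ! i, vs0 ! ((i + 1) mod c)}" unfolding eqs by (rule insert_commute)
          also have "\<dots> = e" unfolding i(2) cyc_edge_def vs0(1) ..
          finally show ?thesis .
        qed
        moreover have "length ?vs = c" "distinct ?vs" "cyc_edges ?vs = C"
          by (simp_all add: vs0 cyc_edges_rotate cyc_edges_rev)
        ultimately show ?thesis by (intro image_eqI[of _ _ ?vs]) simp_all
      qed
    qed
  qed
  then have "card ?F = card C" by (rule bij_betw_same_card)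
  then show ?thesis using card_cyc_edges[OF vs0(2)] vs0 c by simp
qed

lemma is_cycle_facts:
  assumes "is_cycle G c C"
  shows "finite C" "card C = c" "C \<subseteq> G" "finite (\<Union>C)" "C \<noteq> {}"
proof -
  obtain vs where vs: "length vs = c" "distinct vs" "3 \<le> c" "C = cyc_edges vs" "C \<subseteq> G"
    using assms by (auto simp: is_cycle_iff)
  then show "finite C" "C \<subseteq> G" "finite (\<Union>C)" by (auto simp: Union_cyc_edges)
  show "card C = c" using vs card_cyc_edges by auto
  then show "C \<noteq> {}" using vs(3) by auto
qed

lemma is_cycle_subset_eq:
  assumes "is_cycle G c C" "is_cycle G' c' C'" "C' \<subseteq> C"
  shows "C' = C"
  using assms cycle_subset_eq by (auto simp: is_cycle_iff)

section \<open>Balls in graphs of bounded degree\<close>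

primrec reach :: "'a set set \<Rightarrow> 'a set \<Rightarrow> nat \<Rightarrow> 'a set" where
  "reach G X 0 = X"
| "reach G X (Suc r) = reach G X r \<union> (\<Union>v\<in>reach G X r. {w. {v, w} \<in> G})"

lemma reach_mono: "r \<le> s \<Longrightarrow> reach G X r \<subseteq> reach G X s"
  by (rule lift_Suc_mono_le[of "reach G X"]) auto

lemma card_reach:
  assumes "finite X" "finite G" "\<And>v. node_degree G v \<le> D"
  shows "finite (reach G X r) \<and> card (reach G X r) \<le> card X * (D + 1) ^ r"
proof (induction r)
  case 0
  then show ?case using assms by simp
next
  case (Suc r)
  have nb: "finite {w. {v, w} \<in> G} \<and> card {w. {v, w} \<in> G} \<le> D" for v
  proof -
    have inj: "inj_on (\<lambda>w. {v, w}) {w. {v, w} \<in> G}" by (auto simp: inj_on_def doubleton_eq_iff)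
    have sub: "(\<lambda>w. {v, w}) ` {w. {v, w} \<in> G} \<subseteq> {e \<in> G. v \<in> e}" by auto
    have "finite {w. {v, w} \<in> G}"
      using finite_imageD[OF finite_subset[OF sub] inj] assms(2) by simp
    moreover have "card {w. {v, w} \<in> G} \<le> node_degree G v"
      unfolding node_degree_def using card_inj_on_le[OF inj sub] assms(2) by simp
    ultimately show ?thesis using assms(3)[of v] by simp
  qed
  have "card (\<Union>v\<in>reach G X r. {w. {v, w} \<in> G}) \<le> (\<Sum>v\<in>reach G X r. card {w. {v, w} \<in> G})"
    using Suc by (intro card_UN_le) simp
  also have "\<dots> \<le> (\<Sum>v\<in>reach G X r. D)" using nb by (intro sum_mono) simp
  finally have "card (\<Union>v\<in>reach G X r. {w. {v, w} \<in> G}) \<le> card (reach G X r) * D" by simp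
  then have "card (reach G X (Suc r)) \<le> card (reach G X r) * (D + 1)"
    using card_Un_le[of "reach G X r" "\<Union>v\<in>reach G X r. {w. {v, w} \<in> G}"] by simp
  also have "\<dots> \<le> card X * (D + 1) ^ r * (D + 1)" using Suc by (intro mult_right_mono) auto
  finally show ?case using Suc nb by (simp add: mult_ac)
qed

lemma path_in_reach:
  assumes "\<And>s. s + 1 < length ws \<Longrightarrow> {ws ! s, ws ! (s + 1)} \<in> G"
    and "i < length ws" "ws ! i \<in> X"
  shows "set ws \<subseteq> reach G X (length ws)"
proof -
  have up: "i + n < length ws \<longrightarrow> ws ! (i + n) \<in> reach G X n" for n
  proof (induction n)
    case (Suc n)
    then show ?case using assms(1)[of "i + n"] by auto
  qed (use assms in simp)
  have down: "n \<le> i \<longrightarrow> ws ! (i - n) \<in> reach G X n" for n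
  proof (induction n)
    case (Suc n)
    have "i - n < length ws" using assms(2) by simp
    then show ?case using Suc assms(1)[of "i - Suc n"]
      by (auto simp: Suc_diff_Suc insert_commute)
  qed (use assms in simp)
  show ?thesis
  proof
    fix x assume "x \<in> set ws"
    then obtain j where j: "j < length ws" "x = ws ! j" by (auto simp: in_set_conv_nth)
    have "x \<in> reach G X (if i \<le> j then j - i else i - j)"
      using up[of "j - i"] down[of "i - j"] j by auto
    moreover have "(if i \<le> j then j - i else i - j) \<le> length ws" using j assms(2) by auto
    ultimately show "x \<in> reach G X (length ws)" using reach_mono by (metis subsetD)
  qed
qed

text \<open>Cutting the cycle at \<open>e\<close> leaves a path in \<open>G\<close> through all its
  nodes. As the path meets \<open>X\<close>, all of them lie within bounded distance of
  \<open>X\<close>. One edge may be missing from \<open>G\<close>: this spare edge later yields the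
  factor \<open>1 / \<eta>\<close> for meeting cycles.\<close>

lemma almost_cycle_in_reach:
  assumes "distinct vs" "3 \<le> length vs" "set vs \<inter> X \<noteq> {}" "e \<in> cyc_edges vs" "cyc_edges vs - {e} \<subseteq> G"
  shows "set vs \<subseteq> reach G X (length vs)"
proof -
  let ?c = "length vs"
  obtain q where q: "q < ?c" "e = cyc_edge vs q" using assms(4) by (auto simp: cyc_edges_def)
  \<comment> \<open>This rotation makes \<open>e\<close> the closing edge, so that consecutive
    entries of \<open>ws\<close> are joined by edges other than \<open>e\<close>.\<close>
  define ws where "ws = rotate (q + 1) vs"
  have ws: "length ws = ?c" "distinct ws" "set ws = set vs" "cyc_edges ws = cyc_edges vs"
    by (simp_all add: ws_def assms(1) cyc_edges_rotate del: rotate_Suc)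
  have e: "e = cyc_edge ws (?c - 1)"
  proof -
    have "ws ! (?c - 1) = vs ! ((q + 1 + (?c - 1)) mod ?c)" "ws ! 0 = vs ! ((q + 1) mod ?c)"
      unfolding ws_def using assms(2) nth_rotate[of "?c - 1" vs "q + 1"] nth_rotate[of 0 vs "q + 1"]
      by (simp_all del: rotate_Suc flip: length_greater_0_conv)
    moreover have "q + 1 + (?c - 1) = q + ?c" using assms(2) by simp
    ultimately have "ws ! (?c - 1) = vs ! q" "ws ! 0 = vs ! ((q + 1) mod ?c)" using q by simp_all
    moreover have "?c - 1 + 1 = ?c" using assms(2) by simp
    then have "(?c - 1 + 1) mod ?c = 0" by (simp only: mod_self)
    ultimately show ?thesis using q(2) ws(1) by (simp only: cyc_edge_def)
  qed
  have "{ws ! s, ws ! (s + 1)} \<in> G" if s: "s + 1 < length ws" for s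
  proof -
    have "cyc_edge ws s \<noteq> cyc_edge ws (?c - 1)"
      using inj_onD[OF inj_cyc_edge[OF ws(2)], of s "?c - 1"] s ws(1) assms(2) by auto
    moreover have "cyc_edge ws s \<in> cyc_edges ws" using s by (auto simp: cyc_edges_def)
    ultimately have "cyc_edge ws s \<in> G" using assms(5) ws(4) e by auto
    then show ?thesis using s by (simp add: cyc_edge_def)
  qed
  moreover obtain i where "i < length ws" "ws ! i \<in> X"
    using assms(3) ws(3) by (metis Int_iff all_not_in_conv in_set_conv_nth)
  ultimately show ?thesis using path_in_reach[of ws G i X] ws by simp
qed


context bip_degrees begin

subsection \<open>Factorial moments of the cycle counts\<close>

definition cycs :: "nat \<Rightarrow> 'a set set set" where
  "cycs c = {C. is_cycle (bedges U W) c C}"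

lemma cycs_facts:
  assumes "C \<in> cycs c"
  shows "finite C" "card C = c" "C \<subseteq> bedges U W" "finite (\<Union>C)" "C \<noteq> {}" "3 \<le> c"
  using assms is_cycle_facts[of "bedges U W" c C] by (auto simp: cycs_def is_cycle_iff)

lemma finite_cycs: "finite (cycs c)"
  by (rule finite_subset[of _ "Pow (bedges U W)"])
    (auto dest: cycs_facts simp: finite_bedges[OF finite_U finite_W])

lemma Union_cycs_nonempty: "C \<in> cycs c \<Longrightarrow> \<Union>C \<noteq> {}"
  using cycs_facts(3,5) by (fastforce elim: bedgesE)

text \<open>There are \<open>c / 2\<close> starting nodes in \<open>U\<close> and two directions,
  hence \<open>c\<close> lists for each cycle. This is the origin of the factor \<open>1 / c\<close>
  in \<open>mean\<close>; the passage to lists allows the sum to be evaluated node by node.\<close>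

lemma sum_lists_eq_sum_cycs:
  fixes f :: "'a set set \<Rightarrow> real"
  assumes "even c" "3 \<le> c"
  shows "(\<Sum>vs\<in>alt_lists c U W X. f (cyc_edges vs)) = real c * (\<Sum>C | C \<in> cycs c \<and> \<Union>C \<inter> X = {}. f C)"
proof -
  let ?T = "{C \<in> cycs c. \<Union>C \<inter> X = {}}" and ?S = "alt_lists c U W X"
  have into: "cyc_edges ` ?S \<subseteq> ?T"
  proof clarify
    fix vs assume "vs \<in> ?S"
    then have vs: "length vs = c" "distinct vs" "set vs \<inter> X = {}" "alternating U W vs"
      by (auto simp: alt_lists_def)
    then show "cyc_edges vs \<in> cycs c \<and> \<Union>(cyc_edges vs) \<inter> X = {}"
      using assms alternating_cyc_edges[OF vs(4)] unfolding Union_cyc_edges cycs_def is_cycle_iff by auto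
  qed
  have "(\<Sum>vs\<in>?S. f (cyc_edges vs)) = (\<Sum>C\<in>?T. \<Sum>vs | vs \<in> ?S \<and> cyc_edges vs = C. f (cyc_edges vs))"
    using finite_alt_lists[OF finite_U finite_W] finite_cycs into by (intro sum.group[symmetric]) auto
  also have "\<dots> = (\<Sum>C\<in>?T. real c * f C)"
  proof (rule sum.cong)
    fix C assume C: "C \<in> ?T"
    have "{vs \<in> ?S. cyc_edges vs = C}
        = {vs. length vs = c \<and> distinct vs \<and> alternating U W vs \<and> cyc_edges vs = C}"
      using C by (auto simp: alt_lists_def simp flip: Union_cyc_edges)
    then have "card {vs \<in> ?S. cyc_edges vs = C} = c"
      using card_cycle_lists[OF disj assms(1)] C by (simp add: cycs_def)
    moreover have "(\<Sum>vs | vs \<in> ?S \<and> cyc_edges vs = C. f (cyc_edges vs))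
        = (\<Sum>vs | vs \<in> ?S \<and> cyc_edges vs = C. f C)" by (rule sum.cong) auto
    ultimately show "(\<Sum>vs | vs \<in> ?S \<and> cyc_edges vs = C. f (cyc_edges vs)) = real c * f C" by simp
  qed simp
  finally show ?thesis by (simp add: sum_distrib_left)
qed

text \<open>A cycle uses two edge ends at each of its nodes and has as many edges as nodes, so its
  falling weight divided by \<open>\<eta>\<close> to the number of edges is a product of these node
  factors. Over one side they add up to \<open>2 / \<eta>\<close> times the sum of the numbers
  \<open>d v choose 2\<close>.\<close>

definition pair_density :: "'a \<Rightarrow> real" where
  "pair_density v = real (d v) * (real (d v) - 1) / \<eta>"

definition mean :: "nat \<Rightarrow> real" where
  "mean c = (sum pair_density U * sum pair_density W) ^ (c div 2) / c"

lemma pair_density_bounds: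
  assumes "v \<in> U \<union> W"
  shows "0 \<le> pair_density v" "pair_density v \<le> real (D\<^sup>2) / \<eta>" "pair_density v \<le> D * (real (d v) / \<eta>)"
proof -
  have d: "2 \<le> d v" "d v \<le> D" using assms d_ge d_le by auto
  then show "0 \<le> pair_density v" by (auto simp: pair_density_def)
  have 1: "real (d v) * (real (d v) - 1) \<le> D * real (d v)"
    using d by (subst mult.commute) (intro mult_right_mono, auto)
  also have "\<dots> \<le> D * real D" using d by (intro mult_left_mono) auto
  finally show "pair_density v \<le> real (D\<^sup>2) / \<eta>"
    unfolding pair_density_def by (intro divide_right_mono) (auto simp: power2_eq_square)
  show "pair_density v \<le> D * (real (d v) / \<eta>)"
    unfolding pair_density_def using divide_right_mono[OF 1, of \<eta>] by simp
qed

lemma sum_pair_density_le: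
  assumes "A \<subseteq> U \<union> W" "(\<Sum>v\<in>A. d v) = \<eta>"
  shows "sum pair_density A \<le> D" "0 \<le> sum pair_density A"
proof -
  have "sum pair_density A \<le> (\<Sum>v\<in>A. D * (real (d v) / \<eta>))"
    using assms(1) by (intro sum_mono pair_density_bounds) auto
  also have "\<dots> = D * (real (\<Sum>v\<in>A. d v) / \<eta>)"
    by (simp only: sum_distrib_left[symmetric] sum_divide_distrib[symmetric] of_nat_sum)
  also have "\<dots> = D" using assms(2) eta_pos by simp
  finally show "sum pair_density A \<le> D" .
  show "0 \<le> sum pair_density A" using assms(1) by (intro sum_nonneg pair_density_bounds) auto
qed

lemma card_side_le: "A \<subseteq> U \<union> W \<Longrightarrow> (\<Sum>v\<in>A. d v) = \<eta> \<Longrightarrow> card A \<le> \<eta>"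
proof -
  assume A: "A \<subseteq> U \<union> W" "(\<Sum>v\<in>A. d v) = \<eta>"
  have "card A = (\<Sum>v\<in>A. 1)" by simp
  also have "\<dots> \<le> (\<Sum>v\<in>A. d v)" using A(1) d_ge by (intro sum_mono) force
  finally show ?thesis using A(2) by simp
qed

lemma falling_wt_cycle:
  assumes "distinct vs" "3 \<le> length vs" "set vs \<subseteq> U \<union> W" "set vs \<inter> \<Union>H = {}"
  shows "falling_wt H (cyc_edges vs) / \<eta> ^ length vs = (\<Prod>v\<in>set vs. pair_density v)"
proof -
  let ?f = "\<lambda>v. \<Prod>j<node_degree (cyc_edges vs) v. real (d v - node_degree H v - j)"
  have "falling_wt H (cyc_edges vs) = prod ?f (set vs)"
    unfolding falling_wt_def
    by (rule prod.mono_neutral_right)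
      (use assms finite_U finite_W in \<open>auto simp: node_degree_eq_0 Union_cyc_edges\<close>)
  also have "\<dots> = (\<Prod>v\<in>set vs. real (d v) * (real (d v) - 1))"
  proof (rule prod.cong)
    fix v assume v: "v \<in> set vs"
    have "node_degree (cyc_edges vs) v = 2" "node_degree H v = 0" "2 \<le> d v"
      using node_degree_cyc_edges[OF assms(1,2) v] node_degree_eq_0[of v H] v assms d_ge by auto
    then show "?f v = real (d v) * (real (d v) - 1)" by (simp add: numeral_2_eq_2 of_nat_diff)
  qed simp
  finally show ?thesis
    using distinct_card[OF assms(1)] by (simp add: pair_density_def prod_dividef)
qed

text \<open>The first summand comes from replacing counts by falling weights, the second from
  dropping the requirement that nodes be distinct and avoid \<open>H\<close>. At most
  \<open>2 * L\<close> nodes are excluded at any position.\<close>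

definition cycle_error :: real where "cycle_error = edge_error * edge_bound ^ L + 2 * L * D ^ (L + 1)"

lemma cycle_error_nonneg: "0 \<le> cycle_error"
  unfolding cycle_error_def using edge_error_nonneg edge_bound_ge by simp

lemma card_Union_le: "finite H \<Longrightarrow> H \<subseteq> bedges U W \<Longrightarrow> finite (\<Union>H) \<and> card (\<Union>H) \<le> 2 * card H"
proof -
  assume H: "finite H" "H \<subseteq> bedges U W"
  have e: "finite e \<and> card e \<le> 2" if "e \<in> H" for e
    using bedgesE[OF subsetD[OF H(2) that]] by (metis card_2_iff card.insert card.empty
        finite.emptyI finite.insertI insert_absorb2 le_refl one_le_numeral One_nat_def card_1_singleton_iff)
  then have "card (\<Union>H) \<le> (\<Sum>e\<in>H. card e)" by (intro card_Union_le_sum_card)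
  also have "\<dots> \<le> (\<Sum>e\<in>H. 2)" using e by (intro sum_mono) auto
  finally show ?thesis using H e by auto
qed

text \<open>Each side has at most \<open>\<eta>\<close> nodes, so there are at most
  \<open>\<eta> ^ c\<close> lists. An error of order \<open>\<eta> ^ -(c + 1)\<close> for each
  leaves a total relative error of order \<open>1 / \<eta>\<close>, and the main terms sum to an
  alternating product over the two sides.\<close>

lemma sum_disjoint_cycles:
  assumes H: "finite H" "H \<subseteq> bedges U W" and c: "even c" "3 \<le> c" "card H + c \<le> L"
  shows "\<bar>(\<Sum>C | C \<in> cycs c \<and> \<Union>C \<inter> \<Union>H = {}. cnt (H \<union> C)) - mean c * cnt H\<bar> \<le> cycle_error / \<eta> * cnt H"
proof -
  let ?S = "alt_lists c U W (\<Union>H)"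
  let ?w = "\<lambda>vs. \<Prod>v\<in>set vs. pair_density v"
  let ?P = "alt_prod c (sum pair_density U) (sum pair_density W)"
  have e0: "real \<eta> > 0" using eta_pos by simp
  have cX: "finite (\<Union>H)" "card (\<Union>H) \<le> 2 * card H" using card_Union_le[OF H] by auto
  have each: "\<bar>cnt (H \<union> cyc_edges vs) - ?w vs * cnt H\<bar> \<le> c * edge_error * edge_bound ^ c / \<eta> ^ (c + 1) * cnt H"
    if "vs \<in> ?S" for vs
  proof -
    have vs: "length vs = c" "distinct vs" "set vs \<inter> \<Union>H = {}" "alternating U W vs"
      using that by (auto simp: alt_lists_def)
    have cc: "card (cyc_edges vs) = c" using card_cyc_edges[OF vs(2)] vs(1) c by simp
    have sub: "cyc_edges vs \<subseteq> bedges U W" using alternating_cyc_edges[OF vs(4)] vs(1) c by simp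
    have "H \<inter> cyc_edges vs = {}"
    proof (rule ccontr)
      assume "\<not> ?thesis"
      then obtain e where e: "e \<in> H" "e \<in> cyc_edges vs" by auto
      then have "e \<subseteq> set vs" "e \<subseteq> \<Union>H" using Union_cyc_edges[of vs] by auto
      moreover have "e \<noteq> {}" using e H(2) by (fastforce elim: bedgesE)
      ultimately show False using vs(3) by auto
    qed
    moreover have "card H + card (cyc_edges vs) \<le> L" using c cc by simp
    ultimately have "\<bar>cnt (H \<union> cyc_edges vs) - falling_wt H (cyc_edges vs) / \<eta> ^ c * cnt H\<bar>
        \<le> c * edge_error * edge_bound ^ c / \<eta> ^ (c + 1) * cnt H"
      using cnt_Un_approx[OF H(1) _ sub] unfolding cc by simp
    moreover have "falling_wt H (cyc_edges vs) / \<eta> ^ c = ?w vs"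
      using falling_wt_cycle[OF vs(2) _ alternating_subset[OF vs(4)] vs(3)] vs(1) c by simp
    ultimately show ?thesis by (simp only:)
  qed
  have "\<bar>(\<Sum>vs\<in>?S. cnt (H \<union> cyc_edges vs)) - (\<Sum>vs\<in>?S. ?w vs) * cnt H\<bar>
      = \<bar>\<Sum>vs\<in>?S. cnt (H \<union> cyc_edges vs) - ?w vs * cnt H\<bar>"
    by (simp add: sum_subtractf sum_distrib_right)
  also have "\<dots> \<le> (\<Sum>vs\<in>?S. c * edge_error * edge_bound ^ c / \<eta> ^ (c + 1) * cnt H)"
    by (rule order_trans[OF sum_abs sum_mono[OF each]])
  also have "\<dots> = real (card ?S) * (c * edge_error * edge_bound ^ c / \<eta> ^ (c + 1) * cnt H)" by simp
  also have "\<dots> \<le> real (\<eta> ^ c) * (c * edge_error * edge_bound ^ c / \<eta> ^ (c + 1) * cnt H)"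
    using card_alt_lists_le[OF finite_U finite_W card_side_le card_side_le, of c "\<Union>H"] sum_U sum_W
      edge_error_nonneg edge_bound_ge cnt_nonneg[of H]
    by (intro mult_right_mono of_nat_mono) auto
  also have "\<dots> = c * (edge_error * edge_bound ^ c / \<eta> * cnt H)" using e0 by simp
  finally have 1: "\<bar>(\<Sum>vs\<in>?S. cnt (H \<union> cyc_edges vs)) - (\<Sum>vs\<in>?S. ?w vs) * cnt H\<bar>
      \<le> c * (edge_error * edge_bound ^ c / \<eta> * cnt H)" .
  have "\<bar>(\<Sum>vs\<in>?S. ?w vs) - ?P\<bar> \<le> c * (card (\<Union>H) + c) * (real (D\<^sup>2) / \<eta>) * real D ^ (c - 1)"
  proof -
    have g: "0 \<le> pair_density v \<and> pair_density v \<le> real (D\<^sup>2) / \<eta>" if "v \<in> U \<union> W" for v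
      using pair_density_bounds[OF that] by simp
    have s: "sum pair_density U \<le> D" "sum pair_density W \<le> D"
      using sum_pair_density_le sum_U sum_W by auto
    have "0 \<le> c * (card (\<Union>H) + c) * (real (D\<^sup>2) / \<eta>) * real D ^ (c - 1)" by simp
    then show ?thesis
      using sum_alt_lists_approx[OF finite_U finite_W g s cX(1), of c] by (simp add: abs_le_iff)
  qed
  also have "\<dots> \<le> c * (2 * L) * (real (D\<^sup>2) / \<eta>) * real D ^ (c - 1)"
    using c cX by (intro mult_right_mono mult_left_mono) auto
  also have "\<dots> = c * (2 * L * real D ^ (c + 1) / \<eta>)"
  proof -
    have "real D ^ (c + 1) = real (D\<^sup>2) * real D ^ (c - 1)" using c by (simp flip: power_add)
    then show ?thesis by simp
  qed
  finally have "\<bar>(\<Sum>vs\<in>?S. ?w vs) - ?P\<bar> * cnt H \<le> c * (2 * L * real D ^ (c + 1) / \<eta>) * cnt H"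
    by (intro mult_right_mono cnt_nonneg)
  then have 2: "\<bar>(\<Sum>vs\<in>?S. ?w vs) * cnt H - ?P * cnt H\<bar> \<le> c * (2 * L * real D ^ (c + 1) / \<eta> * cnt H)"
    unfolding left_diff_distrib[symmetric] abs_mult abs_of_nonneg[OF cnt_nonneg] by (simp only: mult.assoc)
  have P: "?P = c * mean c" using alt_prod_even[of "c div 2"] c by (simp add: mean_def)
  define \<Sigma> where "\<Sigma> = (\<Sum>C | C \<in> cycs c \<and> \<Union>C \<inter> \<Union>H = {}. cnt (H \<union> C))"
  have S: "(\<Sum>vs\<in>?S. cnt (H \<union> cyc_edges vs)) = c * \<Sigma>"
    unfolding \<Sigma>_def using sum_lists_eq_sum_cycs[OF c(1,2), of "\<lambda>C. cnt (H \<union> C)"] by simp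
  have "\<bar>c * \<Sigma> - c * mean c * cnt H\<bar> \<le> c * (edge_error * edge_bound ^ c / \<eta> * cnt H) + c * (2 * L * real D ^ (c + 1) / \<eta> * cnt H)"
    using 1 2 unfolding S P by linarith
  moreover have "\<bar>c * \<Sigma> - c * mean c * cnt H\<bar> = c * \<bar>\<Sigma> - mean c * cnt H\<bar>"
  proof -
    have "c * \<Sigma> - c * mean c * cnt H = c * (\<Sigma> - mean c * cnt H)" by (simp only: right_diff_distrib mult.assoc)
    then show ?thesis by (simp only: abs_mult abs_of_nat)
  qed
  ultimately have "c * \<bar>\<Sigma> - mean c * cnt H\<bar> \<le> c * (edge_error * edge_bound ^ c / \<eta> * cnt H + 2 * L * real D ^ (c + 1) / \<eta> * cnt H)"
    by (simp only: distrib_left)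
  then have "\<bar>\<Sigma> - mean c * cnt H\<bar> \<le> edge_error * edge_bound ^ c / \<eta> * cnt H + 2 * L * real D ^ (c + 1) / \<eta> * cnt H"
    using c by simp
  also have "\<dots> = (edge_error * edge_bound ^ c + 2 * L * real D ^ (c + 1)) / \<eta> * cnt H" by (simp add: add_divide_distrib algebra_simps)
  also have "\<dots> \<le> cycle_error / \<eta> * cnt H"
    unfolding cycle_error_def using edge_error_nonneg edge_bound_ge D_ge c
    by (intro mult_right_mono divide_right_mono add_mono mult_left_mono cnt_nonneg power_increasing) auto
  finally show ?thesis unfolding \<Sigma>_def .
qed

definition mean_bound :: real where "mean_bound = real D ^ L"

lemma mean_bounds: "0 \<le> mean c" "2 \<le> c \<Longrightarrow> c \<le> L \<Longrightarrow> mean c \<le> mean_bound"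
proof -
  have s: "sum pair_density U \<le> D" "sum pair_density W \<le> D"
    "0 \<le> sum pair_density U" "0 \<le> sum pair_density W"
    using sum_pair_density_le sum_U sum_W by auto
  then show "0 \<le> mean c" unfolding mean_def by simp
  assume c: "2 \<le> c" "c \<le> L"
  have "mean c \<le> (sum pair_density U * sum pair_density W) ^ (c div 2) / 1"
    unfolding mean_def using c s by (intro divide_left_mono) auto
  also have "\<dots> \<le> (real D * real D) ^ (c div 2) / 1"
    using s by (intro divide_right_mono power_mono mult_mono) auto
  also have "\<dots> = real D ^ (2 * (c div 2))" by (simp add: power_mult power2_eq_square)
  also have "\<dots> \<le> mean_bound" unfolding mean_bound_def using c D_ge by (intro power_increasing) auto
  finally show "mean c \<le> mean_bound" .
qed

lemma mean_bound_ge: "1 \<le> mean_bound" unfolding mean_bound_def using D_ge by (intro one_le_power) simp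

text \<open>This counts ordered tuples of cycles of the given lengths in \<open>G\<close>, disjoint
  from \<open>H\<close> and from each other: the cycles chosen so far are accumulated in the second
  argument.\<close>

primrec disjoint_tuples :: "nat list \<Rightarrow> 'a set set \<Rightarrow> 'a set set \<Rightarrow> real" where
  "disjoint_tuples [] H G = 1"
| "disjoint_tuples (c # cs) H G =
    (\<Sum>C | C \<in> cycs c \<and> \<Union>C \<inter> \<Union>H = {} \<and> C \<subseteq> G. disjoint_tuples cs (H \<union> C) G)"

definition tuple_sum :: "nat list \<Rightarrow> 'a set set \<Rightarrow> real" where
  "tuple_sum cs H = (\<Sum>G | G \<in> graphs \<and> H \<subseteq> G. disjoint_tuples cs H G)"

lemma sum_swap_graphs:
  fixes f :: "'b \<Rightarrow> 'a set set \<Rightarrow> real"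
  assumes "finite I"
  shows "(\<Sum>G | G \<in> graphs \<and> H \<subseteq> G. \<Sum>i | i \<in> I \<and> h i \<subseteq> G. f i G)
    = (\<Sum>i\<in>I. \<Sum>G | G \<in> graphs \<and> H \<union> h i \<subseteq> G. f i G)"
proof -
  have "(\<Sum>G | G \<in> graphs \<and> H \<subseteq> G. \<Sum>i | i \<in> I \<and> h i \<subseteq> G. f i G)
    = (\<Sum>i\<in>I. \<Sum>G | G \<in> {G \<in> graphs. H \<subseteq> G} \<and> h i \<subseteq> G. f i G)"
    using finite_graphs assms by (intro sum.swap_restrict) auto
  also have "\<dots> = (\<Sum>i\<in>I. \<Sum>G | G \<in> graphs \<and> H \<union> h i \<subseteq> G. f i G)"
    by (intro sum.cong) auto
  finally show ?thesis .
qed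

lemma tuple_sum_Cons:
  "tuple_sum (c # cs) H = (\<Sum>C | C \<in> cycs c \<and> \<Union>C \<inter> \<Union>H = {}. tuple_sum cs (H \<union> C))"
  unfolding tuple_sum_def disjoint_tuples.simps
  using sum_swap_graphs[where I = "{C \<in> cycs c. \<Union>C \<inter> \<Union>H = {}}" and H = H and h = "\<lambda>C. C"] finite_cycs[of c]
  by (simp add: conj_assoc)

text \<open>Every additional cycle contributes a factor \<open>mean c\<close> whatever
  \<open>H\<close> is, up to relative error of order \<open>1 / \<eta>\<close>. This lack of
  dependence on \<open>H\<close> is the source of asymptotic independence. The sum
  \<open>mean_bound + cycle_error\<close> dominates each step's growth and its error.\<close>

lemma tuple_sum_approx:
  assumes "finite H" "H \<subseteq> bedges U W" "card H + sum_list cs \<le> L" "\<forall>c\<in>set cs. even c \<and> 3 \<le> c"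
  shows "\<bar>tuple_sum cs H - (\<Prod>c\<leftarrow>cs. mean c) * cnt H\<bar> \<le> length cs * (mean_bound + cycle_error) ^ length cs / \<eta> * cnt H"
  using assms
proof (induction cs arbitrary: H)
  case Nil
  then show ?case by (simp add: tuple_sum_def cnt_def)
next
  case (Cons c cs)
  let ?T = "{C \<in> cycs c. \<Union>C \<inter> \<Union>H = {}}"
  let ?m = "\<Prod>c\<leftarrow>cs. mean c"
  define n where "n = length cs"
  have B1: "1 \<le> mean_bound + cycle_error" using mean_bound_ge cycle_error_nonneg by simp
  have e1: "1 \<le> real \<eta>" using eta_pos by simp
  have m: "0 \<le> ?m \<and> ?m \<le> mean_bound ^ n"
  proof -
    have "\<forall>c\<in>set cs. 0 \<le> mean c \<and> mean c \<le> mean_bound"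
      using Cons.prems member_le_sum_list[of _ cs] by (auto intro!: mean_bounds) (meson add_leD2 le_trans)
    then show ?thesis unfolding n_def
      by (induction cs) (auto intro!: mult_mono)
  qed
  have c: "even c" "3 \<le> c" "card H + c \<le> L" using Cons.prems by auto
  define \<Sigma> where "\<Sigma> = (\<Sum>C\<in>?T. cnt (H \<union> C))"
  have \<Sigma>: "\<bar>\<Sigma> - mean c * cnt H\<bar> \<le> cycle_error / \<eta> * cnt H"
    unfolding \<Sigma>_def using sum_disjoint_cycles[OF Cons.prems(1,2) c] .
  have "mean c \<le> mean_bound" using mean_bounds(2)[of c] c by simp
  then have "mean c * cnt H \<le> mean_bound * cnt H" by (intro mult_right_mono cnt_nonneg)
  moreover have "cycle_error / \<eta> * cnt H \<le> cycle_error * cnt H"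
    using e1 cycle_error_nonneg by (intro mult_right_mono cnt_nonneg) (simp add: divide_le_eq mult_le_cancel_left1)
  ultimately have \<Sigma>2: "\<Sigma> \<le> (mean_bound + cycle_error) * cnt H" using \<Sigma> by (simp add: algebra_simps)
  have step: "\<bar>tuple_sum cs (H \<union> C) - ?m * cnt (H \<union> C)\<bar> \<le> n * (mean_bound + cycle_error) ^ n / \<eta> * cnt (H \<union> C)"
    if "C \<in> ?T" for C
  proof -
    have C: "finite C" "card C = c" "C \<subseteq> bedges U W" using cycs_facts[of C c] that by auto
    have "card (H \<union> C) \<le> card H + c" using C card_Un_le[of H C] by simp
    then show ?thesis unfolding n_def using Cons C by auto
  qed
  have "\<bar>tuple_sum (c # cs) H - ?m * \<Sigma>\<bar> = \<bar>\<Sum>C\<in>?T. tuple_sum cs (H \<union> C) - ?m * cnt (H \<union> C)\<bar>"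
    unfolding tuple_sum_Cons \<Sigma>_def by (simp add: sum_subtractf sum_distrib_left)
  also have "\<dots> \<le> (\<Sum>C\<in>?T. n * (mean_bound + cycle_error) ^ n / \<eta> * cnt (H \<union> C))"
    by (rule order_trans[OF sum_abs sum_mono[OF step]])
  also have "\<dots> = n * (mean_bound + cycle_error) ^ n / \<eta> * \<Sigma>" by (simp add: \<Sigma>_def sum_distrib_left)
  also have "\<dots> \<le> n * (mean_bound + cycle_error) ^ n / \<eta> * ((mean_bound + cycle_error) * cnt H)"
    using \<Sigma>2 B1 by (intro mult_left_mono) auto
  finally have 1: "\<bar>tuple_sum (c # cs) H - ?m * \<Sigma>\<bar> \<le> n * (mean_bound + cycle_error) ^ Suc n / \<eta> * cnt H"
    by (simp add: mult_ac)
  have "\<bar>?m * \<Sigma> - ?m * (mean c * cnt H)\<bar> = ?m * \<bar>\<Sigma> - mean c * cnt H\<bar>"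
    using m by (simp add: abs_mult flip: right_diff_distrib)
  also have "\<dots> \<le> (mean_bound + cycle_error) ^ n * ((mean_bound + cycle_error) / \<eta> * cnt H)"
  proof (rule mult_mono)
    show "?m \<le> (mean_bound + cycle_error) ^ n" using m mean_bound_ge cycle_error_nonneg power_mono[of mean_bound "mean_bound + cycle_error" n] by linarith
    have "cycle_error / \<eta> * cnt H \<le> (mean_bound + cycle_error) / \<eta> * cnt H"
      using mean_bound_ge by (intro mult_right_mono divide_right_mono cnt_nonneg) auto
    then show "\<bar>\<Sigma> - mean c * cnt H\<bar> \<le> (mean_bound + cycle_error) / \<eta> * cnt H" using \<Sigma> by linarith
  qed (use B1 in auto)
  finally have 2: "\<bar>?m * \<Sigma> - ?m * (mean c * cnt H)\<bar> \<le> (mean_bound + cycle_error) ^ Suc n / \<eta> * cnt H" by (simp add: mult_ac)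
  have "\<bar>tuple_sum (c # cs) H - ?m * (mean c * cnt H)\<bar>
      \<le> n * (mean_bound + cycle_error) ^ Suc n / \<eta> * cnt H + (mean_bound + cycle_error) ^ Suc n / \<eta> * cnt H"
    using 1 2 by linarith
  also have "\<dots> = Suc n * (mean_bound + cycle_error) ^ Suc n / \<eta> * cnt H"
    by (simp add: algebra_simps add_divide_distrib)
  finally show ?case by (simp add: n_def mult_ac)
qed

end


section \<open>Moments of the number of short cycles, and cycles that meet\<close>

definition lengths :: "nat \<Rightarrow> nat set" where
  "lengths k = {c. even c \<and> 4 \<le> c \<and> c \<le> k}"

lemma lengths_facts: "finite (lengths k)" "card (lengths k) \<le> k"
proof -
  have sub: "lengths k \<subseteq> {1..k}" by (auto simp: lengths_def)
  then show "finite (lengths k)" by (rule finite_subset) simp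
  show "card (lengths k) \<le> k" using card_mono[OF _ sub] by simp
qed

context bip_degrees begin

text \<open>There are at most \<open>L\<close> lengths; a ball of radius at most \<open>L\<close>
  around \<open>2 * L\<close> nodes has at most the size in parentheses, and a cycle is given by at
  most \<open>L\<close> nodes of the ball.\<close>

definition near_bound :: real where "near_bound = L * (2 * L * (real D + 1) ^ L) ^ L"
definition total_bound :: real where "total_bound = L * (mean_bound + cycle_error) + near_bound"

lemma card_near_cycles_le:
  assumes G: "G \<in> graphs" and X: "finite X" "card X \<le> 2 * L" and c: "3 \<le> c" "c \<le> L"
  shows "real (card {C \<in> cycs c. \<Union>C \<inter> X \<noteq> {} \<and> (\<exists>e\<in>C. C - {e} \<subseteq> G)}) \<le> (2 * L * (real D + 1) ^ L) ^ L"
proof -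
  let ?A = "reach G X c"
  have A: "finite ?A" "card ?A \<le> card X * (D + 1) ^ c"
    using card_reach[OF X(1) graph_finite[OF G] graph_degree_le[OF G]] by auto
  have "{C \<in> cycs c. \<Union>C \<inter> X \<noteq> {} \<and> (\<exists>e\<in>C. C - {e} \<subseteq> G)}
      \<subseteq> cyc_edges ` {vs. set vs \<subseteq> ?A \<and> length vs = c}"
  proof clarify
    fix C e assume C: "C \<in> cycs c" "\<Union>C \<inter> X \<noteq> {}" "e \<in> C" "C - {e} \<subseteq> G"
    then obtain vs where vs: "length vs = c" "distinct vs" "C = cyc_edges vs"
      by (auto simp: cycs_def is_cycle_iff)
    have "set vs \<subseteq> ?A"
      using almost_cycle_in_reach[OF vs(2), of X e G] C vs c by (simp add: Union_cyc_edges)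
    then show "C \<in> cyc_edges ` {vs. set vs \<subseteq> ?A \<and> length vs = c}" using vs by blast
  qed
  then have "card {C \<in> cycs c. \<Union>C \<inter> X \<noteq> {} \<and> (\<exists>e\<in>C. C - {e} \<subseteq> G)}
      \<le> card (cyc_edges ` {vs. set vs \<subseteq> ?A \<and> length vs = c})"
    by (intro card_mono finite_imageI finite_lists_length_eq A)
  also have "\<dots> \<le> card {vs. set vs \<subseteq> ?A \<and> length vs = c}"
    by (intro card_image_le finite_lists_length_eq A)
  also have "\<dots> = card ?A ^ c" by (rule card_lists_length_eq[OF A(1)])
  also have "\<dots> \<le> (card X * (D + 1) ^ c) ^ c" by (intro power_mono A) simp
  also have "\<dots> \<le> (2 * L * (D + 1) ^ L) ^ c"
    using X c by (intro power_mono mult_mono power_increasing) auto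
  also have "\<dots> \<le> (2 * L * (D + 1) ^ L) ^ L" using c by (intro power_increasing) auto
  finally have "real (card {C \<in> cycs c. \<Union>C \<inter> X \<noteq> {} \<and> (\<exists>e\<in>C. C - {e} \<subseteq> G)})
      \<le> real ((2 * L * (D + 1) ^ L) ^ L)" by (rule of_nat_mono)
  then show ?thesis by (simp add: add.commute)
qed

definition short_cycs :: "nat \<Rightarrow> 'a set set set" where
  "short_cycs k = (\<Union>c\<in>lengths k. cycs c)"

definition tot :: "nat \<Rightarrow> 'a set set \<Rightarrow> real" where
  "tot k G = real (card {C \<in> short_cycs k. C \<subseteq> G})"

lemma finite_short_cycs: "finite (short_cycs k)"
  unfolding short_cycs_def using lengths_facts finite_cycs by blast

lemma short_cycs_facts:
  assumes "C \<in> short_cycs k"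
  shows "finite C" "card C \<le> k" "C \<subseteq> bedges U W" "finite (\<Union>C)" "\<Union>C \<noteq> {}" "C \<noteq> {}"
proof -
  obtain c where c: "C \<in> cycs c" "c \<le> k" using assms by (auto simp: short_cycs_def lengths_def)
  show "finite C" "card C \<le> k" "C \<subseteq> bedges U W" "finite (\<Union>C)" "\<Union>C \<noteq> {}" "C \<noteq> {}"
    using cycs_facts[OF c(1)] Union_cycs_nonempty[OF c(1)] c(2) by simp_all
qed

lemma cycs_unique: "C \<in> cycs c \<Longrightarrow> C \<in> cycs c' \<Longrightarrow> c = c'"
  using cycs_facts(2) by blast

lemma card_short_cycs_le:
  "card {C \<in> short_cycs k. P C} \<le> (\<Sum>c\<in>lengths k. card {C \<in> cycs c. P C})"
proof -
  have "{C \<in> short_cycs k. P C} = (\<Union>c\<in>lengths k. {C \<in> cycs c. P C})" by (auto simp: short_cycs_def)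
  then show ?thesis using card_UN_le[OF lengths_facts(1)] by simp
qed

lemma card_near_short_cycs_le:
  assumes G: "G \<in> graphs" and X: "finite X" "card X \<le> 2 * L" and k: "k \<le> L"
  shows "real (card {C \<in> short_cycs k. \<Union>C \<inter> X \<noteq> {} \<and> (\<exists>e\<in>C. C - {e} \<subseteq> G)}) \<le> near_bound"
proof -
  have "real (card {C \<in> short_cycs k. \<Union>C \<inter> X \<noteq> {} \<and> (\<exists>e\<in>C. C - {e} \<subseteq> G)})
    \<le> real (\<Sum>c\<in>lengths k. card {C \<in> cycs c. \<Union>C \<inter> X \<noteq> {} \<and> (\<exists>e\<in>C. C - {e} \<subseteq> G)})"
    by (intro of_nat_mono card_short_cycs_le)
  also have "\<dots> = (\<Sum>c\<in>lengths k. real (card {C \<in> cycs c. \<Union>C \<inter> X \<noteq> {} \<and> (\<exists>e\<in>C. C - {e} \<subseteq> G)}))"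
    by simp
  also have "\<dots> \<le> (\<Sum>c\<in>lengths k. (2 * L * (real D + 1) ^ L) ^ L)"
    using k by (intro sum_mono card_near_cycles_le[OF G X]) (auto simp: lengths_def)
  also have "\<dots> = card (lengths k) * (2 * L * (real D + 1) ^ L) ^ L" by simp
  also have "\<dots> \<le> near_bound" unfolding near_bound_def
    using lengths_facts(2)[of k] k by (intro mult_right_mono) auto
  finally show ?thesis .
qed

lemma bounds_nonneg: "0 \<le> near_bound" "0 \<le> total_bound" "0 \<le> mean_bound + cycle_error"
  unfolding total_bound_def near_bound_def using mean_bound_ge cycle_error_nonneg by auto

text \<open>Given \<open>H\<close>, the expected number of short cycles is bounded: cycles disjoint
  from \<open>H\<close> are covered by the moment estimate, and those meeting \<open>H\<close> are
  boundedly many in every single graph. These are the two summands of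
  \<open>total_bound\<close>.\<close>

lemma sum_short_cycs_le:
  assumes H: "finite H" "H \<subseteq> bedges U W" and k: "card H + k \<le> L"
  shows "(\<Sum>C\<in>short_cycs k. cnt (H \<union> C)) \<le> total_bound * cnt H"
proof -
  let ?D = "{C \<in> short_cycs k. \<Union>C \<inter> \<Union>H = {}}" and ?N = "{C \<in> short_cycs k. \<Union>C \<inter> \<Union>H \<noteq> {}}"
  have e1: "1 \<le> real \<eta>" using eta_pos by simp
  have X: "finite (\<Union>H)" "card (\<Union>H) \<le> 2 * L" using card_Union_le[OF H] k by auto
  have "short_cycs k = ?D \<union> ?N" by auto
  then have "(\<Sum>C\<in>short_cycs k. cnt (H \<union> C)) = (\<Sum>C\<in>?D \<union> ?N. cnt (H \<union> C))" by simp
  also have "\<dots> = (\<Sum>C\<in>?D. cnt (H \<union> C)) + (\<Sum>C\<in>?N. cnt (H \<union> C))"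
    using finite_short_cycs by (intro sum.union_disjoint) auto
  also have "(\<Sum>C\<in>?D. cnt (H \<union> C)) \<le> L * (mean_bound + cycle_error) * cnt H"
  proof -
    have "?D = (\<Union>c\<in>lengths k. {C \<in> cycs c. \<Union>C \<inter> \<Union>H = {}})" by (auto simp: short_cycs_def)
    then have "(\<Sum>C\<in>?D. cnt (H \<union> C)) = (\<Sum>c\<in>lengths k. \<Sum>C | C \<in> cycs c \<and> \<Union>C \<inter> \<Union>H = {}. cnt (H \<union> C))"
      using lengths_facts(1)[of k] finite_cycs
      by (simp only:) (subst sum.UNION_disjoint, auto dest: cycs_unique)
    also have "\<dots> \<le> (\<Sum>c\<in>lengths k. (mean_bound + cycle_error) * cnt H)"
    proof (rule sum_mono)
      fix c assume "c \<in> lengths k"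
      then have c: "even c" "3 \<le> c" "card H + c \<le> L" "2 \<le> c" "c \<le> L" using k by (auto simp: lengths_def)
      have "(\<Sum>C | C \<in> cycs c \<and> \<Union>C \<inter> \<Union>H = {}. cnt (H \<union> C)) \<le> mean c * cnt H + cycle_error / \<eta> * cnt H"
        using sum_disjoint_cycles[OF H c(1-3)] by linarith
      also have "\<dots> \<le> mean_bound * cnt H + cycle_error * cnt H"
        using e1 cycle_error_nonneg mean_bounds(2)[OF c(4,5)]
        by (intro add_mono mult_right_mono cnt_nonneg) (auto simp: divide_le_eq mult_le_cancel_left1)
      finally show "(\<Sum>C | C \<in> cycs c \<and> \<Union>C \<inter> \<Union>H = {}. cnt (H \<union> C)) \<le> (mean_bound + cycle_error) * cnt H"
        by (simp add: algebra_simps)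
    qed
    also have "\<dots> = card (lengths k) * ((mean_bound + cycle_error) * cnt H)" by simp
    also have "\<dots> \<le> L * ((mean_bound + cycle_error) * cnt H)"
      using lengths_facts(2)[of k] k bounds_nonneg cnt_nonneg by (intro mult_right_mono) auto
    finally show ?thesis by (simp add: mult_ac)
  qed
  also have "(\<Sum>C\<in>?N. cnt (H \<union> C)) \<le> near_bound * cnt H"
  proof -
    have "(\<Sum>C\<in>?N. cnt (H \<union> C)) = (\<Sum>G\<in>graphs. real (card {C \<in> ?N. H \<union> C \<subseteq> G}))"
      using finite_short_cycs by (intro sum_cnt) simp
    also have "\<dots> \<le> (\<Sum>G\<in>graphs. if H \<subseteq> G then near_bound else 0)"
    proof (rule sum_mono)
      fix G assume G: "G \<in> graphs"
      show "real (card {C \<in> ?N. H \<union> C \<subseteq> G}) \<le> (if H \<subseteq> G then near_bound else 0)"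
      proof (cases "H \<subseteq> G")
        case True
        have "{C \<in> ?N. H \<union> C \<subseteq> G} \<subseteq> {C \<in> short_cycs k. \<Union>C \<inter> \<Union>H \<noteq> {} \<and> (\<exists>e\<in>C. C - {e} \<subseteq> G)}"
        proof
          fix C assume "C \<in> {C \<in> ?N. H \<union> C \<subseteq> G}"
          then have C: "C \<in> short_cycs k" "\<Union>C \<inter> \<Union>H \<noteq> {}" "C \<subseteq> G" by simp_all
          obtain e where "e \<in> C" using short_cycs_facts(6)[OF C(1)] by blast
          then have "\<exists>e\<in>C. C - {e} \<subseteq> G" using C(3) by blast
          then show "C \<in> {C \<in> short_cycs k. \<Union>C \<inter> \<Union>H \<noteq> {} \<and> (\<exists>e\<in>C. C - {e} \<subseteq> G)}"
            using C by simp
        qed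
        then have "card {C \<in> ?N. H \<union> C \<subseteq> G} \<le> card {C \<in> short_cycs k. \<Union>C \<inter> \<Union>H \<noteq> {} \<and> (\<exists>e\<in>C. C - {e} \<subseteq> G)}"
          by (rule card_mono[rotated]) (simp add: finite_short_cycs)
        then show ?thesis using card_near_short_cycs_le[OF G X, of k] k True by simp
      next
        case False
        then have "{C \<in> ?N. H \<union> C \<subseteq> G} = {}" by auto
        then show ?thesis using False by (simp only: card.empty) simp
      qed
    qed
    also have "\<dots> = near_bound * cnt H" using finite_graphs by (simp add: sum.If_cases cnt_def Int_def)
    finally show ?thesis .
  qed
  finally show ?thesis by (simp add: total_bound_def algebra_simps)
qed

lemma tot_nonneg: "0 \<le> tot k G" by (simp add: tot_def)

lemma sum_times_tot:
  "(\<Sum>G | G \<in> graphs \<and> H \<subseteq> G. f G * tot k G) = (\<Sum>C\<in>short_cycs k. \<Sum>G | G \<in> graphs \<and> H \<union> C \<subseteq> G. f G)"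
  using sum_swap_graphs[OF finite_short_cycs, where f = "\<lambda>_. f" and H = H and h = "\<lambda>C. C"]
  by (simp add: tot_def mult.commute)

text \<open>Expanding one factor \<open>tot k G\<close> as a sum over the short cycles of
  \<open>G\<close> moves a cycle of at most \<open>k\<close> edges into \<open>H\<close>, hence the
  allowance of \<open>r * k\<close> edges.\<close>

lemma sum_tot_power_le:
  assumes "finite H" "H \<subseteq> bedges U W" "card H + r * k \<le> L"
  shows "(\<Sum>G | G \<in> graphs \<and> H \<subseteq> G. tot k G ^ r) \<le> total_bound ^ r * cnt H"
  using assms
proof (induction r arbitrary: H)
  case 0
  then show ?case by (simp add: cnt_def)
next
  case (Suc r)
  have "(\<Sum>G | G \<in> graphs \<and> H \<subseteq> G. tot k G ^ Suc r) = (\<Sum>G | G \<in> graphs \<and> H \<subseteq> G. tot k G ^ r * tot k G)"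
    by (simp add: mult.commute)
  also have "\<dots> = (\<Sum>C\<in>short_cycs k. \<Sum>G | G \<in> graphs \<and> H \<union> C \<subseteq> G. tot k G ^ r)"
    by (rule sum_times_tot)
  also have "\<dots> \<le> (\<Sum>C\<in>short_cycs k. total_bound ^ r * cnt (H \<union> C))"
  proof (rule sum_mono)
    fix C assume "C \<in> short_cycs k"
    note C = short_cycs_facts[OF this]
    have "card (H \<union> C) \<le> card H + k" using card_Un_le[of H C] C(2) by linarith
    then show "(\<Sum>G | G \<in> graphs \<and> H \<union> C \<subseteq> G. tot k G ^ r) \<le> total_bound ^ r * cnt (H \<union> C)"
      using Suc.prems C by (intro Suc.IH) auto
  qed
  also have "\<dots> = total_bound ^ r * (\<Sum>C\<in>short_cycs k. cnt (H \<union> C))" by (simp add: sum_distrib_left)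
  also have "\<dots> \<le> total_bound ^ r * (total_bound * cnt H)"
    using Suc.prems bounds_nonneg by (intro mult_left_mono sum_short_cycs_le) auto
  finally show ?case by (simp add: mult_ac)
qed

definition crowded :: "nat \<Rightarrow> 'a set set \<Rightarrow> bool" where
  "crowded k G \<longleftrightarrow> (\<exists>C1\<in>short_cycs k. \<exists>C2\<in>short_cycs k.
     C1 \<subseteq> G \<and> C2 \<subseteq> G \<and> C1 \<noteq> C2 \<and> \<Union>C1 \<inter> \<Union>C2 \<noteq> {})"

lemma short_cycs_subset_eq: "C \<in> short_cycs k \<Longrightarrow> C' \<in> short_cycs k \<Longrightarrow> C' \<subseteq> C \<Longrightarrow> C' = C"
  unfolding short_cycs_def cycs_def using is_cycle_subset_eq by blast

text \<open>Two distinct cycles that meet use more edges than nodes; removing one edge of the second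
  cycle leaves a path, and bounded degrees allow only boundedly many such paths in a graph.\<close>

lemma sum_meeting_cycles_le:
  assumes C: "C \<in> short_cycs k" and k: "2 * k \<le> L"
  shows "(\<Sum>C' | C' \<in> short_cycs k \<and> C' \<noteq> C \<and> \<Union>C \<inter> \<Union>C' \<noteq> {}. cnt (C \<union> C')) \<le> edge_bound * near_bound / \<eta> * cnt C"
proof -
  let ?N = "{C' \<in> short_cycs k. C' \<noteq> C \<and> \<Union>C \<inter> \<Union>C' \<noteq> {}}"
  note Cf = short_cycs_facts[OF C]
  have X: "card (\<Union>C) \<le> 2 * L" using card_Union_le[OF Cf(1,3)] Cf(2) k by linarith
  \<comment> \<open>No cycle properly contains another one, so a different cycle \<open>C'\<close>
    has an edge outside \<open>C\<close>.\<close>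
  have "\<forall>C'\<in>?N. \<exists>e. e \<in> C' - C" using short_cycs_subset_eq[OF C] by blast
  from bchoice[OF this] obtain e where e': "\<forall>C'\<in>?N. e C' \<in> C' - C" ..
  note e = e'[rule_format]
  have "(\<Sum>C'\<in>?N. cnt (C \<union> C')) \<le> (\<Sum>C'\<in>?N. edge_bound / \<eta> * cnt (C \<union> (C' - {e C'})))"
  proof (rule sum_mono)
    fix C' assume N: "C' \<in> ?N"
    then have "C' \<in> short_cycs k" by simp
    note Cf' = short_cycs_facts[OF this]
    let ?H = "C \<union> (C' - {e C'})"
    have "card ?H \<le> card C + card (C' - {e C'})" by (rule card_Un_le)
    also have "\<dots> \<le> k + k" using Cf Cf' card_mono[of C' "C' - {e C'}"] by (intro add_mono) auto
    finally have "2 * (card ?H + 4 * D\<^sup>2) \<le> 2 * (L + 2 + 4 * D\<^sup>2)" using k by simp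
    then have "2 * (card ?H + 4 * D\<^sup>2) \<le> \<eta>" using large by (rule order_trans)
    then have "cnt (insert (e C') ?H) \<le> 2 * D\<^sup>2 / \<eta> * cnt ?H"
      using e[OF N] Cf Cf' by (intro cnt_insert_le) auto
    moreover have "insert (e C') ?H = C \<union> C'" using e[OF N] by auto
    ultimately show "cnt (C \<union> C') \<le> edge_bound / \<eta> * cnt ?H" by (simp add: edge_bound_def)
  qed
  also have "\<dots> = edge_bound / \<eta> * (\<Sum>C'\<in>?N. cnt (C \<union> (C' - {e C'})))" by (simp add: sum_distrib_left)
  also have "(\<Sum>C'\<in>?N. cnt (C \<union> (C' - {e C'}))) = (\<Sum>G\<in>graphs. real (card {C' \<in> ?N. C \<union> (C' - {e C'}) \<subseteq> G}))"
    using finite_short_cycs by (intro sum_cnt) simp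
  also have "edge_bound / \<eta> * \<dots> \<le> edge_bound / \<eta> * (near_bound * cnt C)"
  proof (rule mult_left_mono)
    have "(\<Sum>G\<in>graphs. real (card {C' \<in> ?N. C \<union> (C' - {e C'}) \<subseteq> G})) \<le> (\<Sum>G\<in>graphs. if C \<subseteq> G then near_bound else 0)"
    proof (rule sum_mono)
      fix G assume G: "G \<in> graphs"
      show "real (card {C' \<in> ?N. C \<union> (C' - {e C'}) \<subseteq> G}) \<le> (if C \<subseteq> G then near_bound else 0)"
      proof (cases "C \<subseteq> G")
        case True
        have "{C' \<in> ?N. C \<union> (C' - {e C'}) \<subseteq> G} \<subseteq> {C' \<in> short_cycs k. \<Union>C' \<inter> \<Union>C \<noteq> {} \<and> (\<exists>e\<in>C'. C' - {e} \<subseteq> G)}"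
          using e by (auto simp: Int_commute)
        then have "card {C' \<in> ?N. C \<union> (C' - {e C'}) \<subseteq> G}
            \<le> card {C' \<in> short_cycs k. \<Union>C' \<inter> \<Union>C \<noteq> {} \<and> (\<exists>e\<in>C'. C' - {e} \<subseteq> G)}"
          using finite_short_cycs by (intro card_mono) auto
        then show ?thesis using card_near_short_cycs_le[OF G Cf(4) X, of k] k True by simp
      next
        case False
        then have "{C' \<in> ?N. C \<union> (C' - {e C'}) \<subseteq> G} = {}" by auto
        then show ?thesis using False by (simp only: card.empty) simp
      qed
    qed
    also have "\<dots> = near_bound * cnt C" using finite_graphs by (simp add: sum.If_cases cnt_def Int_def)
    finally show "(\<Sum>G\<in>graphs. real (card {C' \<in> ?N. C \<union> (C' - {e C'}) \<subseteq> G})) \<le> near_bound * cnt C" .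
  qed (use edge_bound_ge in simp)
  finally show ?thesis by (simp add: mult_ac)
qed

lemma card_pos_if_mem: "x \<in> A \<Longrightarrow> finite A \<Longrightarrow> 0 < card A"
  by (auto simp: card_gt_0_iff)

text \<open>The power of \<open>tot\<close> is the bound for the discrepancy between tuples of
  distinct and of disjoint cycles. Each crowded graph is charged to a meeting pair; given the pair,
  the power contributes \<open>total_bound ^ r\<close>, the second cycle a factor of order
  \<open>1 / \<eta>\<close>, and the first cycle one more \<open>total_bound\<close>.\<close>

lemma sum_crowded_le:
  assumes "2 * k + r * k \<le> L"
  shows "(\<Sum>G | G \<in> graphs \<and> crowded k G. tot k G ^ r) \<le> total_bound ^ (r + 1) * edge_bound * near_bound / \<eta> * cnt {}"
proof -
  let ?N = "\<lambda>C. {C' \<in> short_cycs k. C' \<noteq> C \<and> \<Union>C \<inter> \<Union>C' \<noteq> {}}"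
  let ?P = "Sigma (short_cycs k) ?N"
  have finP: "finite ?P" using finite_short_cycs by auto
  have "(\<Sum>G | G \<in> graphs \<and> crowded k G. tot k G ^ r)
      \<le> (\<Sum>G | G \<in> graphs \<and> crowded k G. \<Sum>p | p \<in> ?P \<and> fst p \<union> snd p \<subseteq> G. tot k G ^ r)"
  proof (rule sum_mono)
    fix G assume "G \<in> {G \<in> graphs. crowded k G}"
    then obtain C1 C2 where "C1 \<in> short_cycs k" "C2 \<in> short_cycs k" "C1 \<subseteq> G" "C2 \<subseteq> G" "C1 \<noteq> C2"
      "\<Union>C1 \<inter> \<Union>C2 \<noteq> {}" unfolding crowded_def by blast
    then have "(C1, C2) \<in> {p \<in> ?P. fst p \<union> snd p \<subseteq> G}" by auto
    moreover have "finite {p \<in> ?P. fst p \<union> snd p \<subseteq> G}" using finP by simp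
    ultimately have "0 < card {p \<in> ?P. fst p \<union> snd p \<subseteq> G}" by (rule card_pos_if_mem)
    then have "1 * tot k G ^ r \<le> real (card {p \<in> ?P. fst p \<union> snd p \<subseteq> G}) * tot k G ^ r"
      using tot_nonneg by (intro mult_right_mono) auto
    then show "tot k G ^ r \<le> (\<Sum>p | p \<in> ?P \<and> fst p \<union> snd p \<subseteq> G. tot k G ^ r)" by simp
  qed
  also have "\<dots> \<le> (\<Sum>G | G \<in> graphs \<and> {} \<subseteq> G. \<Sum>p | p \<in> ?P \<and> fst p \<union> snd p \<subseteq> G. tot k G ^ r)"
    using finite_graphs tot_nonneg by (intro sum_mono2) (auto intro!: sum_nonneg)
  also have "\<dots> = (\<Sum>p\<in>?P. \<Sum>G | G \<in> graphs \<and> {} \<union> (fst p \<union> snd p) \<subseteq> G. tot k G ^ r)"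
    by (rule sum_swap_graphs[OF finP])
  also have "\<dots> \<le> (\<Sum>p\<in>?P. total_bound ^ r * cnt (fst p \<union> snd p))"
  proof (rule sum_mono)
    fix p assume "p \<in> ?P"
    then have "fst p \<in> short_cycs k" "snd p \<in> short_cycs k" by auto
    note C = short_cycs_facts[OF this(1)] short_cycs_facts[OF this(2)]
    have "card (fst p \<union> snd p) \<le> card (fst p) + card (snd p)" by (rule card_Un_le)
    also have "\<dots> \<le> 2 * k" using C(2,8) by simp
    finally have "card (fst p \<union> snd p) + r * k \<le> L" using assms by linarith
    then show "(\<Sum>G | G \<in> graphs \<and> {} \<union> (fst p \<union> snd p) \<subseteq> G. tot k G ^ r) \<le> total_bound ^ r * cnt (fst p \<union> snd p)"
      using sum_tot_power_le[of "fst p \<union> snd p" r k] C by simp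
  qed
  also have "\<dots> = total_bound ^ r * (\<Sum>C\<in>short_cycs k. \<Sum>C'\<in>?N C. cnt (C \<union> C'))"
    using finite_short_cycs by (simp add: sum.Sigma sum_distrib_left case_prod_unfold)
  also have "\<dots> \<le> total_bound ^ r * (\<Sum>C\<in>short_cycs k. edge_bound * near_bound / \<eta> * cnt C)"
    using assms bounds_nonneg by (intro mult_left_mono sum_mono sum_meeting_cycles_le) auto
  also have "\<dots> = total_bound ^ r * (edge_bound * near_bound / \<eta> * (\<Sum>C\<in>short_cycs k. cnt ({} \<union> C)))"
    by (simp add: sum_distrib_left)
  also have "\<dots> \<le> total_bound ^ r * (edge_bound * near_bound / \<eta> * (total_bound * cnt {}))"
    using assms bounds_nonneg edge_bound_ge by (intro mult_left_mono sum_short_cycs_le) auto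
  finally show ?thesis by (simp add: mult_ac)
qed

definition num :: "nat \<Rightarrow> 'a set set \<Rightarrow> nat" where
  "num c G = card {C \<in> cycs c. C \<subseteq> G}"

end

text \<open>A product of falling factorials evaluated in the order of a list, where \<open>s\<close>
  records how often each type occurred before. This matches the recursion of
  \<open>disjoint_tuples\<close>; truncated subtraction gives 0 once a type is exhausted.\<close>

primrec falling_seq :: "('c \<Rightarrow> nat) \<Rightarrow> 'c list \<Rightarrow> ('c \<Rightarrow> nat) \<Rightarrow> real" where
  "falling_seq N [] s = 1"
| "falling_seq N (c # cs) s = real (N c - s c) * falling_seq N cs (s(c := s c + 1))"

lemma falling_seq_bounds:
  assumes "\<And>c. c \<in> set cs \<Longrightarrow> real (N c) \<le> t"
  shows "0 \<le> falling_seq N cs s \<and> falling_seq N cs s \<le> t ^ length cs"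
  using assms
proof (induction cs arbitrary: s)
  case (Cons c cs)
  have le: "real (N c - s c) \<le> t" using Cons.prems[of c] by simp
  then have "0 \<le> t" by (rule order_trans[rotated]) simp
  then show ?case using le Cons.IH[of "s(c := s c + 1)"] Cons.prems
    by (auto simp del: fun_upd_apply intro!: mult_mono)
qed simp

context bip_degrees begin

lemma num_le_tot:
  assumes "c \<in> lengths k"
  shows "real (num c G) \<le> tot k G"
proof -
  have "finite {C \<in> short_cycs k. C \<subseteq> G}" using finite_short_cycs by simp
  then show ?thesis unfolding num_def tot_def using assms
    by (intro of_nat_mono card_mono) (auto simp: short_cycs_def)
qed

lemma disjoint_tuples_bounds:
  assumes "set cs \<subseteq> lengths k"
  shows "0 \<le> disjoint_tuples cs H G \<and> disjoint_tuples cs H G \<le> tot k G ^ length cs"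
  using assms
proof (induction cs arbitrary: H)
  case (Cons c cs)
  let ?T = "{C \<in> cycs c. \<Union>C \<inter> \<Union>H = {} \<and> C \<subseteq> G}"
  have IH: "0 \<le> disjoint_tuples cs H' G \<and> disjoint_tuples cs H' G \<le> tot k G ^ length cs" for H'
    using Cons by simp
  have "disjoint_tuples (c # cs) H G \<le> (\<Sum>C\<in>?T. tot k G ^ length cs)"
    unfolding disjoint_tuples.simps using IH by (intro sum_mono) blast
  also have "\<dots> = real (card ?T) * tot k G ^ length cs" by simp
  also have "\<dots> \<le> tot k G * tot k G ^ length cs"
  proof (rule mult_right_mono)
    have "card ?T \<le> num c G" unfolding num_def using finite_cycs by (intro card_mono) auto
    then show "real (card ?T) \<le> tot k G" using num_le_tot[of c k G] Cons.prems by simp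
  qed (simp add: tot_nonneg)
  finally show ?case using IH by (auto intro: sum_nonneg)
qed simp

text \<open>In an uncrowded graph distinct short cycles are automatically disjoint, so avoiding the
  nodes of the cycles in \<open>S\<close> just means choosing a cycle outside
  \<open>S\<close>.\<close>

lemma disjoint_tuples_eq_falling:
  assumes "\<not> crowded k G" "set cs \<subseteq> lengths k" "S \<subseteq> {C \<in> short_cycs k. C \<subseteq> G}"
  shows "disjoint_tuples cs (\<Union>S) G = falling_seq (\<lambda>c. num c G) cs (\<lambda>c. card (S \<inter> cycs c))"
  using assms(2,3)
proof (induction cs arbitrary: S)
  case (Cons c cs)
  let ?A = "{C \<in> cycs c. C \<subseteq> G}"
  have c: "c \<in> lengths k" using Cons.prems by simp
  have finS: "finite S" using Cons.prems(2) finite_short_cycs finite_subset by fastforce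
  have T: "{C \<in> cycs c. \<Union>C \<inter> \<Union>(\<Union>S) = {} \<and> C \<subseteq> G} = ?A - S" (is "?T = _")
  proof (intro equalityI subsetI)
    fix C assume C: "C \<in> ?T"
    then have "C \<in> cycs c" "\<Union>C \<inter> \<Union>(\<Union>S) = {}" by auto
    then have "C \<notin> S" using Union_cycs_nonempty by blast
    then show "C \<in> ?A - S" using C by simp
  next
    fix C assume C: "C \<in> ?A - S"
    then have Cs: "C \<in> short_cycs k" using c by (auto simp: short_cycs_def)
    have "\<Union>C \<inter> \<Union>C' = {}" if "C' \<in> S" for C'
    proof -
      have "C' \<in> short_cycs k" "C' \<subseteq> G" "C \<noteq> C'" "C \<subseteq> G" using that C Cons.prems(2) by auto
      then show ?thesis using assms(1) Cs unfolding crowded_def by blast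
    qed
    then show "C \<in> ?T" using C by blast
  qed
  have step: "disjoint_tuples cs (\<Union>S \<union> C) G
      = falling_seq (\<lambda>c. num c G) cs ((\<lambda>c. card (S \<inter> cycs c))(c := card (S \<inter> cycs c) + 1))"
    if "C \<in> ?A - S" for C
  proof -
    have C: "C \<in> cycs c" "C \<subseteq> G" "C \<notin> S" using that by auto
    have "(\<lambda>c'. card (insert C S \<inter> cycs c')) = (\<lambda>c. card (S \<inter> cycs c))(c := card (S \<inter> cycs c) + 1)"
    proof
      fix c'
      show "card (insert C S \<inter> cycs c') = ((\<lambda>c. card (S \<inter> cycs c))(c := card (S \<inter> cycs c) + 1)) c'"
      proof (cases "c' = c")
        case True
        then show ?thesis using C finS by simp
      next
        case False
        then have "C \<notin> cycs c'" using C cycs_unique by blast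
        then show ?thesis using False by simp
      qed
    qed
    moreover have "insert C S \<subseteq> {C \<in> short_cycs k. C \<subseteq> G}"
      using C c Cons.prems by (auto simp: short_cycs_def)
    ultimately show ?thesis using Cons.IH[of "insert C S"] Cons.prems(1) by (simp add: Un_commute)
  qed
  have "card (?A - S) = num c G - card (S \<inter> cycs c)"
  proof -
    have "S \<inter> cycs c \<subseteq> ?A" using Cons.prems(2) by auto
    then have "card (?A - S \<inter> cycs c) = card ?A - card (S \<inter> cycs c)"
      using finS by (intro card_Diff_subset) simp
    moreover have "?A - S \<inter> cycs c = ?A - S" by auto
    ultimately show ?thesis by (simp add: num_def)
  qed
  then show ?case unfolding disjoint_tuples.simps T using step by simp
qed simp

text \<open>Both ways of counting agree on uncrowded graphs, and on crowded ones both lie between 0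
  and a power of \<open>tot\<close>. The edge allowance is \<open>2 * k\<close> for a meeting pair
  and \<open>k\<close> for every cycle of the tuple.\<close>

lemma sum_falling_approx:
  assumes "set cs \<subseteq> lengths k" "2 * k + length cs * k \<le> L"
  shows "\<bar>(\<Sum>G\<in>graphs. falling_seq (\<lambda>c. num c G) cs (\<lambda>_. 0)) - (\<Prod>c\<leftarrow>cs. mean c) * cnt {}\<bar>
    \<le> (length cs * (mean_bound + cycle_error) ^ length cs + total_bound ^ (length cs + 1) * edge_bound * near_bound) / \<eta> * cnt {}"
proof -
  let ?f = "\<lambda>G. falling_seq (\<lambda>c. num c G) cs (\<lambda>_. 0)" and ?g = "\<lambda>G. disjoint_tuples cs {} G"
  have cs: "\<forall>c\<in>set cs. even c \<and> 3 \<le> c" "\<forall>c\<in>set cs. c \<le> k"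
    using assms(1) by (auto simp: lengths_def)
  have "sum_list cs \<le> length cs * k" using cs(2) by (induction cs) auto
  then have 1: "\<bar>tuple_sum cs {} - (\<Prod>c\<leftarrow>cs. mean c) * cnt {}\<bar> \<le> length cs * (mean_bound + cycle_error) ^ length cs / \<eta> * cnt {}"
    using assms(2) cs(1) by (intro tuple_sum_approx) auto
  have "\<bar>(\<Sum>G\<in>graphs. ?f G) - tuple_sum cs {}\<bar> = \<bar>\<Sum>G\<in>graphs. ?f G - ?g G\<bar>"
    by (simp add: tuple_sum_def sum_subtractf)
  also have "\<dots> \<le> (\<Sum>G\<in>graphs. if crowded k G then tot k G ^ length cs else 0)"
  proof (rule order_trans[OF sum_abs sum_mono])
    fix G
    show "\<bar>?f G - ?g G\<bar> \<le> (if crowded k G then tot k G ^ length cs else 0)"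
    proof (cases "crowded k G")
      case True
      have "0 \<le> ?f G \<and> ?f G \<le> tot k G ^ length cs"
        using num_le_tot assms(1) by (intro falling_seq_bounds) auto
      then show ?thesis using True disjoint_tuples_bounds[OF assms(1), of "{}" G] by (simp add: abs_le_iff)
    next
      case False
      then show ?thesis using disjoint_tuples_eq_falling[OF False assms(1), of "{}"] by simp
    qed
  qed
  also have "\<dots> = (\<Sum>G | G \<in> graphs \<and> crowded k G. tot k G ^ length cs)"
    using finite_graphs by (simp add: sum.If_cases Int_def)
  also have "\<dots> \<le> total_bound ^ (length cs + 1) * edge_bound * near_bound / \<eta> * cnt {}" by (rule sum_crowded_le[OF assms(2)])
  finally have 2: "\<bar>(\<Sum>G\<in>graphs. ?f G) - tuple_sum cs {}\<bar> \<le> total_bound ^ (length cs + 1) * edge_bound * near_bound / \<eta> * cnt {}" .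
  have "(length cs * (mean_bound + cycle_error) ^ length cs + total_bound ^ (length cs + 1) * edge_bound * near_bound) / \<eta> * cnt {}
    = length cs * (mean_bound + cycle_error) ^ length cs / \<eta> * cnt {} + total_bound ^ (length cs + 1) * edge_bound * near_bound / \<eta> * cnt {}"
    by (simp only: add_divide_distrib distrib_right)
  then show ?thesis using 1 2 by linarith
qed

end


subsection \<open>From factorial moments to Poisson probabilities\<close>

definition falling :: "nat \<Rightarrow> nat \<Rightarrow> real" where
  "falling n r = (\<Prod>j<r. real (n - j))"

lemma falling_nonneg: "0 \<le> falling n r"
  unfolding falling_def by (intro prod_nonneg) simp

lemma falling_eq_binomial: "falling n r = fact r * real (n choose r)"
proof (cases "r \<le> n")
  case True
  then have "real (n choose r) * fact r = (\<Prod>i<r. of_nat n - of_nat i)"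
    by (simp add: binomial_gbinomial gbinomial_mult_fact' atLeast0LessThan)
  also have "\<dots> = falling n r"
    unfolding falling_def using True by (intro prod.cong) (auto simp: of_nat_diff)
  finally show ?thesis by (simp add: mult.commute)
next
  case False
  then have "falling n r = 0" unfolding falling_def by (auto intro!: bexI[of _ n])
  then show ?thesis using False by simp
qed

lemma alternating_binomial_sum:
  "0 < m \<Longrightarrow> (\<Sum>j<Suc J. (-1) ^ j * real (m choose j)) = (-1) ^ J * real ((m - 1) choose J)"
proof (induction J)
  case (Suc J)
  have "real (m choose Suc J) = real ((m - 1) choose J) + real ((m - 1) choose Suc J)"
    using Suc.prems binomial_Suc_Suc[of "m - 1" J] by simp
  then show ?case using Suc by (simp add: algebra_simps)
qed simp

text \<open>For positive \<open>m\<close> and \<open>J\<close> the alternating sum is, up to sign,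
  \<open>(m - 1) choose (J - 1)\<close>, one of the two terms that make up \<open>m choose J\<close>
  by Pascal's rule.\<close>

lemma bonferroni_zero: "\<bar>of_bool (m = 0) - (\<Sum>j<J. (-1) ^ j * real (m choose j))\<bar> \<le> real (m choose J)"
proof (cases J)
  case 0
  then show ?thesis by simp
next
  case (Suc i)
  show ?thesis
  proof (cases "m = 0")
    case True
    have "(\<Sum>j<Suc i. (-1) ^ j * real (0 choose j)) = 1"
      by (induction i) simp_all
    then show ?thesis using True Suc by simp
  next
    case False
    then have "m choose J = (m - 1 choose i) + (m - 1 choose Suc i)"
      using Suc binomial_Suc_Suc[of "m - 1" i] by simp
    then show ?thesis using False Suc alternating_binomial_sum[of m i] by (simp add: abs_mult power_abs)
  qed
qed

text \<open>Choosing \<open>x + j\<close> objects and marking \<open>x\<close> of them amounts to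
  choosing \<open>x\<close> first and \<open>j\<close> of the rest. It separates the prescribed
  value \<open>x\<close> from the \<open>j\<close> objects of the inclusion-exclusion sum.\<close>

lemma falling_add: "falling n (x + j) / (fact x * fact j) = real (n choose x) * real ((n - x) choose j)"
proof (cases "x + j \<le> n")
  case True
  have "(n choose (x + j)) * ((x + j) choose x) = (n choose x) * ((n - x) choose (x + j - x))"
    using True by (intro choose_mult) auto
  then have "real (n choose (x + j)) * real ((x + j) choose x) = real (n choose x) * real ((n - x) choose j)"
    by (metis add_diff_cancel_left' of_nat_mult)
  moreover have "real ((x + j) choose x) = fact (x + j) / (fact x * fact j)"
    using binomial_fact[of x "x + j", where ?'a = real] by simp
  ultimately show ?thesis unfolding falling_eq_binomial by (simp add: mult_ac)
next
  case False
  then show ?thesis unfolding falling_eq_binomial by (cases "x \<le> n") (auto simp: binomial_eq_0)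
qed

lemma bonferroni:
  "\<bar>of_bool (n = x) - (\<Sum>j<J. (-1) ^ j * falling n (x + j) / (fact x * fact j))\<bar>
    \<le> falling n (x + J) / (fact x * fact J)"
proof -
  have "(\<Sum>j<J. (-1) ^ j * falling n (x + j) / (fact x * fact j))
      = real (n choose x) * (\<Sum>j<J. (-1) ^ j * real ((n - x) choose j))"
    unfolding sum_distrib_left
  proof (rule sum.cong)
    fix j
    have "(-1) ^ j * falling n (x + j) / (fact x * fact j) = (-1) ^ j * (falling n (x + j) / (fact x * fact j))"
      by (rule times_divide_eq_right[symmetric])
    then show "(-1) ^ j * falling n (x + j) / (fact x * fact j)
        = real (n choose x) * ((-1) ^ j * real ((n - x) choose j))"
      unfolding falling_add by simp
  qed simp
  moreover have "of_bool (n = x) = real (n choose x) * of_bool (n - x = 0)"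
    by (cases "n < x") (auto simp: binomial_eq_0)
  ultimately have "\<bar>of_bool (n = x) - (\<Sum>j<J. (-1) ^ j * falling n (x + j) / (fact x * fact j))\<bar>
      = real (n choose x) * \<bar>of_bool (n - x = 0) - (\<Sum>j<J. (-1) ^ j * real ((n - x) choose j))\<bar>"
    by (simp only: right_diff_distrib[symmetric] abs_mult abs_of_nat)
  also have "\<dots> \<le> real (n choose x) * real ((n - x) choose J)"
    by (intro mult_left_mono bonferroni_zero) simp
  finally show ?thesis by (simp only: falling_add)
qed

definition poisson :: "real \<Rightarrow> nat \<Rightarrow> real" where
  "poisson l x = exp (- l) * l ^ x / fact x"

lemma poisson_bounds:
  assumes "0 \<le> l" "l \<le> b" "1 \<le> b"
  shows "0 \<le> poisson l x" "poisson l x \<le> b ^ x"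
proof -
  show "0 \<le> poisson l x" using assms by (simp add: poisson_def)
  have "exp (- l) * l ^ x / fact x \<le> 1 * l ^ x / 1"
    using assms by (intro frac_le mult_right_mono fact_ge_1) auto
  also have "\<dots> \<le> b ^ x" using assms by (simp add: power_mono)
  finally show "poisson l x \<le> b ^ x" by (simp add: poisson_def)
qed

text \<open>The remainder of the exponential series is taken in Lagrange form; its intermediate
  point is at most \<open>b\<close>, which makes the bound uniform in \<open>l\<close>.\<close>

lemma poisson_partial_sum:
  assumes "0 \<le> l" "l \<le> b"
  shows "\<bar>(\<Sum>j<J. (-1) ^ j * l ^ (x + j) / (fact x * fact j)) - poisson l x\<bar>
    \<le> exp b * l ^ (x + J) / (fact x * fact J)"
proof -
  obtain t where t: "\<bar>t\<bar> \<le> \<bar>- l\<bar>" "exp (- l) = (\<Sum>m<J. (- l) ^ m / fact m) + exp t / fact J * (- l) ^ J"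
    using Maclaurin_exp_le by blast
  have "(\<Sum>j<J. (-1) ^ j * l ^ (x + j) / (fact x * fact j)) = l ^ x / fact x * (\<Sum>m<J. (- l) ^ m / fact m)"
    by (simp add: sum_distrib_left power_add power_minus[of l] mult_ac)
  moreover have "poisson l x = l ^ x / fact x * exp (- l)" by (simp add: poisson_def)
  ultimately have "\<bar>(\<Sum>j<J. (-1) ^ j * l ^ (x + j) / (fact x * fact j)) - poisson l x\<bar>
      = \<bar>l ^ x / fact x * (exp t / fact J * (- l) ^ J)\<bar>"
    unfolding t(2) by (simp add: algebra_simps)
  also have "\<dots> = l ^ x / fact x * (exp t / fact J * l ^ J)"
    using assms by (simp add: abs_mult power_abs)
  also have "\<dots> \<le> l ^ x / fact x * (exp b / fact J * l ^ J)"
    using assms t(1) by (intro mult_left_mono mult_right_mono divide_right_mono) auto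
  finally show ?thesis by (simp add: power_add mult_ac)
qed

definition average :: "'a set \<Rightarrow> ('a \<Rightarrow> real) \<Rightarrow> real" where
  "average A f = (\<Sum>a\<in>A. f a) / card A"

lemma average_nonneg: "(\<And>a. a \<in> A \<Longrightarrow> 0 \<le> f a) \<Longrightarrow> 0 \<le> average A f"
  unfolding average_def by (intro divide_nonneg_nonneg sum_nonneg) auto

lemma average_abs_le: "(\<And>a. a \<in> A \<Longrightarrow> \<bar>f a\<bar> \<le> g a) \<Longrightarrow> \<bar>average A f\<bar> \<le> average A g"
  unfolding average_def abs_divide abs_of_nat
  by (intro divide_right_mono order_trans[OF sum_abs sum_mono]) auto

lemma average_linear:
  "average A (\<lambda>a. f a - (\<Sum>j\<in>J. c j * g j a)) = average A f - (\<Sum>j\<in>J. c j * average A (g j))"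
proof -
  have "(\<Sum>a\<in>A. \<Sum>j\<in>J. c j * g j a) = (\<Sum>j\<in>J. c j * (\<Sum>a\<in>A. g j a))"
    by (subst sum.swap) (simp add: sum_distrib_left)
  moreover have "(\<Sum>j\<in>J. c j * (\<Sum>a\<in>A. g j a)) / card A = (\<Sum>j\<in>J. c j * ((\<Sum>a\<in>A. g j a) / card A))"
    by (subst sum_divide_distrib) simp
  ultimately show ?thesis unfolding average_def by (simp add: sum_subtractf diff_divide_distrib)
qed

lemma average_cmult: "average A (\<lambda>a. f a * c) = average A f * c"
  unfolding average_def by (simp add: sum_distrib_right)

lemma power_over_fact_tendsto_0: "(\<lambda>J. (b::real) ^ J / fact J) \<longlonglongrightarrow> 0"
  using summable_LIMSEQ_zero[OF summable_exp[of b]] by (simp add: divide_inverse mult.commute)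

text \<open>The Bonferroni inequalities turn the indicators of \<open>N c = x c\<close> into combinations of
  factorial moments, one type \<open>c\<close> at a time.\<close>

lemma factorial_moments_imp_poisson_partial:
  fixes A :: "'i \<Rightarrow> 'a set" and N :: "'a \<Rightarrow> 'c \<Rightarrow> nat" and l :: "'i \<Rightarrow> 'c \<Rightarrow> real"
  assumes "finite T" and b: "1 \<le> b" "\<forall>\<^sub>F t in F. \<forall>c\<in>T. 0 \<le> l t c \<and> l t c \<le> b"
    and mom: "\<And>r. ((\<lambda>t. average (A t) (\<lambda>a. \<Prod>c\<in>T. falling (N a c) (r c)) - (\<Prod>c\<in>T. l t c ^ r c)) \<longlongrightarrow> 0) F"
    and "S \<subseteq> T"
  shows "((\<lambda>t. average (A t) (\<lambda>a. (\<Prod>c\<in>S. of_bool (N a c = x c)) * (\<Prod>c\<in>T - S. falling (N a c) (r c)))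
    - (\<Prod>c\<in>S. poisson (l t c) (x c)) * (\<Prod>c\<in>T - S. l t c ^ r c)) \<longlongrightarrow> 0) F"
proof -
  have "finite S" using assms finite_subset by blast
  then show ?thesis using \<open>S \<subseteq> T\<close>
  \<comment> \<open>The exponents must be free: converting type \<open>c\<close> uses the induction
    hypothesis with exponent \<open>x c + j\<close> at \<open>c\<close> for every \<open>j\<close>
    up to the truncation point.\<close>
  proof (induction S arbitrary: r rule: finite_induct)
    case empty
    then show ?case using mom by simp
  next
    case (insert c S)
    define T' where "T' = T - insert c S"
    have T': "T - S = insert c T'" "c \<notin> T'" "finite T'" "T' \<subseteq> T"
      using insert assms(1) by (auto simp: T'_def)
    define h where "h a = (\<Prod>c\<in>S. of_bool (N a c = x c)) * (\<Prod>c\<in>T'. falling (N a c) (r c))" for a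
    define p where "p t = (\<Prod>c\<in>S. poisson (l t c) (x c)) * (\<Prod>c\<in>T'. l t c ^ r c)" for t
    define m where "m = x c"
    define \<delta> where "\<delta> j t = average (A t) (\<lambda>a. h a * falling (N a c) (m + j)) - p t * l t c ^ (m + j)" for j t
    define K where "K = (\<Prod>c\<in>S. b ^ x c) * (\<Prod>c\<in>T'. b ^ r c)"
    define \<alpha> :: "nat \<Rightarrow> real" where "\<alpha> j = (-1) ^ j / (fact m * fact j)" for j
    have h0: "0 \<le> h a" for a
      unfolding h_def by (intro mult_nonneg_nonneg prod_nonneg) (auto simp: falling_nonneg)
    have \<delta>: "(\<delta> j \<longlongrightarrow> 0) F" for j
    proof -
      let ?r = "r(c := m + j)"
      have "(\<Prod>c\<in>T - S. falling (N a c) (?r c)) = (\<Prod>c\<in>T'. falling (N a c) (r c)) * falling (N a c) (m + j)" for a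
      proof -
        have "(\<Prod>c\<in>T'. falling (N a c) (?r c)) = (\<Prod>c\<in>T'. falling (N a c) (r c))"
          using T'(2) by (intro prod.cong) auto
        then show ?thesis unfolding T'(1) using T'(2,3) by simp
      qed
      moreover have "(\<Prod>c\<in>T - S. l t c ^ ?r c) = (\<Prod>c\<in>T'. l t c ^ r c) * l t c ^ (m + j)" for t
      proof -
        have "(\<Prod>c\<in>T'. l t c ^ ?r c) = (\<Prod>c\<in>T'. l t c ^ r c)"
          using T'(2) by (intro prod.cong) auto
        then show ?thesis unfolding T'(1) using T'(2,3) by simp
      qed
      ultimately show ?thesis
        using insert.IH[of ?r] insert.prems unfolding \<delta>_def h_def p_def by (simp add: mult.assoc)
    qed
    have \<alpha>: "\<bar>\<alpha> j\<bar> \<le> 1" for j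
    proof -
      have "1 * 1 \<le> fact m * (fact j :: real)" by (intro mult_mono fact_ge_1) auto
      then show ?thesis unfolding \<alpha>_def by (simp add: power_abs)
    qed
    \<comment> \<open>Three errors are combined: the moment errors \<open>\<delta> j t\<close>, the
      Bonferroni truncation and the truncation of the exponential series. Both truncations are
      multiples of \<open>b ^ J / fact J\<close>, uniformly in \<open>t\<close>.\<close>
    have bound: "\<forall>\<^sub>F t in F. \<bar>average (A t) (\<lambda>a. h a * of_bool (N a c = m)) - p t * poisson (l t c) m\<bar>
        \<le> (\<Sum>j<Suc J. \<bar>\<delta> j t\<bar>) + K * (1 + exp b) * b ^ m * (b ^ J / fact J)" for J
      using b(2)
    proof eventually_elim
      case (elim t)
      have lc: "0 \<le> l t c" "l t c \<le> b" using elim insert.prems by auto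
      have p: "0 \<le> p t" "p t \<le> K"
      proof -
        show "0 \<le> p t" unfolding p_def using elim insert.prems T' b(1)
          by (intro mult_nonneg_nonneg prod_nonneg) (auto intro: poisson_bounds)
        show "p t \<le> K" unfolding p_def K_def
        proof (intro mult_mono prod_mono)
          fix c' assume "c' \<in> S"
          then have "0 \<le> l t c'" "l t c' \<le> b" using elim insert.prems by auto
          then show "0 \<le> poisson (l t c') (x c') \<and> poisson (l t c') (x c') \<le> b ^ x c'"
            using poisson_bounds b(1) by blast
        next
          fix c' assume "c' \<in> T'"
          then show "0 \<le> l t c' ^ r c' \<and> l t c' ^ r c' \<le> b ^ r c'"
            using elim T' by (auto intro!: power_mono)
        qed (use elim T' b(1) in \<open>auto intro!: prod_nonneg\<close>)
      qed
      define f where "f = fact m * (fact J :: real)"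
      have f: "fact J \<le> f" "0 < f" unfolding f_def by (simp_all add: fact_ge_1)
      define L where "L = l t c ^ (m + J) / f"
      have L: "0 \<le> L" "L \<le> b ^ m * (b ^ J / fact J)"
      proof -
        show "0 \<le> L" unfolding L_def using lc f by simp
        have "L \<le> b ^ (m + J) / fact J"
          unfolding L_def using lc f b(1) by (intro frac_le power_mono) auto
        then show "L \<le> b ^ m * (b ^ J / fact J)" by (simp add: power_add)
      qed
      let ?g = "\<lambda>j a. h a * falling (N a c) (m + j)"
      have "\<bar>average (A t) (\<lambda>a. h a * of_bool (N a c = m) - (\<Sum>j<J. \<alpha> j * ?g j a))\<bar>
          \<le> average (A t) (\<lambda>a. ?g J a * (1 / f))"
      proof (rule average_abs_le)
        fix a
        have "h a * of_bool (N a c = m) - (\<Sum>j<J. \<alpha> j * ?g j a)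
            = h a * (of_bool (N a c = m) - (\<Sum>j<J. (-1) ^ j * falling (N a c) (m + j) / (fact m * fact j)))"
          by (simp add: \<alpha>_def right_diff_distrib sum_distrib_left mult_ac)
        then have "\<bar>h a * of_bool (N a c = m) - (\<Sum>j<J. \<alpha> j * ?g j a)\<bar>
            = h a * \<bar>of_bool (N a c = m) - (\<Sum>j<J. (-1) ^ j * falling (N a c) (m + j) / (fact m * fact j))\<bar>"
          using h0[of a] by (simp add: abs_mult)
        also have "\<dots> \<le> h a * (falling (N a c) (m + J) / f)"
          unfolding f_def by (intro mult_left_mono bonferroni h0)
        finally show "\<bar>h a * of_bool (N a c = m) - (\<Sum>j<J. \<alpha> j * ?g j a)\<bar> \<le> ?g J a * (1 / f)" by simp
      qed
      also have "\<dots> = (\<delta> J t + p t * l t c ^ (m + J)) / f"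
        unfolding average_cmult by (simp add: \<delta>_def)
      also have "\<dots> = \<delta> J t / f + p t * L" by (simp add: L_def add_divide_distrib)
      also have "\<delta> J t / f \<le> \<bar>\<delta> J t\<bar>"
      proof -
        have "1 \<le> f" using f(1) fact_ge_1[of J, where ?'a = real] by linarith
        then have "\<bar>\<delta> J t\<bar> / f \<le> \<bar>\<delta> J t\<bar> / 1" by (intro divide_left_mono) auto
        then show ?thesis using f(2) abs_ge_self[of "\<delta> J t / f"] by (simp add: abs_divide)
      qed
      finally have 1: "\<bar>average (A t) (\<lambda>a. h a * of_bool (N a c = m)) - (\<Sum>j<J. \<alpha> j * average (A t) (?g j))\<bar>
          \<le> \<bar>\<delta> J t\<bar> + p t * L"
        unfolding average_linear by simp
      have 2: "\<bar>(\<Sum>j<J. \<alpha> j * average (A t) (?g j)) - p t * (\<Sum>j<J. \<alpha> j * l t c ^ (m + j))\<bar> \<le> (\<Sum>j<J. \<bar>\<delta> j t\<bar>)"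
      proof -
        have "(\<Sum>j<J. \<alpha> j * average (A t) (?g j)) - p t * (\<Sum>j<J. \<alpha> j * l t c ^ (m + j)) = (\<Sum>j<J. \<alpha> j * \<delta> j t)"
          by (simp add: \<delta>_def right_diff_distrib sum_subtractf sum_distrib_left mult_ac)
        also have "\<bar>\<dots>\<bar> \<le> (\<Sum>j<J. \<bar>\<delta> j t\<bar>)"
        proof (rule order_trans[OF sum_abs sum_mono])
          fix j
          show "\<bar>\<alpha> j * \<delta> j t\<bar> \<le> \<bar>\<delta> j t\<bar>"
            using mult_right_mono[OF \<alpha>[of j], of "\<bar>\<delta> j t\<bar>"] by (simp add: abs_mult)
        qed
        finally show ?thesis by simp
      qed
      have "\<bar>(\<Sum>j<J. \<alpha> j * l t c ^ (m + j)) - poisson (l t c) m\<bar> \<le> exp b * L"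
        using poisson_partial_sum[OF lc, where J = J and x = m] by (simp add: \<alpha>_def L_def f_def)
      then have "p t * \<bar>(\<Sum>j<J. \<alpha> j * l t c ^ (m + j)) - poisson (l t c) m\<bar> \<le> p t * (exp b * L)"
        using p by (intro mult_left_mono)
      then have 3: "\<bar>p t * (\<Sum>j<J. \<alpha> j * l t c ^ (m + j)) - p t * poisson (l t c) m\<bar> \<le> p t * (exp b * L)"
        using p(1) by (simp only: right_diff_distrib[symmetric] abs_mult abs_of_nonneg)
      have "p t * L + p t * (exp b * L) = p t * ((1 + exp b) * L)" by (simp add: algebra_simps)
      also have "\<dots> \<le> K * ((1 + exp b) * (b ^ m * (b ^ J / fact J)))"
        using p L by (intro mult_mono) auto
      finally show ?case using 1 2 3 by (simp add: mult_ac)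
    qed
    have "((\<lambda>t. average (A t) (\<lambda>a. h a * of_bool (N a c = m)) - p t * poisson (l t c) m) \<longlongrightarrow> 0) F"
    proof (rule tendstoI)
      fix e :: real assume e: "0 < e"
      \<comment> \<open>The order of choices matters: \<open>J\<close> is fixed first to make the
        truncation small for all \<open>t\<close> at once, and only then do the finitely many moment
        errors tend to 0.\<close>
      have "(\<lambda>J. K * (1 + exp b) * b ^ m * (b ^ J / fact J)) \<longlonglongrightarrow> K * (1 + exp b) * b ^ m * 0"
        by (intro tendsto_mult_left power_over_fact_tendsto_0)
      then have "\<forall>\<^sub>F J in sequentially. K * (1 + exp b) * b ^ m * (b ^ J / fact J) < e / 2"
        using e by (intro order_tendstoD) auto
      then obtain J where J: "K * (1 + exp b) * b ^ m * (b ^ J / fact J) < e / 2"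
        by (meson eventually_happens' sequentially_bot)
      have "((\<lambda>t. \<Sum>j<Suc J. \<bar>\<delta> j t\<bar>) \<longlongrightarrow> (\<Sum>j<Suc J. \<bar>0\<bar>)) F"
        by (intro tendsto_intros \<delta>)
      then have "\<forall>\<^sub>F t in F. (\<Sum>j<Suc J. \<bar>\<delta> j t\<bar>) < e / 2" using e by (intro order_tendstoD) auto
      then show "\<forall>\<^sub>F t in F. dist (average (A t) (\<lambda>a. h a * of_bool (N a c = m)) - p t * poisson (l t c) m) 0 < e"
        using bound[of J]
      proof eventually_elim
        case (elim t)
        then show ?case using J unfolding dist_real_def diff_zero by linarith
      qed
    qed
    then show ?case
      unfolding h_def p_def m_def T'_def using insert.hyps by (simp add: mult_ac)
  qed
qed

text \<open>The parameters \<open>l t c\<close> need not converge; boundedness suffices. This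
  matters because the degree sequences may vary without any limit.\<close>

lemma factorial_moments_imp_poisson:
  fixes A :: "'i \<Rightarrow> 'a set" and N :: "'a \<Rightarrow> 'c \<Rightarrow> nat" and l :: "'i \<Rightarrow> 'c \<Rightarrow> real"
  assumes "finite T" "1 \<le> b" "\<forall>\<^sub>F t in F. \<forall>c\<in>T. 0 \<le> l t c \<and> l t c \<le> b"
    and "\<And>r. ((\<lambda>t. average (A t) (\<lambda>a. \<Prod>c\<in>T. falling (N a c) (r c)) - (\<Prod>c\<in>T. l t c ^ r c)) \<longlongrightarrow> 0) F"
  shows "((\<lambda>t. average (A t) (\<lambda>a. of_bool (\<forall>c\<in>T. N a c = x c)) - (\<Prod>c\<in>T. poisson (l t c) (x c))) \<longlongrightarrow> 0) F"
proof -
  have "(\<Prod>c\<in>T. of_bool (N a c = x c)) = (of_bool (\<forall>c\<in>T. N a c = x c) :: real)" for a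
    using assms(1) by (induction T rule: finite_induct) auto
  then show ?thesis
    using factorial_moments_imp_poisson_partial[OF assms(1-4) order_refl, where x = x] by simp
qed

lemma prod_diff_tendsto_0:
  fixes f g :: "'i \<Rightarrow> 'c \<Rightarrow> real"
  assumes "finite T" "\<And>c. c \<in> T \<Longrightarrow> ((\<lambda>t. f t c - g t c) \<longlongrightarrow> 0) F"
    and "0 \<le> b" "\<forall>\<^sub>F t in F. \<forall>c\<in>T. \<bar>f t c\<bar> \<le> b \<and> \<bar>g t c\<bar> \<le> b"
  shows "((\<lambda>t. (\<Prod>c\<in>T. f t c) - (\<Prod>c\<in>T. g t c)) \<longlongrightarrow> 0) F"
  using assms(1,2,4)
proof (induction T rule: finite_induct)
  case empty
  then show ?case by simp
next
  case (insert c T)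
  have IH: "((\<lambda>t. (\<Prod>c\<in>T. f t c) - (\<Prod>c\<in>T. g t c)) \<longlongrightarrow> 0) F"
  proof (rule insert.IH)
    show "\<forall>\<^sub>F t in F. \<forall>c\<in>T. \<bar>f t c\<bar> \<le> b \<and> \<bar>g t c\<bar> \<le> b"
      using insert.prems(2) by (rule eventually_mono) simp
  qed (use insert.prems(1) in simp)
  have "((\<lambda>t. \<bar>f t c - g t c\<bar> * b ^ card T + b * \<bar>(\<Prod>c\<in>T. f t c) - (\<Prod>c\<in>T. g t c)\<bar>) \<longlongrightarrow> \<bar>0\<bar> * b ^ card T + b * \<bar>0\<bar>) F"
    using insert by (intro tendsto_intros IH) auto
  then have lim: "((\<lambda>t. \<bar>f t c - g t c\<bar> * b ^ card T + b * \<bar>(\<Prod>c\<in>T. f t c) - (\<Prod>c\<in>T. g t c)\<bar>) \<longlongrightarrow> 0) F" by simp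
  show ?case
  proof (rule Lim_null_comparison[OF _ lim])
    show "\<forall>\<^sub>F t in F. norm ((\<Prod>c\<in>insert c T. f t c) - (\<Prod>c\<in>insert c T. g t c))
        \<le> \<bar>f t c - g t c\<bar> * b ^ card T + b * \<bar>(\<Prod>c\<in>T. f t c) - (\<Prod>c\<in>T. g t c)\<bar>"
      using insert.prems(2)
    proof eventually_elim
      case (elim t)
      have "(\<Prod>c\<in>insert c T. f t c) - (\<Prod>c\<in>insert c T. g t c)
          = (f t c - g t c) * (\<Prod>c\<in>T. f t c) + g t c * ((\<Prod>c\<in>T. f t c) - (\<Prod>c\<in>T. g t c))"
        using insert.hyps by (simp add: algebra_simps)
      also have "\<bar>\<dots>\<bar> \<le> \<bar>f t c - g t c\<bar> * \<bar>\<Prod>c\<in>T. f t c\<bar> + \<bar>g t c\<bar> * \<bar>(\<Prod>c\<in>T. f t c) - (\<Prod>c\<in>T. g t c)\<bar>"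
        by (rule order_trans[OF abs_triangle_ineq]) (simp add: abs_mult)
      also have "\<dots> \<le> \<bar>f t c - g t c\<bar> * b ^ card T + b * \<bar>(\<Prod>c\<in>T. f t c) - (\<Prod>c\<in>T. g t c)\<bar>"
      proof (intro add_mono mult_left_mono mult_right_mono)
        have "\<bar>\<Prod>c\<in>T. f t c\<bar> \<le> (\<Prod>c\<in>T. b)" unfolding abs_prod using elim by (intro prod_mono) auto
        then show "\<bar>\<Prod>c\<in>T. f t c\<bar> \<le> b ^ card T" by simp
      qed (use elim in auto)
      finally show ?case by simp
    qed
  qed
qed

lemma falling_seq_eq_prod:
  assumes "finite T" "set cs \<subseteq> T"
  shows "falling_seq N cs s = (\<Prod>c\<in>T. \<Prod>j<count_list cs c. real (N c - (s c + j)))"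
  using assms(2)
proof (induction cs arbitrary: s)
  case (Cons a cs)
  have "(\<Prod>c\<in>T. \<Prod>j<count_list (a # cs) c. real (N c - (s c + j)))
      = (\<Prod>c\<in>T. (if c = a then real (N c - s c) else 1)
          * (\<Prod>j<count_list cs c. real (N c - ((s(a := s a + 1)) c + j))))"
    by (rule prod.cong) (auto simp: prod.lessThan_Suc_shift simp del: prod.lessThan_Suc)
  also have "\<dots> = real (N a - s a) * falling_seq N cs (s(a := s a + 1))"
    using Cons assms(1) by (simp add: prod.distrib del: fun_upd_apply)
  finally show ?case by simp
qed simp

lemma prod_list_eq_prod_count:
  fixes f :: "'c \<Rightarrow> real"
  assumes "finite T" "set cs \<subseteq> T"
  shows "(\<Prod>c\<leftarrow>cs. f c) = (\<Prod>c\<in>T. f c ^ count_list cs c)"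
  using assms(2)
proof (induction cs)
  case (Cons a cs)
  have "(\<Prod>c\<in>T. f c ^ count_list (a # cs) c) = (\<Prod>c\<in>T. (if c = a then f c else 1) * f c ^ count_list cs c)"
    by (rule prod.cong) auto
  also have "\<dots> = f a * (\<Prod>c\<in>T. f c ^ count_list cs c)" using Cons assms(1) by (simp add: prod.distrib)
  finally show ?case using Cons by simp
qed simp

lemma ex_list_with_counts:
  assumes "finite T"
  shows "\<exists>cs. set cs \<subseteq> T \<and> (\<forall>c\<in>T. count_list cs c = r c)"
  using assms
proof (induction T rule: finite_induct)
  case empty
  then show ?case by simp
next
  case (insert a T)
  then obtain cs where cs: "set cs \<subseteq> T" "\<forall>c\<in>T. count_list cs c = r c" by blast
  have rep: "count_list (replicate n a) c = (if c = a then n else 0)" for n c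
    by (induction n) auto
  have "count_list cs a = 0" using cs insert.hyps by (auto simp: count_list_0_iff)
  then have "set (replicate (r a) a @ cs) \<subseteq> insert a T"
    "\<forall>c\<in>insert a T. count_list (replicate (r a) a @ cs) c = r c"
    using cs insert.hyps by (auto simp: rep)
  then show ?case by blast
qed


subsection \<open>Random bipartite graphs\<close>

text \<open>With \<open>x = ln h / (h - 1)\<close> Specht's ratio equals
  \<open>exp (x - 1) / x\<close>, so the claim is the inequality \<open>1 + y \<le> exp y\<close> at
  \<open>y = x - 1\<close>.\<close>

lemma specht_ge_1:
  assumes "1 \<le> h"
  shows "1 \<le> specht h"
proof (cases "h = 1")
  case False
  define x where "x = ln h / (h - 1)"
  have h: "1 < h" using assms False by simp
  have x: "0 < x" unfolding x_def using h by simp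
  have "h powr (1 / (h - 1)) = exp x" unfolding x_def using h by (simp add: powr_def)
  then have "specht h = exp x / (exp 1 * x)"
    unfolding specht_def x_def using h False by (simp add: field_simps)
  also have "\<dots> = exp (x - 1) / x" by (simp add: exp_diff)
  finally have "specht h = exp (x - 1) / x" .
  moreover have "x \<le> exp (x - 1)" using exp_ge_add_one_self[of "x - 1"] by simp
  ultimately show ?thesis using x by simp
qed (simp add: specht_def)

lemma degree_ratio_ge_1:
  assumes "1 < \<delta>" "\<delta> \<le> \<Delta>"
  shows "1 \<le> degree_ratio \<Delta> \<delta>"
proof -
  have "real \<delta> * (real \<delta> - 1) \<le> real \<Delta> * (real \<Delta> - 1)"
    using assms by (intro mult_mono) auto
  moreover have "0 < real \<delta> * (real \<delta> - 1)" using assms by simp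
  ultimately show ?thesis unfolding degree_ratio_def by simp
qed

lemma degree_sequence_bounds:
  assumes "degree_sequence n d \<Delta> \<delta>" "i \<in> {1..n}"
  shows "\<delta> \<le> d i" "d i \<le> \<Delta>"
  using assms by (auto simp: degree_sequence_def monotone_on_def)

lemma bip_degrees_instance:
  fixes n m \<eta> L :: nat
  assumes "1 < \<delta>u" "1 < \<delta>w" "degree_sequence n d \<Delta>u \<delta>u" "degree_sequence m d' \<Delta>w \<delta>w"
    and "(\<Sum>i=1..n. d i) = \<eta>" "(\<Sum>i=1..m. d' i) = \<eta>"
    and "2 * (L + 2 + 4 * (max \<Delta>u \<Delta>w)\<^sup>2) \<le> \<eta>"
  shows "bip_degrees (Inl ` {1..n} :: (nat + nat) set) (Inr ` {1..m}) (case_sum d d') (max \<Delta>u \<Delta>w) \<eta> L"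
proof
  fix v :: "nat + nat" assume v: "v \<in> Inl ` {1..n} \<union> Inr ` {1..m}"
  show "2 \<le> case_sum d d' v"
    using v degree_sequence_bounds(1)[OF assms(3)] degree_sequence_bounds(1)[OF assms(4)] assms(1,2)
    by (auto simp: numeral_2_eq_2 Suc_le_eq intro: less_le_trans)
  show "case_sum d d' v \<le> max \<Delta>u \<Delta>w"
    using v degree_sequence_bounds(2)[OF assms(3)] degree_sequence_bounds(2)[OF assms(4)]
    by (auto intro: max.coboundedI1 max.coboundedI2)
qed (use assms in \<open>auto simp: sum.reindex\<close>)

lemma bipartite_graphs_eq:
  assumes "bip_degrees (Inl ` {1..n}) (Inr ` {1..m}) (case_sum d d') D \<eta> L"
  shows "bipartite_graphs n d m d' = bip_degrees.graphs (Inl ` {1..n}) (Inr ` {1..m}) (case_sum d d')"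
proof -
  have "{{Inl i, Inr j} | i j. i \<in> {1..n} \<and> j \<in> {1..m}} = bedges (Inl ` {1..n}) (Inr ` {1..m})"
    unfolding bedges_def by blast
  then show ?thesis
    unfolding bipartite_graphs_def bip_degrees.graphs_def[OF assms] by (auto simp: ball_Un)
qed

lemma (in bip_degrees) num_eq_num_cycles:
  assumes "G \<in> graphs"
  shows "num c G = num_cycles c G"
proof -
  have "{C \<in> cycs c. C \<subseteq> G} = {C. is_cycle G c C}"
    using graph_sub[OF assms] by (auto simp: cycs_def is_cycle_iff)
  then show ?thesis by (simp add: num_def num_cycles_def)
qed

text \<open>Since \<open>d v \<ge> 2\<close>, each numerator \<open>d v * (d v - 1)\<close> is at
  least \<open>d v\<close>, and these sum to \<open>\<eta>\<close>. The resulting lower bound on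
  \<open>mean\<close> turns additive errors into relative ones.\<close>

lemma (in bip_degrees) sum_pair_density_ge:
  assumes "A \<subseteq> U \<union> W" "(\<Sum>v\<in>A. d v) = \<eta>"
  shows "1 \<le> sum pair_density A"
proof -
  have "1 = (\<Sum>v\<in>A. real (d v)) / \<eta>" using assms eta_pos by (simp flip: of_nat_sum)
  also have "\<dots> = (\<Sum>v\<in>A. real (d v) * 1 / \<eta>)" by (simp add: sum_divide_distrib)
  also have "\<dots> \<le> sum pair_density A"
    unfolding pair_density_def
  proof (intro sum_mono divide_right_mono mult_left_mono)
    fix v assume "v \<in> A"
    then have "2 \<le> d v" using assms d_ge by auto
    then show "1 \<le> real (d v) - 1" by simp
  qed auto
  finally show ?thesis .
qed

lemma (in bip_degrees) pair_density_product_ge: "1 \<le> sum pair_density U * sum pair_density W"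
  using mult_mono[OF sum_pair_density_ge[OF _ sum_U] sum_pair_density_ge[OF _ sum_W]]
    sum_pair_density_le(2)[OF _ sum_U] by simp

lemma (in bip_degrees) mean_ge: "1 / real c \<le> mean c"
  unfolding mean_def by (intro divide_right_mono one_le_power pair_density_product_ge) simp

lemma real_choose_two: "2 * real (n choose 2) = real n * (real n - 1)"
proof -
  have "even (n * (n - 1))" by (cases n) auto
  then have "2 * (n choose 2) = n * (n - 1)" by (simp add: choose_two)
  then have "real (2 * (n choose 2)) = real (n * (n - 1))" by (rule arg_cong)
  then show ?thesis by (cases n) (auto simp: algebra_simps)
qed

lemma cycle_bound_eq_mean:
  assumes "bip_degrees (Inl ` {1..n}) (Inr ` {1..m}) (case_sum d d') D \<eta> L" "even c"
  shows "cycle_bound \<eta> n d m d' c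
    = bip_degrees.mean (Inl ` {1..n}) (Inr ` {1..m}) (case_sum d d') \<eta> c"
proof -
  interpret bip_degrees "Inl ` {1..n}" "Inr ` {1..m}" "case_sum d d'" D \<eta> L by (rule assms(1))
  have "2 / real \<eta> * (\<Sum>i=1..n. real (f i choose 2)) = (\<Sum>i=1..n. real (f i) * (real (f i) - 1) / \<eta>)"
    for n and f :: "nat \<Rightarrow> nat"
    by (simp add: sum_distrib_left real_choose_two[symmetric])
  moreover have "sum pair_density (Inl ` {1..n}) = (\<Sum>i=1..n. real (d i) * (real (d i) - 1) / \<eta>)"
    "sum pair_density (Inr ` {1..m}) = (\<Sum>i=1..m. real (d' i) * (real (d' i) - 1) / \<eta>)"
    by (simp_all add: sum.reindex pair_density_def)
  ultimately have s: "2 / real \<eta> * (\<Sum>i=1..n. real (d i choose 2)) = sum pair_density (Inl ` {1..n})"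
    "2 / real \<eta> * (\<Sum>i=1..m. real (d' i choose 2)) = sum pair_density (Inr ` {1..m})" by simp_all
  have c: "real c / 2 = real (c div 2)" using assms(2) by (auto elim: evenE)
  show ?thesis
    using pair_density_product_ge unfolding cycle_bound_def s c mean_def by (subst powr_realpow) auto
qed


context bip_degrees begin

text \<open>All ingredients depend on \<open>D\<close> and \<open>L\<close> only, so for a fixed
  list of lengths this is one constant along the whole filter.\<close>

definition moment_error :: "nat \<Rightarrow> real" where
  "moment_error n = n * (mean_bound + cycle_error) ^ n + total_bound ^ (n + 1) * edge_bound * near_bound"

lemma average_falling_approx:
  assumes "set cs \<subseteq> lengths k" "2 * k + length cs * k \<le> L"
  shows "\<bar>average graphs (\<lambda>G. falling_seq (\<lambda>c. num_cycles c G) cs (\<lambda>_. 0)) - (\<Prod>c\<leftarrow>cs. mean c)\<bar>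
    \<le> moment_error (length cs) / \<eta>"
proof -
  have pos: "0 < cnt {}"
    using graphs_nonempty finite_graphs by (simp add: cnt_def card_gt_0_iff)
  have "average graphs (\<lambda>G. falling_seq (\<lambda>c. num_cycles c G) cs (\<lambda>_. 0))
      = (\<Sum>G\<in>graphs. falling_seq (\<lambda>c. num c G) cs (\<lambda>_. 0)) / cnt {}"
    unfolding average_def by (simp add: num_eq_num_cycles cnt_def)
  moreover have "x / cnt {} - y = (x - y * cnt {}) / cnt {}" for x y
    using pos by (simp add: field_simps)
  ultimately have "\<bar>average graphs (\<lambda>G. falling_seq (\<lambda>c. num_cycles c G) cs (\<lambda>_. 0)) - (\<Prod>c\<leftarrow>cs. mean c)\<bar>
      = \<bar>(\<Sum>G\<in>graphs. falling_seq (\<lambda>c. num c G) cs (\<lambda>_. 0)) - (\<Prod>c\<leftarrow>cs. mean c) * cnt {}\<bar> / cnt {}"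
    by (simp only: abs_divide abs_of_pos[OF pos])
  also have "\<dots> \<le> moment_error (length cs) / \<eta> * cnt {} / cnt {}"
    using sum_falling_approx[OF assms] pos unfolding moment_error_def by (intro divide_right_mono) auto
  finally show ?thesis using pos by simp
qed

end

lemma powr_minus_le_1: "1 \<le> x \<Longrightarrow> 0 \<le> a \<Longrightarrow> x powr (- a) \<le> (1::real)"
  using powr_mono[of "- a" 0 x] by simp

text \<open>An abstract index and filter let the degree sequences vary freely with the sizes; a
  sequence of instances is the case of the filter \<open>sequentially\<close>. The constants
  \<open>D\<close> and \<open>L\<close> below do not depend on the index.\<close>

theorem theorem1:
  fixes \<Delta>\<^sub>u \<Delta>\<^sub>w \<delta>\<^sub>u \<delta>\<^sub>w k :: nat
    and F :: "'i filter"
    and n m \<eta> :: "'i \<Rightarrow> nat"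
    and d d' :: "'i \<Rightarrow> nat \<Rightarrow> nat"
  assumes "1 < \<delta>\<^sub>u" and "1 < \<delta>\<^sub>w"
    and "filterlim n at_top F" and "filterlim m at_top F"
    and "\<forall>\<^sub>F t in F. degree_sequence (n t) (d t) \<Delta>\<^sub>u \<delta>\<^sub>u"
    and "\<forall>\<^sub>F t in F. degree_sequence (m t) (d' t) \<Delta>\<^sub>w \<delta>\<^sub>w"
    and "\<forall>\<^sub>F t in F. (\<Sum>i=1..n t. d t i) = \<eta> t \<and> (\<Sum>i=1..m t. d' t i) = \<eta> t"
    and "even k" and "4 \<le> k"
  shows "(\<forall>x :: nat \<Rightarrow> nat.
      ((\<lambda>t. measure_pmf.prob (random_graph (n t) (d t) (m t) (d' t))
               {G. \<forall>c\<in>{c. even c \<and> 4 \<le> c \<and> c \<le> k}. num_cycles c G = x c}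
             - (\<Prod>c | even c \<and> 4 \<le> c \<and> c \<le> k.
                  exp (- expected_cycles (n t) (d t) (m t) (d' t) c) *
                  expected_cycles (n t) (d t) (m t) (d' t) c ^ x c / fact (x c)))
        \<longlongrightarrow> 0) F) \<and>
    (\<forall>c. even c \<and> 4 \<le> c \<and> c \<le> k \<longrightarrow>
      (\<forall>\<epsilon>>0. \<forall>\<^sub>F t in F.
        (1 - \<epsilon>) * (specht (degree_ratio \<Delta>\<^sub>u \<delta>\<^sub>u) * specht (degree_ratio \<Delta>\<^sub>w \<delta>\<^sub>w)) powr (- (real c / 2))
            * cycle_bound (\<eta> t) (n t) (d t) (m t) (d' t) c
          \<le> expected_cycles (n t) (d t) (m t) (d' t) c \<and>
        expected_cycles (n t) (d t) (m t) (d' t) c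
          \<le> (1 + \<epsilon>) * cycle_bound (\<eta> t) (n t) (d t) (m t) (d' t) c))"
proof -
  define D where "D = max \<Delta>\<^sub>u \<Delta>\<^sub>w"
  define A where "A t = bipartite_graphs (n t) (d t) (m t) (d' t)" for t
  define M where "M t c = cycle_bound (\<eta> t) (n t) (d t) (m t) (d' t) c" for t c
  define E where "E t c = expected_cycles (n t) (d t) (m t) (d' t) c" for t c
  let ?T = "lengths k"
  let ?loc = "\<lambda>t. bip_degrees (Inl ` {1..n t} :: (nat + nat) set) (Inr ` {1..m t}) (case_sum (d t) (d' t)) D (\<eta> t)"
  have finT: "finite ?T" by (rule lengths_facts)
  \<comment> \<open>All degrees are at least 1, so growth of \<open>n\<close> forces growth of
    \<open>\<eta>\<close>, the quantity in which all errors are measured.\<close>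
  have "\<forall>\<^sub>F t in F. n t \<le> \<eta> t"
    using assms(5,7)
  proof eventually_elim
    case (elim t)
    have "n t = (\<Sum>i=1..n t. 1)" by simp
    also have "\<dots> \<le> (\<Sum>i=1..n t. d t i)"
      using degree_sequence_bounds(1)[OF elim(1)] assms(1) by (intro sum_mono) force
    finally show ?case using elim(2) by simp
  qed
  then have eta: "filterlim \<eta> at_top F" by (rule filterlim_at_top_mono[OF assms(3)])
  have inst: "\<forall>\<^sub>F t in F. ?loc t L" for L
  proof -
    have "\<forall>\<^sub>F t in F. 2 * (L + 2 + 4 * D\<^sup>2) \<le> \<eta> t" using eta by (simp add: filterlim_at_top)
    with assms(5-7) show ?thesis
    proof eventually_elim
      case (elim t)
      show ?case
        unfolding D_def
        by (rule bip_degrees_instance[OF assms(1,2) elim(1,2) conjunct1[OF elim(3)]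
              conjunct2[OF elim(3)] elim(4)[unfolded D_def]])
    qed
  qed
  have facts: "A t = bip_degrees.graphs (Inl ` {1..n t}) (Inr ` {1..m t}) (case_sum (d t) (d' t))"
    "finite (A t)" "A t \<noteq> {}"
    "\<And>c. c \<in> ?T \<Longrightarrow> M t c = bip_degrees.mean (Inl ` {1..n t}) (Inr ` {1..m t}) (case_sum (d t) (d' t)) (\<eta> t) c"
    if "?loc t L" for t L
  proof -
    show eq: "A t = bip_degrees.graphs (Inl ` {1..n t}) (Inr ` {1..m t}) (case_sum (d t) (d' t))"
      unfolding A_def by (rule bipartite_graphs_eq[OF that])
    show "finite (A t)" "A t \<noteq> {}"
      unfolding eq using bip_degrees.finite_graphs[OF that] bip_degrees.graphs_nonempty[OF that] by auto
    show "\<And>c. c \<in> ?T \<Longrightarrow> M t c = bip_degrees.mean (Inl ` {1..n t}) (Inr ` {1..m t}) (case_sum (d t) (d' t)) (\<eta> t) c"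
      unfolding M_def using cycle_bound_eq_mean[OF that] by (simp add: lengths_def)
  qed
  have mom_list: "((\<lambda>t. average (A t) (\<lambda>G. falling_seq (\<lambda>c. num_cycles c G) cs (\<lambda>_. 0)) - (\<Prod>c\<leftarrow>cs. M t c)) \<longlongrightarrow> 0) F"
    if cs: "set cs \<subseteq> ?T" for cs
  proof -
    define L where "L = 2 * k + length cs * k"
    define K where "K = bip_degrees.moment_error D L (length cs)"
    have "\<forall>\<^sub>F t in F. norm (average (A t) (\<lambda>G. falling_seq (\<lambda>c. num_cycles c G) cs (\<lambda>_. 0)) - (\<Prod>c\<leftarrow>cs. M t c))
        \<le> K / real (\<eta> t)"
      using inst[of L]
    proof eventually_elim
      case (elim t)
      have eq: "map (M t) cs = map (bip_degrees.mean (Inl ` {1..n t}) (Inr ` {1..m t}) (case_sum (d t) (d' t)) (\<eta> t)) cs"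
        using facts(4)[OF elim] cs by (intro map_cong) auto
      show ?case
        unfolding eq using bip_degrees.average_falling_approx[OF elim cs, folded facts(1)[OF elim]]
        by (simp add: L_def K_def)
    qed
    moreover have "((\<lambda>t. K / real (\<eta> t)) \<longlongrightarrow> 0) F"
      by (intro real_tendsto_divide_at_top[OF tendsto_const] filterlim_compose[OF filterlim_real_sequentially eta])
    ultimately show ?thesis by (rule Lim_null_comparison)
  qed
  have mom: "((\<lambda>t. average (A t) (\<lambda>G. \<Prod>c\<in>?T. falling (num_cycles c G) (r c)) - (\<Prod>c\<in>?T. M t c ^ r c)) \<longlongrightarrow> 0) F" for r
  proof -
    obtain cs where cs: "set cs \<subseteq> ?T" "\<forall>c\<in>?T. count_list cs c = r c"
      using ex_list_with_counts[OF finT] by blast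
    have "falling_seq (\<lambda>c. num_cycles c G) cs (\<lambda>_. 0) = (\<Prod>c\<in>?T. falling (num_cycles c G) (r c))"
      for G :: "(nat + nat) set set"
      unfolding falling_seq_eq_prod[OF finT cs(1)] falling_def using cs(2) by (intro prod.cong) auto
    moreover have "(\<Prod>c\<leftarrow>cs. M t c) = (\<Prod>c\<in>?T. M t c ^ r c)" for t
      unfolding prod_list_eq_prod_count[OF finT cs(1)] using cs(2) by (intro prod.cong) auto
    ultimately show ?thesis using mom_list[OF cs(1)] by simp
  qed
  have E_avg: "E t c = average (A t) (\<lambda>G. real (num_cycles c G))" if "?loc t L" for t L c
    unfolding E_def expected_cycles_def random_graph_def average_def A_def[symmetric]
    using facts(2,3)[OF that] by (intro integral_pmf_of_set) auto
  have E_lim: "((\<lambda>t. E t c - M t c) \<longlongrightarrow> 0) F" if "c \<in> ?T" for c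
  proof (rule Lim_transform_eventually)
    show "((\<lambda>t. average (A t) (\<lambda>G. real (num_cycles c G)) - M t c) \<longlongrightarrow> 0) F"
      using mom_list[of "[c]"] that by simp
    show "\<forall>\<^sub>F t in F. average (A t) (\<lambda>G. real (num_cycles c G)) - M t c = E t c - M t c"
      using inst[of 0] by eventually_elim (simp add: E_avg)
  qed
  have E_nonneg: "\<forall>\<^sub>F t in F. 0 \<le> E t c" for c
    using inst[of 0] by eventually_elim (auto simp: E_avg intro: average_nonneg)
  \<comment> \<open>The values \<open>M t c\<close> are at most \<open>mean_bound\<close>, and
    \<open>E t c\<close> is eventually within 1 of \<open>M t c\<close>, hence the summand
    1.\<close>
  define b where "b = bip_degrees.mean_bound D k + 1"
  have bounds: "\<forall>\<^sub>F t in F. \<forall>c\<in>?T. 0 \<le> M t c \<and> M t c \<le> b \<and> 0 \<le> E t c \<and> E t c \<le> b \<and> 1 / real c \<le> M t c \<and> 1 \<le> b"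
  proof (intro eventually_ball_finite finT ballI)
    fix c assume c: "c \<in> ?T"
    have "\<forall>\<^sub>F t in F. dist (E t c - M t c) 0 < 1" by (intro tendstoD[OF E_lim[OF c]]) simp
    with inst[of k] E_nonneg[of c]
    show "\<forall>\<^sub>F t in F. 0 \<le> M t c \<and> M t c \<le> b \<and> 0 \<le> E t c \<and> E t c \<le> b \<and> 1 / real c \<le> M t c \<and> 1 \<le> b"
    proof eventually_elim
      case (elim t)
      have "2 \<le> c" "c \<le> k" using c by (auto simp: lengths_def)
      then have "0 \<le> M t c" "M t c \<le> bip_degrees.mean_bound D k" "1 / real c \<le> M t c"
        unfolding facts(4)[OF elim(1) c]
        using bip_degrees.mean_bounds[OF elim(1)] bip_degrees.mean_ge[OF elim(1)] by blast+
      moreover have "1 \<le> bip_degrees.mean_bound D k" by (rule bip_degrees.mean_bound_ge[OF elim(1)])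
      ultimately show ?case using elim(2,3) unfolding b_def dist_real_def by linarith
    qed
  qed
  show ?thesis
  proof (intro conjI allI impI)
    fix x :: "nat \<Rightarrow> nat"
    show "((\<lambda>t. measure_pmf.prob (random_graph (n t) (d t) (m t) (d' t))
               {G. \<forall>c\<in>{c. even c \<and> 4 \<le> c \<and> c \<le> k}. num_cycles c G = x c}
             - (\<Prod>c | even c \<and> 4 \<le> c \<and> c \<le> k.
                  exp (- expected_cycles (n t) (d t) (m t) (d' t) c) *
                  expected_cycles (n t) (d t) (m t) (d' t) c ^ x c / fact (x c)))
        \<longlongrightarrow> 0) F"
    \<comment> \<open>The inequality \<open>1 \<le> b\<close> is only known eventually along
      \<open>F\<close>. It does not mention \<open>t\<close>, so it holds outright for a proper
      filter; along the trivial filter every limit holds.\<close>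
    proof (cases "F = bot")
      case False
      have b1: "1 \<le> b"
      proof -
        obtain t where "\<forall>c\<in>?T. 1 \<le> b" using eventually_happens'[OF False bounds] by blast
        moreover have "4 \<in> ?T" using assms(9) by (simp add: lengths_def)
        ultimately show ?thesis by blast
      qed
      \<comment> \<open>The moment estimates involve \<open>M\<close>, but the Poisson parameters
        are the expectations \<open>E\<close>. Both are bounded and their difference vanishes, so
        powers of one may replace powers of the other.\<close>
      have pow: "((\<lambda>t. M t c ^ j - E t c ^ j) \<longlongrightarrow> 0) F" if c: "c \<in> ?T" for c j
      proof -
        have "((\<lambda>t. (\<Prod>i<j. M t c) - (\<Prod>i<j. E t c)) \<longlongrightarrow> 0) F"
        proof (rule prod_diff_tendsto_0)
          show "((\<lambda>t. M t c - E t c) \<longlongrightarrow> 0) F" using tendsto_minus[OF E_lim[OF c]] by simp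
          show "\<forall>\<^sub>F t in F. \<forall>i\<in>{..<j}. \<bar>M t c\<bar> \<le> b \<and> \<bar>E t c\<bar> \<le> b"
            using bounds by eventually_elim (use c in auto)
        qed (use b1 in auto)
        then show ?thesis by simp
      qed
      have momE: "((\<lambda>t. average (A t) (\<lambda>G. \<Prod>c\<in>?T. falling (num_cycles c G) (r c)) - (\<Prod>c\<in>?T. E t c ^ r c)) \<longlongrightarrow> 0) F" for r
      proof -
        have "((\<lambda>t. (\<Prod>c\<in>?T. M t c ^ r c) - (\<Prod>c\<in>?T. E t c ^ r c)) \<longlongrightarrow> 0) F"
        proof (rule prod_diff_tendsto_0[OF finT pow])
          show "\<forall>\<^sub>F t in F. \<forall>c\<in>?T. \<bar>M t c ^ r c\<bar> \<le> b ^ sum r ?T \<and> \<bar>E t c ^ r c\<bar> \<le> b ^ sum r ?T"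
            using bounds
          proof eventually_elim
            case (elim t)
            have "y ^ r c \<le> b ^ sum r ?T" if "c \<in> ?T" "0 \<le> y" "y \<le> b" for c y
            proof -
              have "y ^ r c \<le> b ^ r c" using that by (intro power_mono)
              also have "\<dots> \<le> b ^ sum r ?T"
                using that finT b1 by (intro power_increasing member_le_sum) auto
              finally show ?thesis .
            qed
            then show ?case using elim by (auto simp: power_abs)
          qed
        qed (use b1 in auto)
        from tendsto_add[OF mom[of r] this] show ?thesis by simp
      qed
      have "((\<lambda>t. average (A t) (\<lambda>G. of_bool (\<forall>c\<in>?T. num_cycles c G = x c)) - (\<Prod>c\<in>?T. poisson (E t c) (x c))) \<longlongrightarrow> 0) F"
      proof (rule factorial_moments_imp_poisson[OF finT b1 _ momE])
        show "\<forall>\<^sub>F t in F. \<forall>c\<in>?T. 0 \<le> E t c \<and> E t c \<le> b"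
          using bounds by eventually_elim auto
      qed
      moreover have "\<forall>\<^sub>F t in F. average (A t) (\<lambda>G. of_bool (\<forall>c\<in>?T. num_cycles c G = x c))
          = measure_pmf.prob (random_graph (n t) (d t) (m t) (d' t)) {G. \<forall>c\<in>?T. num_cycles c G = x c}"
        using inst[of 0]
      proof eventually_elim
        case (elim t)
        show ?case
          unfolding random_graph_def A_def[symmetric] average_def
          using facts(2,3)[OF elim] by (simp add: measure_pmf_of_set)
      qed
      ultimately have "((\<lambda>t. measure_pmf.prob (random_graph (n t) (d t) (m t) (d' t)) {G. \<forall>c\<in>?T. num_cycles c G = x c}
          - (\<Prod>c\<in>?T. poisson (E t c) (x c))) \<longlongrightarrow> 0) F"
        by (rule Lim_transform_eventually[OF _ eventually_mono]) simp
      then show ?thesis unfolding lengths_def poisson_def E_def .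
    qed simp
  next
    fix c :: nat and \<epsilon> :: real
    assume c: "even c \<and> 4 \<le> c \<and> c \<le> k" and e: "0 < \<epsilon>"
    then have cT: "c \<in> ?T" and c0: "0 < real c" by (auto simp: lengths_def)
    define s where "s = (specht (degree_ratio \<Delta>\<^sub>u \<delta>\<^sub>u) * specht (degree_ratio \<Delta>\<^sub>w \<delta>\<^sub>w)) powr (- (real c / 2))"
    \<comment> \<open>The tolerance \<open>\<epsilon> / c\<close> is at most
      \<open>\<epsilon> * M t c\<close>, because \<open>M t c\<close> is at least
      \<open>1 / c\<close>.\<close>
    have "\<forall>\<^sub>F t in F. dist (E t c - M t c) 0 < \<epsilon> / c"
      using e c0 by (intro tendstoD[OF E_lim[OF cT]]) simp
    with bounds assms(5,6)
    have "\<forall>\<^sub>F t in F. (1 - \<epsilon>) * s * M t c \<le> E t c \<and> E t c \<le> (1 + \<epsilon>) * M t c"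
    proof eventually_elim
      case (elim t)
      have M: "0 \<le> M t c" "1 / real c \<le> M t c" "0 \<le> E t c" using elim(1) cT by auto
      have "\<epsilon> / c \<le> \<epsilon> * M t c" using mult_left_mono[OF M(2), of \<epsilon>] e by simp
      then have diff: "\<bar>E t c - M t c\<bar> \<le> \<epsilon> * M t c" using elim(4) by (simp add: dist_real_def)
      have "1 \<le> n t" "1 \<le> m t" "d t 1 = \<Delta>\<^sub>u" "d' t 1 = \<Delta>\<^sub>w"
        using elim(2,3) by (auto simp: degree_sequence_def)
      then have "\<delta>\<^sub>u \<le> \<Delta>\<^sub>u" "\<delta>\<^sub>w \<le> \<Delta>\<^sub>w"
        using degree_sequence_bounds(1)[OF elim(2), of 1] degree_sequence_bounds(1)[OF elim(3), of 1] by auto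
      then have S: "1 \<le> specht (degree_ratio \<Delta>\<^sub>u \<delta>\<^sub>u)" "1 \<le> specht (degree_ratio \<Delta>\<^sub>w \<delta>\<^sub>w)"
        using assms(1,2) by (auto intro!: specht_ge_1 degree_ratio_ge_1)
      have "1 * 1 \<le> specht (degree_ratio \<Delta>\<^sub>u \<delta>\<^sub>u) * specht (degree_ratio \<Delta>\<^sub>w \<delta>\<^sub>w)"
        using S by (intro mult_mono) auto
      then have s: "0 \<le> s" "s \<le> 1" unfolding s_def by (auto intro: powr_minus_le_1)
      have "(1 - \<epsilon>) * s * M t c \<le> E t c"
      \<comment> \<open>For \<open>\<epsilon> > 1\<close> the factor \<open>1 - \<epsilon>\<close>
        is negative, so \<open>s \<le> 1\<close> can no longer be used for monotonicity, but then
        the left side is at most 0.\<close>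
      proof (cases "\<epsilon> \<le> 1")
        case True
        then have "(1 - \<epsilon>) * s * M t c \<le> (1 - \<epsilon>) * 1 * M t c"
          using s M by (intro mult_right_mono mult_left_mono) auto
        also have "\<dots> = M t c - \<epsilon> * M t c" by (simp add: algebra_simps)
        finally show ?thesis using diff by linarith
      next
        case False
        then have "(1 - \<epsilon>) * s * M t c \<le> 0"
          using s M by (intro mult_nonpos_nonneg) auto
        then show ?thesis using M by linarith
      qed
      moreover have "E t c \<le> (1 + \<epsilon>) * M t c" using diff by (simp add: algebra_simps)
      ultimately show ?case by blast
    qed
    then show "\<forall>\<^sub>F t in F.
        (1 - \<epsilon>) * (specht (degree_ratio \<Delta>\<^sub>u \<delta>\<^sub>u) * specht (degree_ratio \<Delta>\<^sub>w \<delta>\<^sub>w)) powr (- (real c / 2))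
            * cycle_bound (\<eta> t) (n t) (d t) (m t) (d' t) c
          \<le> expected_cycles (n t) (d t) (m t) (d' t) c \<and>
        expected_cycles (n t) (d t) (m t) (d' t) c
          \<le> (1 + \<epsilon>) * cycle_bound (\<eta> t) (n t) (d t) (m t) (d' t) c"
      unfolding s_def M_def E_def .
  qed
qed

end
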